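(* Let $k$ be a field, let $q\in k$ be a root of unity, say a primitive $r$-th root of unity (so $r\ge 1$ is the multiplicative order of $q$), and let $\Lambda=\Lambda_q=k\langle x,y\rangle/(x^2,\,xy+qyx,\,y^2)$. Then the Hilbert series $h(t)=\sum_{i\ge 0}\dim_k \mathrm{HH}^i(\Lambda)\,t^i$ of the Hochschild cohomology of $\Lambda$ over $k$ is as follows. (1) If $r>1$ is odd and $\mathrm{char}\,k\neq 2$, then $h(t)=1+\dfrac{(1+t)^2(1+t^{2r})}{(1-t^{2r})^2}$. (2) If $\mathrm{char}\,k=2$ and $q\neq 1$, or if $\mathrm{char}\,k\neq 2$ and $r>2$ is even, then $h(t)=1+\dfrac{(1+t)^2}{(1-t^{r})^2}$. (3) If $\mathrm{char}\,k=2$ and $q=1$, then $h(t)=\dfrac{4}{(1-t)^2}$. (4) If $\mathrm{char}\,k\neq 2$ and $q=-1$, then $h(t)=\dfrac{4-4t+t^2}{(1-t)^2}$. (5) If $\mathrm{char}\,k\neq 2$ and $q=1$, then $h(t)=\dfrac{2}{(1-t)^2}$.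
   Context: $k\langle x,y\rangle$ is the free associative (non-commutative) $k$-algebra on $x,y$, and $(\dots)$ denotes the two-sided ideal generated by the listed elements. The enveloping algebra is $\Lambda^e=\Lambda^{\mathrm{op}}\otimes_k\Lambda$, and $\mathrm{HH}^i(\Lambda)=\mathrm{Ext}^i_{\Lambda^e}(\Lambda,\Lambda)$. *)

theory Defs
  imports
    "HOL-Algebra.QuotRing"
    "HOL-Computational_Algebra.Formal_Power_Series"
    "Jordan_Normal_Form.VS_Connect"
begin

hide_const (open) Multiset.mult Polynomial.smult Modules.module

text \<open>
  The ground field is a type \<open>'k\<close> of class \<open>field\<close>. A \<open>'k\<close>-algebra is a record of type
  \<open>('k, 'a) module\<close>, i.e. a ring record together with a scalar multiplication.
\<close>

definition delta :: "'g \<Rightarrow> 'g \<Rightarrow> 'k::field"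
  where "delta g = (\<lambda>h. if h = g then 1 else 0)"

definition monoid_algebra :: "('g, 'm) monoid_scheme \<Rightarrow> ('k::field, 'g \<Rightarrow> 'k) module"
  where "monoid_algebra G =
    \<lparr>carrier = {f. finite {g. f g \<noteq> 0} \<and> {g. f g \<noteq> 0} \<subseteq> carrier G},
     mult = (\<lambda>f f' h. \<Sum>a\<in>{g. f g \<noteq> 0}. \<Sum>b\<in>{g. f' g \<noteq> 0}.
               if a \<otimes>\<^bsub>G\<^esub> b = h then f a * f' b else 0),
     one = delta \<one>\<^bsub>G\<^esub>,
     zero = (\<lambda>_. 0),
     add = (\<lambda>f f' h. f h + f' h),
     smult = (\<lambda>c f h. c * f h)\<rparr>"

text \<open>
  \<open>quotient A I\<close> is \<open>A Quot I\<close> with the induced scalar multiplication. It is used for the quotient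
  of an algebra by a two-sided ideal and for the quotient of a vector space by a subspace; in the
  latter case the fields \<open>mult\<close> and \<open>one\<close> are meaningless.
\<close>

definition quotient :: "('k, 'a) module \<Rightarrow> 'a set \<Rightarrow> ('k, 'a set) module"
  where "quotient A I =
    \<lparr>carrier = carrier (A Quot I), mult = mult (A Quot I), one = one (A Quot I),
     zero = zero (A Quot I), add = add (A Quot I),
     smult = (\<lambda>c X. \<Union>x\<in>X. I +>\<^bsub>A\<^esub> (c \<odot>\<^bsub>A\<^esub> x))\<rparr>"

definition opposite :: "('k, 'a) module \<Rightarrow> ('k, 'a) module"
  where "opposite A = A\<lparr>mult := (\<lambda>a b. b \<otimes>\<^bsub>A\<^esub> a)\<rparr>"

text \<open>
  The tensor product over \<open>'k\<close> of two unital algebras: the space with basis \<open>A \<times> B\<close>, with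
  \<open>(a, b) (a', b') = (a a', b b')\<close>, modulo the bilinearity relations. The span of these relations
  is stable under multiplication by basis elements on both sides, so it is equal to the ideal
  they generate.
\<close>

definition tensor_relations :: "('k::field, 'a) module \<Rightarrow> ('k, 'b) module \<Rightarrow> ('a \<times> 'b \<Rightarrow> 'k) set"
  where "tensor_relations A B =
    {\<lambda>p. delta (a \<oplus>\<^bsub>A\<^esub> a', b) p - delta (a, b) p - delta (a', b) p | a a' b.
       a \<in> carrier A \<and> a' \<in> carrier A \<and> b \<in> carrier B} \<union>
    {\<lambda>p. delta (a, b \<oplus>\<^bsub>B\<^esub> b') p - delta (a, b) p - delta (a, b') p | a b b'.
       a \<in> carrier A \<and> b \<in> carrier B \<and> b' \<in> carrier B} \<union>
    {\<lambda>p. delta (c \<odot>\<^bsub>A\<^esub> a, b) p - c * delta (a, b) p | c a b.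
       a \<in> carrier A \<and> b \<in> carrier B} \<union>
    {\<lambda>p. delta (a, c \<odot>\<^bsub>B\<^esub> b) p - c * delta (a, b) p | c a b.
       a \<in> carrier A \<and> b \<in> carrier B}"

definition tensor_algebra ::
    "('k::field, 'a) module \<Rightarrow> ('k, 'b) module \<Rightarrow> ('k, ('a \<times> 'b \<Rightarrow> 'k) set) module"
  where "tensor_algebra A B =
    quotient (monoid_algebra (A \<times>\<times> B)) (Idl\<^bsub>monoid_algebra (A \<times>\<times> B)\<^esub> (tensor_relations A B))"

definition enveloping ::
    "('k::field, 'a) module \<Rightarrow> ('k, ('a \<times> 'a \<Rightarrow> 'k) set) module"
  where "enveloping A = tensor_algebra (opposite A) A"

text \<open>
  The library locale \<open>module\<close> requires a commutative ring of scalars. For left modules over an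
  arbitrary ring the same record type and the library definition of \<open>module_hom\<close> are used.
\<close>

locale left_module = R?: ring R + M?: abelian_group M
  for R :: "('r, 'e) ring_scheme" (structure) and M :: "('r, 'm, 'f) module_scheme" (structure) +
  assumes smult_closed:
      "\<lbrakk>a \<in> carrier R; x \<in> carrier M\<rbrakk> \<Longrightarrow> a \<odot>\<^bsub>M\<^esub> x \<in> carrier M"
    and smult_l_distr:
      "\<lbrakk>a \<in> carrier R; b \<in> carrier R; x \<in> carrier M\<rbrakk> \<Longrightarrow>
        (a \<oplus> b) \<odot>\<^bsub>M\<^esub> x = a \<odot>\<^bsub>M\<^esub> x \<oplus>\<^bsub>M\<^esub> b \<odot>\<^bsub>M\<^esub> x"
    and smult_r_distr:
      "\<lbrakk>a \<in> carrier R; x \<in> carrier M; y \<in> carrier M\<rbrakk> \<Longrightarrow>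
        a \<odot>\<^bsub>M\<^esub> (x \<oplus>\<^bsub>M\<^esub> y) = a \<odot>\<^bsub>M\<^esub> x \<oplus>\<^bsub>M\<^esub> a \<odot>\<^bsub>M\<^esub> y"
    and smult_assoc:
      "\<lbrakk>a \<in> carrier R; b \<in> carrier R; x \<in> carrier M\<rbrakk> \<Longrightarrow>
        (a \<otimes> b) \<odot>\<^bsub>M\<^esub> x = a \<odot>\<^bsub>M\<^esub> (b \<odot>\<^bsub>M\<^esub> x)"
    and smult_one:
      "x \<in> carrier M \<Longrightarrow> \<one> \<odot>\<^bsub>M\<^esub> x = x"

definition free_module :: "('r, 'e) ring_scheme \<Rightarrow> 's set \<Rightarrow> ('r, 's \<Rightarrow> 'r) module"
  where "free_module R S =
    \<lparr>carrier = {f. f \<in> S \<rightarrow> carrier R \<and> (\<forall>s. s \<notin> S \<longrightarrow> f s = \<zero>\<^bsub>R\<^esub>) \<and> finite {s. f s \<noteq> \<zero>\<^bsub>R\<^esub>}},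
     mult = undefined, one = undefined,
     zero = (\<lambda>_. \<zero>\<^bsub>R\<^esub>),
     add = (\<lambda>f g s. f s \<oplus>\<^bsub>R\<^esub> g s),
     smult = (\<lambda>a f s. a \<otimes>\<^bsub>R\<^esub> f s)\<rparr>"

text \<open>
  Projective means direct summand of a free module. A set of generators can be chosen inside the
  module, so it suffices to consider free modules on sets of elements of type \<open>'p\<close>.
\<close>

definition projective :: "('r, 'e) ring_scheme \<Rightarrow> ('r, 'p) module \<Rightarrow> bool"
  where "projective R P \<longleftrightarrow> left_module R P \<and>
    (\<exists>S :: 'p set. \<exists>\<iota> \<in> module_hom R P (free_module R S). \<exists>\<pi> \<in> module_hom R (free_module R S) P.
       \<forall>x \<in> carrier P. \<pi> (\<iota> x) = x)"

definition projective_resolution ::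
    "('r, 'e) ring_scheme \<Rightarrow> ('r, 'm) module \<Rightarrow>
     (nat \<Rightarrow> ('r, 'p) module) \<Rightarrow> (nat \<Rightarrow> 'p \<Rightarrow> 'p) \<Rightarrow> ('p \<Rightarrow> 'm) \<Rightarrow> bool"
  where "projective_resolution R M P d \<epsilon> \<longleftrightarrow>
    (\<forall>n. projective R (P n)) \<and>
    (\<forall>n. d n \<in> module_hom R (P (Suc n)) (P n)) \<and>
    \<epsilon> \<in> module_hom R (P 0) M \<and>
    \<epsilon> ` carrier (P 0) = carrier M \<and>
    d 0 ` carrier (P (Suc 0)) = {x \<in> carrier (P 0). \<epsilon> x = \<zero>\<^bsub>M\<^esub>} \<and>
    (\<forall>n. d (Suc n) ` carrier (P (Suc (Suc n))) =
         {x \<in> carrier (P (Suc n)). d n x = \<zero>\<^bsub>P n\<^esub>})"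

text \<open>
  For left modules \<open>M\<close>, \<open>N\<close> over a \<open>'k\<close>-algebra \<open>A\<close>, the \<open>'k\<close>-space \<open>Hom_A(M, N)\<close>. A
  homomorphism is represented by the function that is \<open>undefined\<close> outside \<open>carrier M\<close>.
\<close>

definition Hom_space ::
    "('k, 'a) module \<Rightarrow> ('a, 'm) module \<Rightarrow> ('a, 'n) module \<Rightarrow> ('k, 'm \<Rightarrow> 'n) module"
  where "Hom_space A M N =
    \<lparr>carrier = module_hom A M N \<inter> extensional (carrier M),
     mult = undefined, one = undefined,
     zero = (\<lambda>x\<in>carrier M. \<zero>\<^bsub>N\<^esub>),
     add = (\<lambda>f g. \<lambda>x\<in>carrier M. f x \<oplus>\<^bsub>N\<^esub> g x),
     smult = (\<lambda>c f. \<lambda>x\<in>carrier M. (c \<odot>\<^bsub>A\<^esub> \<one>\<^bsub>A\<^esub>) \<odot>\<^bsub>N\<^esub> f x)\<rparr>"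

definition cocycles :: "(nat \<Rightarrow> ('k, 'c) module) \<Rightarrow> (nat \<Rightarrow> 'c \<Rightarrow> 'c) \<Rightarrow> nat \<Rightarrow> 'c set"
  where "cocycles C \<delta> n = {f \<in> carrier (C n). \<delta> n f = \<zero>\<^bsub>C (Suc n)\<^esub>}"

definition coboundaries :: "(nat \<Rightarrow> ('k, 'c) module) \<Rightarrow> (nat \<Rightarrow> 'c \<Rightarrow> 'c) \<Rightarrow> nat \<Rightarrow> 'c set"
  where "coboundaries C \<delta> n =
    (case n of 0 \<Rightarrow> {\<zero>\<^bsub>C 0\<^esub>} | Suc m \<Rightarrow> \<delta> m ` carrier (C m))"

definition cohomology ::
    "(nat \<Rightarrow> ('k, 'c) module) \<Rightarrow> (nat \<Rightarrow> 'c \<Rightarrow> 'c) \<Rightarrow> nat \<Rightarrow> ('k, 'c set) module"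
  where "cohomology C \<delta> n = quotient ((C n)\<lparr>carrier := cocycles C \<delta> n\<rparr>) (coboundaries C \<delta> n)"

text \<open>
  \<open>Ext A M N n\<close> is the \<open>n\<close>-th cohomology of \<open>Hom_A(P, N)\<close> for a chosen projective resolution \<open>P\<close>
  of \<open>M\<close>. The resolution is taken in the type \<open>('a + 'm) list \<Rightarrow> 'a\<close>, which is large enough: the
  type \<open>('a + 'm) list\<close> is infinite and not smaller than \<open>'a\<close> or \<open>'m\<close>, so the free module on it has
  at most as many elements, and therefore maps onto \<open>M\<close> and onto each of its own submodules.
\<close>

definition Ext ::
    "('k, 'a) module \<Rightarrow> ('a, 'm) module \<Rightarrow> ('a, 'n) module \<Rightarrow> nat \<Rightarrow>
     ('k, ((('a + 'm) list \<Rightarrow> 'a) \<Rightarrow> 'n) set) module"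
  where "Ext A M N n =
    (let (P, d, \<epsilon>) = (SOME (P, d, \<epsilon>). projective_resolution A M P d \<epsilon>)
     in cohomology (\<lambda>i. Hom_space A (P i) N)
          (\<lambda>i f. \<lambda>x\<in>carrier (P (Suc i)). f (d i x)) n)"

text \<open>
  \<open>A\<close> as a left module over its enveloping algebra, \<open>(a \<otimes> b) m = b m a\<close>. An element \<open>u\<close> of
  \<open>enveloping A\<close> is a coset, and the value is the same for all representatives \<open>f \<in> u\<close>.
\<close>

definition regular_bimodule ::
    "('k::field, 'a) module \<Rightarrow> (('a \<times> 'a \<Rightarrow> 'k) set, 'a) module"
  where "regular_bimodule A =
    \<lparr>carrier = carrier A, mult = mult A, one = one A, zero = zero A, add = add A,
     smult = (\<lambda>u m. the_elem
       ((\<lambda>f. \<Oplus>\<^bsub>A\<^esub>p\<in>{p. f p \<noteq> 0}. f p \<odot>\<^bsub>A\<^esub> (snd p \<otimes>\<^bsub>A\<^esub> m \<otimes>\<^bsub>A\<^esub> fst p)) ` u))\<rparr>"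

definition HH
  where "HH (A :: ('k::field, 'a) module) n = Ext (enveloping A) (regular_bimodule A) (regular_bimodule A) n"

definition hilbert_series :: "(nat \<Rightarrow> ('k::field, 'v) module) \<Rightarrow> rat fps"
  where "hilbert_series V = Abs_fps (\<lambda>n. of_nat (vectorspace.dim class_ring (V n)))"

datatype gen = X | Y

definition word_monoid :: "gen list monoid"
  where "word_monoid = \<lparr>carrier = UNIV, mult = (@), one = []\<rparr>"

definition free_algebra :: "('k::field, gen list \<Rightarrow> 'k) module"
  where "free_algebra = monoid_algebra word_monoid"

definition Lambda :: "'k::field \<Rightarrow> ('k, (gen list \<Rightarrow> 'k) set) module"
  where "Lambda q =
    (let F = free_algebra; x = delta [X]; y = delta [Y]
     in quotient F (Idl\<^bsub>F\<^esub> {x \<otimes>\<^bsub>F\<^esub> x, x \<otimes>\<^bsub>F\<^esub> y \<oplus>\<^bsub>F\<^esub> q \<odot>\<^bsub>F\<^esub> (y \<otimes>\<^bsub>F\<^esub> x), y \<otimes>\<^bsub>F\<^esub> y}))"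

end

theory Submission
  imports Defs
begin

text \<open>
  In the basis \<open>1, x, y, y x\<close> of \<open>\<Lambda>\<close>, the minimal projective bimodule resolution of \<open>\<Lambda>\<close> is its Koszul
  resolution, with \<open>n + 1\<close> free generators in degree \<open>n\<close>; its exactness is witnessed by an explicit
  contracting homotopy that is linear for the right action only. Since projective resolutions are
  homotopy equivalent, Ext can be computed from it although its definition chooses an arbitrary one.
  All maps of the resulting complex are homogeneous for the bigrading by the degrees in \<open>x\<close> and \<open>y\<close>, so
  that the complex splits into squares \<open>k \<rightarrow> k\<^sup>2 \<rightarrow> k\<close> and edges \<open>k \<rightarrow> k\<close>. Each of them is exact or has zero
  differential, according to whether certain powers of \<open>q\<close> are equal to \<open>\<plusminus>1\<close>; counting the latter
  gives the Hilbert series.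
\<close>

text \<open>The elements of \<open>Lambda q\<close> and of its enveloping algebra are cosets, and
  two cosets can be told apart only once the ideals are known exactly. Both algebras are therefore
  identified with concrete types of coordinates: evaluation shows that the ideal lies in a kernel, a
  linear section built from normal forms that it is the whole kernel. After this, d d = 0, the
  homotopy identity and the differential of the Hom complex are polynomial identities in
  coordinates, q and a sign.

  A cohomology space is measured by linear coordinates on its cocycles whose common kernel is the
  space of coboundaries; these can be pulled back to whatever resolution \<open>Ext\<close> chooses.

  A square with zero differential that starts in degree n contributes t^n (1 + t)^2 to h(t), such an
  edge t^n (1 + t), and y x in degree 0 contributes 1. Hence h(t) = 1 + (1 + t)^2 G(t) + 2 (1 + t)
  E(t), where G counts pairs of exponents (u, v), and E, which counts pairs of edges, is nonzero
  only if q is 1 or -1. This is the reason for the common form of the generic cases and for the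
  exceptional ones.\<close>

section \<open>Dimension of a quotient space\<close>

text \<open>The functionals given by \<open>\<theta>\<close> have common kernel \<open>B\<close> and
  are jointly surjective, so they identify the quotient with the functions on \<open>I\<close>.
  \<open>fin_dim\<close> is proved along with the dimension because \<open>dim\<close> is meaningful
  only for spaces of finite dimension.\<close>

lemma quotient_dim:
  fixes W :: "('k::field, 'v) module" and \<theta> :: "'v \<Rightarrow> 'i \<Rightarrow> 'k"
  assumes W: "Module.module class_ring W" and BW: "B \<subseteq> carrier W" and I: "finite I"
    and add: "\<And>x y i. x \<in> carrier W \<Longrightarrow> y \<in> carrier W \<Longrightarrow> i \<in> I \<Longrightarrow> \<theta> (x \<oplus>\<^bsub>W\<^esub> y) i = \<theta> x i + \<theta> y i"
    and smult: "\<And>c x i. x \<in> carrier W \<Longrightarrow> i \<in> I \<Longrightarrow> \<theta> (c \<odot>\<^bsub>W\<^esub> x) i = c * \<theta> x i"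
    and ker: "\<And>x. x \<in> carrier W \<Longrightarrow> x \<in> B \<longleftrightarrow> (\<forall>i\<in>I. \<theta> x i = 0)"
    and surj: "\<And>t. \<exists>x\<in>carrier W. \<forall>i\<in>I. \<theta> x i = t i"
  shows "vectorspace.fin_dim class_ring (quotient W B) \<and> vectorspace.dim class_ring (quotient W B) = card I"
proof -
  interpret W: Module.module "class_ring :: 'k ring" W by fact
  have \<theta>0: "\<theta> \<zero>\<^bsub>W\<^esub> i = 0" if "i \<in> I" for i
    using smult[of "\<zero>\<^bsub>W\<^esub>" i 0] that W.smult_r_null[of 0] by simp
  have \<theta>m: "\<theta> (\<ominus>\<^bsub>W\<^esub> x) i = - \<theta> x i" if "i \<in> I" "x \<in> carrier W" for x i
    using add[of "\<ominus>\<^bsub>W\<^esub> x" x i] that \<theta>0 by (simp add: W.l_neg eq_neg_iff_add_eq_0)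
  have subg: "subgroup B (add_monoid W)"
  proof (rule W.add.subgroupI)
    show "B \<subseteq> carrier W" by fact
    show "B \<noteq> {}" using ker[of "\<zero>\<^bsub>W\<^esub>"] \<theta>0 by auto
    fix a b assume ab: "a \<in> B" "b \<in> B"
    then have "a \<in> carrier W" "b \<in> carrier W" using BW by auto
    then show "\<ominus>\<^bsub>W\<^esub> a \<in> B" "a \<oplus>\<^bsub>W\<^esub> b \<in> B" using ab by (auto simp: ker \<theta>m add)
  qed
  interpret B: abelian_subgroup B W
    using subg by (intro abelian_subgroupI3 additive_subgroup.intro W.abelian_group_axioms)
  let ?c = "\<lambda>x. B +>\<^bsub>W\<^esub> x"
  let ?Q = "quotient W B"
  have eq: "?c x = ?c y \<longleftrightarrow> (\<forall>i\<in>I. \<theta> x i = \<theta> y i)" if "x \<in> carrier W" "y \<in> carrier W" for x y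
  proof -
    have "?c x = ?c y \<longleftrightarrow> x \<ominus>\<^bsub>W\<^esub> y \<in> B"
      using that B.a_rcos_module[of y x] B.a_repr_independence'[of x y]
        B.a_rcos_self[of x] by (auto simp: a_minus_def)
    also have "\<dots> \<longleftrightarrow> (\<forall>i\<in>I. \<theta> (x \<oplus>\<^bsub>W\<^esub> \<ominus>\<^bsub>W\<^esub> y) i = 0)"
      using that by (simp add: a_minus_def ker)
    also have "\<dots> \<longleftrightarrow> (\<forall>i\<in>I. \<theta> x i = \<theta> y i)"
      using that by (simp add: add \<theta>m)
    finally show ?thesis .
  qed
  have Qc: "carrier ?Q = ?c ` carrier W"
    by (auto simp: quotient_def FactRing_def A_RCOSETS_defs a_r_coset_def)
  have Qadd: "?c x \<oplus>\<^bsub>?Q\<^esub> ?c y = ?c (x \<oplus>\<^bsub>W\<^esub> y)" if "x \<in> carrier W" "y \<in> carrier W" for x y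
    using that by (simp add: quotient_def FactRing_def B.a_rcos_sum)
  have Q0: "\<zero>\<^bsub>?Q\<^esub> = ?c \<zero>\<^bsub>W\<^esub>"
    using W.a_coset_add_zero BW by (simp add: quotient_def FactRing_def)
  have Qsm: "r \<odot>\<^bsub>?Q\<^esub> ?c x = ?c (r \<odot>\<^bsub>W\<^esub> x)" if "x \<in> carrier W" for r x
  proof -
    \<comment> \<open>Scalar multiplication in \<open>quotient\<close> is a union over all
      representatives. It collapses to one coset because every representative yields the same
      one.\<close>
    have "?c (r \<odot>\<^bsub>W\<^esub> x') = ?c (r \<odot>\<^bsub>W\<^esub> x)" if x': "x' \<in> ?c x" for x'
    proof -
      have c: "x' \<in> carrier W" using x' \<open>x \<in> carrier W\<close> B.a_elemrcos_carrier by blast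
      have "?c x' = ?c x" using x' \<open>x \<in> carrier W\<close> by (metis B.a_repr_independence')
      then show ?thesis using c \<open>x \<in> carrier W\<close> eq by (simp add: smult)
    qed
    then have "(\<Union>x'\<in>?c x. ?c (r \<odot>\<^bsub>W\<^esub> x')) = (\<Union>x'\<in>?c x. ?c (r \<odot>\<^bsub>W\<^esub> x))"
      by (intro SUP_cong) simp_all
    also have "\<dots> = ?c (r \<odot>\<^bsub>W\<^esub> x)"
      using B.a_rcos_self[OF that] by (simp only: UN_constant) (auto split: if_splits)
    finally show ?thesis by (simp add: quotient_def)
  qed
  have ab: "abelian_group ?Q"
  proof (rule abelian_groupI)
    fix X assume "X \<in> carrier ?Q"
    then obtain x where x: "x \<in> carrier W" "X = ?c x" by (auto simp: Qc)
    then show "\<exists>Y\<in>carrier ?Q. Y \<oplus>\<^bsub>?Q\<^esub> X = \<zero>\<^bsub>?Q\<^esub>"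
      by (intro bexI[of _ "?c (\<ominus>\<^bsub>W\<^esub> x)"]) (auto simp: Qc Qadd Q0 W.l_neg)
  qed (auto simp: Qc Qadd Q0 W.a_ac)
  have mod: "Module.module class_ring ?Q"
    by (rule moduleI) (use ab class_cring.cring_axioms in \<open>auto simp: Qc Qadd Qsm W.smult_l_distr[simplified] 
       W.smult_r_distr[simplified] W.smult_assoc1[simplified] W.smult_one[simplified] W.smult_closed[simplified]\<close>)
  interpret Q: Module.module "class_ring :: 'k ring" ?Q by fact
  interpret Q: vectorspace "class_ring :: 'k ring" ?Q
    by (intro vectorspace.intro mod class_field.field_axioms)
  \<comment> \<open>Vectors dual to the functionals; their cosets will form the basis.\<close>
  define e where "e i = (SOME x. x \<in> carrier W \<and> (\<forall>j\<in>I. \<theta> x j = (if j = i then 1 else 0)))" for i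
  have e: "e i \<in> carrier W \<and> (\<forall>j\<in>I. \<theta> (e i) j = (if j = i then 1 else 0))" for i
    unfolding e_def by (rule someI_ex) (use surj[of "\<lambda>j. if j = i then 1 else 0"] in auto)
  define q where "q i = ?c (e i)" for i
  have inj: "inj_on q I"
    unfolding inj_on_def q_def using e by (metis eq zero_neq_one)
  have qQ: "q i \<in> carrier ?Q" for i using e by (auto simp: q_def Qc)
  have comb: "\<exists>x\<in>carrier W. (\<Oplus>\<^bsub>?Q\<^esub>i\<in>J. a i \<odot>\<^bsub>?Q\<^esub> q i) = ?c x \<and> (\<forall>j\<in>I. \<theta> x j = (if j \<in> J then a j else 0))"
    if "J \<subseteq> I" for a J
    using finite_subset[OF that I] that
  proof (induction J rule: finite_induct)
    case empty
    then show ?case using \<theta>0 by (intro bexI[of _ "\<zero>\<^bsub>W\<^esub>"]) (auto simp: Q0)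
  next
    case (insert k J)
    then obtain x where x: "x \<in> carrier W" "(\<Oplus>\<^bsub>?Q\<^esub>i\<in>J. a i \<odot>\<^bsub>?Q\<^esub> q i) = ?c x" "\<forall>j\<in>I. \<theta> x j = (if j \<in> J then a j else 0)"
      by auto
    have "(\<Oplus>\<^bsub>?Q\<^esub>i\<in>insert k J. a i \<odot>\<^bsub>?Q\<^esub> q i) = a k \<odot>\<^bsub>?Q\<^esub> q k \<oplus>\<^bsub>?Q\<^esub> ?c x"
      using insert x by (subst Q.finsum_insert) (auto simp: qQ Q.smult_closed[simplified])
    also have "\<dots> = ?c (a k \<odot>\<^bsub>W\<^esub> e k \<oplus>\<^bsub>W\<^esub> x)"
      using e[of k] x by (simp add: q_def Qsm Qadd W.smult_closed[simplified])
    finally show ?case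
      using e[of k] x insert.hyps
      by (intro bexI[of _ "a k \<odot>\<^bsub>W\<^esub> e k \<oplus>\<^bsub>W\<^esub> x"]) (auto simp: add smult W.smult_closed[simplified])
  qed
  \<comment> \<open>The functionals read off the coefficients of a combination, which gives
    existence and uniqueness of the expansion at once.\<close>
  have lin: "Q.lincomb a (q ` I) = ?c y \<longleftrightarrow> (\<forall>j\<in>I. a (q j) = \<theta> y j)" if "y \<in> carrier W" for a y
  proof -
    have "Q.lincomb a (q ` I) = (\<Oplus>\<^bsub>?Q\<^esub>i\<in>I. a (q i) \<odot>\<^bsub>?Q\<^esub> q i)"
      unfolding Q.lincomb_def using inj by (subst Q.finsum_reindex) (auto simp: qQ Q.smult_closed[simplified])
    moreover obtain x where "x \<in> carrier W" "\<forall>j\<in>I. \<theta> x j = a (q j)"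
      "(\<Oplus>\<^bsub>?Q\<^esub>i\<in>I. a (q i) \<odot>\<^bsub>?Q\<^esub> q i) = ?c x"
      using comb[of I "\<lambda>i. a (q i)"] by auto
    ultimately show ?thesis using eq[of x y] that by simp
  qed
  have basis: "Q.basis (q ` I)"
  proof (subst Q.basis_criterion)
    show "finite (q ` I)" "q ` I \<subseteq> carrier ?Q" using I qQ by auto
    show "\<forall>v. v \<in> carrier ?Q \<longrightarrow> (\<exists>!a. a \<in> q ` I \<rightarrow>\<^sub>E carrier class_ring \<and> Q.lincomb a (q ` I) = v)"
    proof (intro allI impI)
      fix v assume "v \<in> carrier ?Q"
      then obtain y where y: "y \<in> carrier W" "v = ?c y" by (auto simp: Qc)
      show "\<exists>!a. a \<in> q ` I \<rightarrow>\<^sub>E carrier class_ring \<and> Q.lincomb a (q ` I) = v"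
      proof (rule ex1I[of _ "\<lambda>X\<in>q ` I. \<theta> y (inv_into I q X)"])
        show "(\<lambda>X\<in>q ` I. \<theta> y (inv_into I q X)) \<in> q ` I \<rightarrow>\<^sub>E carrier class_ring \<and>
            Q.lincomb (\<lambda>X\<in>q ` I. \<theta> y (inv_into I q X)) (q ` I) = v"
          using inj y by (auto simp: lin inv_into_f_f)
      next
        fix a assume "a \<in> q ` I \<rightarrow>\<^sub>E carrier class_ring \<and> Q.lincomb a (q ` I) = v"
        then show "a = (\<lambda>X\<in>q ` I. \<theta> y (inv_into I q X))"
          using inj y by (auto simp: lin inv_into_f_f PiE_def extensional_def fun_eq_iff)
      qed
    qed
  qed
  have "Q.fin_dim" unfolding Q.fin_dim_def by (rule exI[of _ "q ` I"]) (use basis I in \<open>simp add: Q.basis_def\<close>)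
  moreover have "Q.dim = card I"
    using Q.dim_basis[OF _ basis] I inj by (simp add: card_image)
  ultimately show ?thesis by simp
qed

section \<open>Left modules over a non-commutative ring\<close>

lemma module_homI:
  assumes "\<And>x. x \<in> carrier M \<Longrightarrow> f x \<in> carrier N"
    and "\<And>x y. x \<in> carrier M \<Longrightarrow> y \<in> carrier M \<Longrightarrow> f (x \<oplus>\<^bsub>M\<^esub> y) = f x \<oplus>\<^bsub>N\<^esub> f y"
    and "\<And>r x. r \<in> carrier R \<Longrightarrow> x \<in> carrier M \<Longrightarrow> f (r \<odot>\<^bsub>M\<^esub> x) = r \<odot>\<^bsub>N\<^esub> f x"
  shows "f \<in> module_hom R M N"
  using assms by (auto simp: module_hom_def)

lemma module_homD:
  assumes "f \<in> module_hom R M N"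
  shows "x \<in> carrier M \<Longrightarrow> f x \<in> carrier N"
    and "x \<in> carrier M \<Longrightarrow> y \<in> carrier M \<Longrightarrow> f (x \<oplus>\<^bsub>M\<^esub> y) = f x \<oplus>\<^bsub>N\<^esub> f y"
    and "r \<in> carrier R \<Longrightarrow> x \<in> carrier M \<Longrightarrow> f (r \<odot>\<^bsub>M\<^esub> x) = r \<odot>\<^bsub>N\<^esub> f x"
  using assms by (auto simp: module_hom_def)

lemma module_hom_compose:
  assumes "f \<in> module_hom R L M" "g \<in> module_hom R M N"
  shows "(\<lambda>x. g (f x)) \<in> module_hom R L N"
  using assms by (auto simp: module_hom_def Pi_def)

lemma module_hom_restrict:
  "f \<in> module_hom R M N \<Longrightarrow> left_module R M \<Longrightarrow> restrict f (carrier M) \<in> module_hom R M N"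
proof -
  assume f: "f \<in> module_hom R M N" and "left_module R M"
  then interpret left_module R M by simp
  show ?thesis by (rule module_homI) (use module_homD[OF f] smult_closed in auto)
qed

context left_module
begin

lemma smult_l_zero: "x \<in> carrier M \<Longrightarrow> \<zero> \<odot>\<^bsub>M\<^esub> x = \<zero>\<^bsub>M\<^esub>"
  using smult_l_distr[of \<zero> \<zero> x] smult_closed[of \<zero> x]
  by (metis M.add.l_cancel_one' R.l_zero R.zero_closed)

lemma smult_r_zero: "a \<in> carrier R \<Longrightarrow> a \<odot>\<^bsub>M\<^esub> \<zero>\<^bsub>M\<^esub> = \<zero>\<^bsub>M\<^esub>"
  using smult_r_distr[of a "\<zero>\<^bsub>M\<^esub>" "\<zero>\<^bsub>M\<^esub>"] smult_closed[of a "\<zero>\<^bsub>M\<^esub>"]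
  by (metis M.add.l_cancel_one' M.l_zero M.zero_closed)

lemma smult_r_minus: "a \<in> carrier R \<Longrightarrow> x \<in> carrier M \<Longrightarrow> a \<odot>\<^bsub>M\<^esub> (\<ominus>\<^bsub>M\<^esub> x) = \<ominus>\<^bsub>M\<^esub> (a \<odot>\<^bsub>M\<^esub> x)"
  using smult_r_distr[of a x "\<ominus>\<^bsub>M\<^esub> x"] smult_r_zero smult_closed
  by (metis M.a_inv_closed M.minus_equality M.add.m_comm M.r_neg)

end

lemma module_hom_zero:
  assumes "left_module R M" "left_module R N" "f \<in> module_hom R M N"
  shows "f \<zero>\<^bsub>M\<^esub> = \<zero>\<^bsub>N\<^esub>"
proof -
  interpret M: left_module R M by fact
  interpret N: left_module R N by fact
  have "f (\<zero>\<^bsub>R\<^esub> \<odot>\<^bsub>M\<^esub> \<zero>\<^bsub>M\<^esub>) = \<zero>\<^bsub>R\<^esub> \<odot>\<^bsub>N\<^esub> f \<zero>\<^bsub>M\<^esub>" using module_homD[OF assms(3)] by simp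
  then show ?thesis using module_homD(1)[OF assms(3)] by (simp add: M.smult_l_zero N.smult_l_zero)
qed

lemma module_hom_diff:
  assumes "left_module R M" "left_module R N" "f \<in> module_hom R M N" "g \<in> module_hom R M N"
  shows "(\<lambda>x. f x \<ominus>\<^bsub>N\<^esub> g x) \<in> module_hom R M N"
proof -
  interpret M: left_module R M by fact
  interpret N: left_module R N by fact
  note [simp] = module_homD[OF assms(3)] module_homD[OF assms(4)]
  show ?thesis
    by (rule module_homI)
      (simp_all add: a_minus_def N.smult_r_distr N.smult_r_minus N.smult_closed N.minus_add N.a_ac)
qed

lemma module_hom_minus:
  assumes "left_module R M" "left_module R N" "f \<in> module_hom R M N" "x \<in> carrier M" "y \<in> carrier M"
  shows "f (x \<ominus>\<^bsub>M\<^esub> y) = f x \<ominus>\<^bsub>N\<^esub> f y"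
proof -
  interpret M: left_module R M by fact
  interpret N: left_module R N by fact
  note h = module_homD[OF assms(3)]
  have "f (\<ominus>\<^bsub>M\<^esub> y) \<oplus>\<^bsub>N\<^esub> f y = \<zero>\<^bsub>N\<^esub>"
    using h(2)[of "\<ominus>\<^bsub>M\<^esub> y" y] assms module_hom_zero[OF assms(1-3)] by (simp add: M.l_neg)
  then have "f (\<ominus>\<^bsub>M\<^esub> y) = \<ominus>\<^bsub>N\<^esub> f y"
    using h(1) assms by (simp add: N.minus_equality)
  then show ?thesis using h assms by (simp add: a_minus_def)
qed

section \<open>Free modules\<close>

lemma free_module_carrier:
  assumes "ring R"
  shows "v \<in> carrier (free_module R S) \<longleftrightarrow>
    (\<forall>s. v s \<in> carrier R) \<and> (\<forall>s. s \<notin> S \<longrightarrow> v s = \<zero>\<^bsub>R\<^esub>) \<and> finite {s. v s \<noteq> \<zero>\<^bsub>R\<^esub>}"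
proof -
  interpret ring R by fact
  have "(\<forall>s. v s \<in> carrier R) \<longleftrightarrow> (\<forall>s\<in>S. v s \<in> carrier R)" if "\<forall>s. s \<notin> S \<longrightarrow> v s = \<zero>\<^bsub>R\<^esub>"
    using that zero_closed by metis
  then show ?thesis unfolding free_module_def by (auto simp: Pi_def)
qed

lemma free_module_ops:
  "f \<oplus>\<^bsub>free_module R S\<^esub> g = (\<lambda>s. f s \<oplus>\<^bsub>R\<^esub> g s)"
  "a \<odot>\<^bsub>free_module R S\<^esub> f = (\<lambda>s. a \<otimes>\<^bsub>R\<^esub> f s)"
  "\<zero>\<^bsub>free_module R S\<^esub> = (\<lambda>_. \<zero>\<^bsub>R\<^esub>)"
  by (simp_all add: free_module_def)

lemma left_module_free_module:
  assumes "ring R"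
  shows "left_module R (free_module R S)"
proof -
  interpret R: ring R by fact
  note c = free_module_carrier[OF assms]
  have sub: "finite {s. h s \<noteq> \<zero>\<^bsub>R\<^esub>}" if "finite {s. f s \<noteq> \<zero>\<^bsub>R\<^esub>}" "finite {s. g s \<noteq> \<zero>\<^bsub>R\<^esub>}"
      "\<And>s. f s = \<zero>\<^bsub>R\<^esub> \<Longrightarrow> g s = \<zero>\<^bsub>R\<^esub> \<Longrightarrow> h s = \<zero>\<^bsub>R\<^esub>" for f g h :: "_ \<Rightarrow> 'a"
    by (rule finite_subset[OF _ finite_UnI[OF that(1,2)]]) (use that(3) in blast)
  have ab: "abelian_group (free_module R S)"
  proof (rule abelian_groupI)
    fix f assume f: "f \<in> carrier (free_module R S)"
    have "(\<lambda>s. \<ominus>\<^bsub>R\<^esub> f s) \<in> carrier (free_module R S)"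
      using f unfolding c by (auto intro: sub[of f f])
    moreover have "(\<lambda>s. \<ominus>\<^bsub>R\<^esub> f s) \<oplus>\<^bsub>free_module R S\<^esub> f = \<zero>\<^bsub>free_module R S\<^esub>"
      using f unfolding c by (auto simp: free_module_ops R.l_neg)
    ultimately show "\<exists>g\<in>carrier (free_module R S). g \<oplus>\<^bsub>free_module R S\<^esub> f = \<zero>\<^bsub>free_module R S\<^esub>" by blast
  next
    fix f g assume "f \<in> carrier (free_module R S)" "g \<in> carrier (free_module R S)"
    then show "f \<oplus>\<^bsub>free_module R S\<^esub> g \<in> carrier (free_module R S)"
      unfolding c by (auto simp: free_module_ops intro: sub[of f g])
  qed (unfold c, auto simp: free_module_ops R.a_ac)
  show ?thesis
  proof (intro left_module.intro left_module_axioms.intro)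
    fix a f assume "a \<in> carrier R" "f \<in> carrier (free_module R S)"
    then show "a \<odot>\<^bsub>free_module R S\<^esub> f \<in> carrier (free_module R S)"
      unfolding c by (auto simp: free_module_ops intro: sub[of f f])
  qed (use assms ab in \<open>auto simp: c free_module_ops R.l_distr R.r_distr R.m_assoc fun_eq_iff\<close>)
qed

definition free_basis :: "('r, 'e) ring_scheme \<Rightarrow> 's \<Rightarrow> 's \<Rightarrow> 'r" where
  "free_basis R s = (\<lambda>t. if t = s then \<one>\<^bsub>R\<^esub> else \<zero>\<^bsub>R\<^esub>)"

lemma free_basis_closed: "ring R \<Longrightarrow> s \<in> S \<Longrightarrow> free_basis R s \<in> carrier (free_module R S)"
proof -
  assume R: "ring R" and s: "s \<in> S"
  interpret ring R by fact
  have "finite {t. free_basis R s t \<noteq> \<zero>\<^bsub>R\<^esub>}"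
    by (rule finite_subset[of _ "{s}"]) (auto simp: free_basis_def)
  then show ?thesis using s by (auto simp: free_module_carrier[OF R] free_basis_def)
qed

lemma free_module_hom_eqI:
  assumes "left_module R N" and f: "f \<in> module_hom R (free_module R S) N"
    and g: "g \<in> module_hom R (free_module R S) N"
    and eq: "\<And>s. s \<in> S \<Longrightarrow> f (free_basis R s) = g (free_basis R s)"
    and v: "v \<in> carrier (free_module R S)"
  shows "f v = g v"
proof -
  interpret N: left_module R N by fact
  have R: "ring R" by (rule N.R.ring_axioms)
  interpret F: left_module R "free_module R S" by (rule left_module_free_module[OF R])
  note c = free_module_carrier[OF R]
  \<comment> \<open>\<open>T\<close> is any finite set containing the support, so that a coordinate
    can be erased without recomputing the support.\<close>
  have "f v = g v" if "finite T" "v \<in> carrier (free_module R S)" "{s. v s \<noteq> \<zero>\<^bsub>R\<^esub>} \<subseteq> T" for T v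
    using that
  proof (induction T arbitrary: v rule: finite_induct)
    case empty
    then have "v = \<zero>\<^bsub>free_module R S\<^esub>" by (auto simp: free_module_ops fun_eq_iff)
    then show ?case using module_hom_zero[OF F.left_module_axioms assms(1) f]
        module_hom_zero[OF F.left_module_axioms assms(1) g] by simp
  next
    case (insert s T)
    show ?case
    proof (cases "s \<in> S")
      case False
      then show ?thesis using insert.prems by (intro insert.IH) (auto simp: c)
    next
      case True
      let ?w = "v(s := \<zero>\<^bsub>R\<^esub>)"
      have w: "?w \<in> carrier (free_module R S)"
        using insert.prems(1) unfolding c by (auto simp: fun_upd_def intro: rev_finite_subset)
      have vs: "v s \<in> carrier R" using insert.prems(1) unfolding c by simp
      have v: "v = ?w \<oplus>\<^bsub>free_module R S\<^esub> v s \<odot>\<^bsub>free_module R S\<^esub> free_basis R s"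
        using insert.prems(1) by (auto simp: c free_module_ops free_basis_def fun_eq_iff)
      have e: "free_basis R s \<in> carrier (free_module R S)" by (rule free_basis_closed[OF R True])
      have "f ?w = g ?w" using insert.prems w by (intro insert.IH) (auto simp: fun_upd_def)
      then show ?thesis
        using module_homD[OF f] module_homD[OF g] w e vs eq[OF True] F.smult_closed[OF vs e]
        by (subst (1 2) v) simp
    qed
  qed
  from this[of "{s. v s \<noteq> \<zero>\<^bsub>R\<^esub>}" v] show ?thesis using v by (simp add: c)
qed

lemma free_module_lift:
  assumes "left_module R N" and b: "\<And>s. s \<in> S \<Longrightarrow> b s \<in> carrier N"
  obtains f where "f \<in> module_hom R (free_module R S) N" "\<And>s. s \<in> S \<Longrightarrow> f (free_basis R s) = b s"
proof -
  interpret N: left_module R N by fact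
  have R: "ring R" by (rule N.R.ring_axioms)
  interpret F: left_module R "free_module R S" by (rule left_module_free_module[OF R])
  note c = free_module_carrier[OF R]
  \<comment> \<open>Extended by zero, the prescribed values lie in the carrier for every index, and
    sums over supports need no reference to \<open>S\<close>.\<close>
  define b' where "b' s = (if s \<in> S then b s else \<zero>\<^bsub>N\<^esub>)" for s
  have b': "b' s \<in> carrier N" for s using b by (simp add: b'_def)
  define f where "f v = (\<Oplus>\<^bsub>N\<^esub>s\<in>{s. v s \<noteq> \<zero>\<^bsub>R\<^esub>}. v s \<odot>\<^bsub>N\<^esub> b' s)" for v
  have f: "f v = (\<Oplus>\<^bsub>N\<^esub>s\<in>T. v s \<odot>\<^bsub>N\<^esub> b' s)"
    if "finite T" "{s. v s \<noteq> \<zero>\<^bsub>R\<^esub>} \<subseteq> T" "v \<in> carrier (free_module R S)" for v T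
    unfolding f_def
    by (rule N.add.finprod_mono_neutral_cong_left)
      (use that in \<open>auto simp: c N.smult_l_zero b' N.smult_closed\<close>)
  have sm: "v s \<odot>\<^bsub>N\<^esub> b' s \<in> carrier N" if "v \<in> carrier (free_module R S)" for v s
    using that by (simp add: c b' N.smult_closed)
  have hom: "f \<in> module_hom R (free_module R S) N"
  proof (rule module_homI)
    show "f v \<in> carrier N" if "v \<in> carrier (free_module R S)" for v
      unfolding f_def using sm[OF that] by (intro N.finsum_closed) auto
  next
    fix v w assume vw: "v \<in> carrier (free_module R S)" "w \<in> carrier (free_module R S)"
    let ?T = "{s. v s \<noteq> \<zero>\<^bsub>R\<^esub>} \<union> {s. w s \<noteq> \<zero>\<^bsub>R\<^esub>}"
    let ?u = "v \<oplus>\<^bsub>free_module R S\<^esub> w"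
    have u: "?u \<in> carrier (free_module R S)" using vw by simp
    have us: "?u s = v s \<oplus>\<^bsub>R\<^esub> w s" for s by (simp add: free_module_ops)
    have T: "finite ?T" using vw by (simp add: c)
    have "f ?u = (\<Oplus>\<^bsub>N\<^esub>s\<in>?T. ?u s \<odot>\<^bsub>N\<^esub> b' s)" using vw T u by (intro f) (auto simp: us)
    also have "\<dots> = (\<Oplus>\<^bsub>N\<^esub>s\<in>?T. v s \<odot>\<^bsub>N\<^esub> b' s \<oplus>\<^bsub>N\<^esub> w s \<odot>\<^bsub>N\<^esub> b' s)"
      using vw by (simp only: us) (simp add: c b' N.smult_l_distr)
    also have "\<dots> = f v \<oplus>\<^bsub>N\<^esub> f w"
      using vw T sm by (simp add: f[OF T] N.finsum_addf Pi_def)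
    finally show "f ?u = f v \<oplus>\<^bsub>N\<^esub> f w" .
  next
    fix r v assume r: "r \<in> carrier R" and v: "v \<in> carrier (free_module R S)"
    let ?T = "{s. v s \<noteq> \<zero>\<^bsub>R\<^esub>}"
    let ?u = "r \<odot>\<^bsub>free_module R S\<^esub> v"
    have u: "?u \<in> carrier (free_module R S)" using r v by (simp add: F.smult_closed)
    have us: "?u s = r \<otimes>\<^bsub>R\<^esub> v s" for s by (simp add: free_module_ops)
    have T: "finite ?T" using v by (simp add: c)
    have "f ?u = (\<Oplus>\<^bsub>N\<^esub>s\<in>?T. ?u s \<odot>\<^bsub>N\<^esub> b' s)" using T u r by (intro f) (auto simp: us)
    also have "\<dots> = (\<Oplus>\<^bsub>N\<^esub>s\<in>?T. r \<odot>\<^bsub>N\<^esub> (v s \<odot>\<^bsub>N\<^esub> b' s))"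
      using r v by (simp only: us) (simp add: c b' N.smult_assoc)
    also have "\<dots> = r \<odot>\<^bsub>N\<^esub> f v"
    proof -
      have "(\<Oplus>\<^bsub>N\<^esub>s\<in>T. r \<odot>\<^bsub>N\<^esub> (v s \<odot>\<^bsub>N\<^esub> b' s)) = r \<odot>\<^bsub>N\<^esub> (\<Oplus>\<^bsub>N\<^esub>s\<in>T. v s \<odot>\<^bsub>N\<^esub> b' s)" if "finite T" for T
        using that by (induction T rule: finite_induct)
          (auto simp: r N.smult_r_zero N.smult_r_distr sm[OF v] N.smult_closed Pi_def)
      then show ?thesis using T by (simp add: f_def)
    qed
    finally show "f ?u = r \<odot>\<^bsub>N\<^esub> f v" .
  qed
  have "f (free_basis R s) = b s" if s: "s \<in> S" for s
  proof -
    have "f (free_basis R s) = (\<Oplus>\<^bsub>N\<^esub>t\<in>{s}. free_basis R s t \<odot>\<^bsub>N\<^esub> b' t)"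
      by (rule f) (use free_basis_closed[OF R s] in \<open>auto simp: free_basis_def\<close>)
    then show ?thesis using s b by (simp add: free_basis_def b'_def N.smult_one)
  qed
  with hom show thesis by (rule that)
qed

text \<open>Lift on the basis of a free module that has \<open>P\<close> as a summand. Instead of
  surjectivity of \<open>g\<close> it is asked that \<open>h\<close> take values in the image of
  \<open>g\<close>, which is what exactness of a resolution supplies in each degree.\<close>

lemma projective_lift:
  fixes P :: "('r, 'p) module"
  assumes P: "projective R P" and B: "left_module R B" and C: "left_module R C"
    and g: "g \<in> module_hom R B C" and h: "h \<in> module_hom R P C"
    and im: "\<And>x. x \<in> carrier P \<Longrightarrow> h x \<in> g ` carrier B"
  shows "\<exists>k\<in>module_hom R P B. \<forall>x\<in>carrier P. g (k x) = h x"
proof -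
  from P obtain S :: "'p set" and i p where i: "i \<in> module_hom R P (free_module R S)"
    and p: "p \<in> module_hom R (free_module R S) P" and pi: "\<And>x. x \<in> carrier P \<Longrightarrow> p (i x) = x"
    unfolding projective_def by auto
  interpret B: left_module R B by fact
  have R: "ring R" by (rule B.R.ring_axioms)
  have "\<forall>s\<in>S. \<exists>b\<in>carrier B. g b = h (p (free_basis R s))"
    using im module_homD(1)[OF p free_basis_closed[OF R]] by (metis (no_types) imageE)
  then obtain b where b: "\<And>s. s \<in> S \<Longrightarrow> b s \<in> carrier B" "\<And>s. s \<in> S \<Longrightarrow> g (b s) = h (p (free_basis R s))"
    by metis
  obtain f where f: "f \<in> module_hom R (free_module R S) B" "\<And>s. s \<in> S \<Longrightarrow> f (free_basis R s) = b s"
    using free_module_lift[where R = R and N = B and S = S and b = b] B b(1) by blast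
  have "g (f v) = h (p v)" if "v \<in> carrier (free_module R S)" for v
    by (rule free_module_hom_eqI[OF C module_hom_compose[OF f(1) g] module_hom_compose[OF p h] _ that])
      (simp add: b f)
  then have "\<forall>x\<in>carrier P. g (f (i x)) = h x" using pi module_homD(1)[OF i] by simp
  then show ?thesis by (rule bexI[OF _ module_hom_compose[OF i f(1)]])
qed

text \<open>\<open>projective\<close> wants the index set of the free module to consist of elements
  of the module itself. The indices are therefore replaced by the corresponding basis vectors, which
  are distinct because 1 differs from 0.\<close>

lemma projective_free_module:
  fixes R :: "('r, 'e) ring_scheme" and S :: "'s set"
  assumes "ring R" "\<one>\<^bsub>R\<^esub> \<noteq> \<zero>\<^bsub>R\<^esub>"
  shows "projective R (free_module R S)"
proof -
  interpret R: ring R by fact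
  define j :: "'s \<Rightarrow> 's \<Rightarrow> 'r" where "j = free_basis R"
  have j: "inj j" using assms(2) by (auto simp: inj_def j_def free_basis_def fun_eq_iff split: if_splits)
  note c = free_module_carrier[OF assms(1)]
  let ?F = "free_module R S" and ?G = "free_module R (j ` S)"
  define i where "i v = (\<lambda>t. if t \<in> j ` S then v (the_inv j t) else \<zero>\<^bsub>R\<^esub>)" for v
  define p where "p w = (\<lambda>s. if s \<in> S then w (j s) else \<zero>\<^bsub>R\<^esub>)" for w
  have "i \<in> module_hom R ?F ?G"
  proof (rule module_homI)
    fix v assume v: "v \<in> carrier ?F"
    have "{t. i v t \<noteq> \<zero>\<^bsub>R\<^esub>} \<subseteq> j ` {s. v s \<noteq> \<zero>\<^bsub>R\<^esub>}" using j by (auto simp: i_def the_inv_f_f)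
    then have "finite {t. i v t \<noteq> \<zero>\<^bsub>R\<^esub>}" using v by (auto simp: c intro: finite_subset)
    then show "i v \<in> carrier ?G" using v by (auto simp: c i_def)
  qed (auto simp: i_def free_module_ops fun_eq_iff)
  moreover have "p \<in> module_hom R ?G ?F"
  proof (rule module_homI)
    fix w assume w: "w \<in> carrier ?G"
    have "finite {s. w (j s) \<noteq> \<zero>\<^bsub>R\<^esub>}"
      using finite_vimageI[of "{t. w t \<noteq> \<zero>\<^bsub>R\<^esub>}" j] w j by (simp add: c vimage_def)
    then have "finite {s. p w s \<noteq> \<zero>\<^bsub>R\<^esub>}" by (rule rev_finite_subset) (auto simp: p_def)
    then show "p w \<in> carrier ?F" using w by (auto simp: c p_def)
  qed (auto simp: p_def free_module_ops fun_eq_iff)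
  moreover have "\<forall>v\<in>carrier ?F. p (i v) = v"
    using j by (auto simp: p_def i_def c the_inv_f_f fun_eq_iff)
  ultimately show ?thesis
    unfolding projective_def
    by (intro conjI left_module_free_module[OF assms(1)] exI[of _ "j ` S"] bexI[of _ i] bexI[of _ p])
qed

section \<open>Comparison of projective resolutions\<close>

locale proj_resolution =
  fixes R :: "('r, 'e) ring_scheme" and M :: "('r, 'm) module"
    and P :: "nat \<Rightarrow> ('r, 'p) module" and d :: "nat \<Rightarrow> 'p \<Rightarrow> 'p" and \<epsilon> :: "'p \<Rightarrow> 'm"
  assumes M: "left_module R M" and res: "projective_resolution R M P d \<epsilon>"
begin

lemma projective_term: "projective R (P n)" using res by (simp add: projective_resolution_def)
lemma left_module_term: "left_module R (P n)" using projective_term by (simp add: projective_def)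
lemma d_hom: "d n \<in> module_hom R (P (Suc n)) (P n)" using res by (simp add: projective_resolution_def)
lemma \<epsilon>_hom: "\<epsilon> \<in> module_hom R (P 0) M" using res by (simp add: projective_resolution_def)
lemma \<epsilon>_surj: "\<epsilon> ` carrier (P 0) = carrier M" using res by (simp add: projective_resolution_def)
lemma exact_0: "d 0 ` carrier (P (Suc 0)) = {x \<in> carrier (P 0). \<epsilon> x = \<zero>\<^bsub>M\<^esub>}"
  using res by (simp add: projective_resolution_def)
lemma exact_Suc: "d (Suc n) ` carrier (P (Suc (Suc n))) = {x \<in> carrier (P (Suc n)). d n x = \<zero>\<^bsub>P n\<^esub>}"
  using res by (simp add: projective_resolution_def)

lemma d_closed: "x \<in> carrier (P (Suc n)) \<Longrightarrow> d n x \<in> carrier (P n)"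
  using module_homD(1)[OF d_hom] .

lemma d_d: "x \<in> carrier (P (Suc (Suc n))) \<Longrightarrow> d n (d (Suc n) x) = \<zero>\<^bsub>P n\<^esub>"
  using exact_Suc[of n] by (metis (mono_tags, lifting) image_eqI mem_Collect_eq)

lemma \<epsilon>_d: "x \<in> carrier (P (Suc 0)) \<Longrightarrow> \<epsilon> (d 0 x) = \<zero>\<^bsub>M\<^esub>"
  using exact_0 by (metis (mono_tags, lifting) image_eqI mem_Collect_eq)

end

lemma chain_map_exists:
  assumes "proj_resolution R M P d \<epsilon>" and "proj_resolution R M Q e \<eta>"
  obtains f where "\<And>n. f n \<in> module_hom R (P n) (Q n)"
    "\<And>n x. x \<in> carrier (P (Suc n)) \<Longrightarrow> e n (f (Suc n) x) = f n (d n x)"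
    "\<And>x. x \<in> carrier (P 0) \<Longrightarrow> \<eta> (f 0 x) = \<epsilon> x"
proof -
  interpret P: proj_resolution R M P d \<epsilon> by fact
  interpret Q: proj_resolution R M Q e \<eta> by fact
  \<comment> \<open>The map chosen in degree n must leave room for the next one, so the invariant
    also says that f d takes values in the image of the next differential of
    \<open>Q\<close>.\<close>
  define I where "I n f \<longleftrightarrow> f \<in> module_hom R (P n) (Q n) \<and>
    (\<forall>x\<in>carrier (P (Suc n)). f (d n x) \<in> e n ` carrier (Q (Suc n))) \<and>
    (n = 0 \<longrightarrow> (\<forall>x\<in>carrier (P 0). \<eta> (f x) = \<epsilon> x))" for n f
  define J where "J n f g \<longleftrightarrow> (\<forall>x\<in>carrier (P (Suc n)). e n (g x) = f (d n x))" for n :: nat and f g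
  have "\<exists>f. \<forall>n. I n (f n) \<and> J n (f n) (f (Suc n))"
  proof (rule dependent_nat_choice)
    have "\<exists>k\<in>module_hom R (P 0) (Q 0). \<forall>x\<in>carrier (P 0). \<eta> (k x) = \<epsilon> x"
      by (rule projective_lift[OF P.projective_term Q.left_module_term P.M Q.\<epsilon>_hom P.\<epsilon>_hom])
        (use module_homD(1)[OF P.\<epsilon>_hom] Q.\<epsilon>_surj in auto)
    then obtain k where k: "k \<in> module_hom R (P 0) (Q 0)" "\<And>x. x \<in> carrier (P 0) \<Longrightarrow> \<eta> (k x) = \<epsilon> x"
      by auto
    have "k (d 0 x) \<in> e 0 ` carrier (Q (Suc 0))" if "x \<in> carrier (P (Suc 0))" for x
      unfolding Q.exact_0 using k that P.d_closed[of x 0] P.\<epsilon>_d[of x] module_homD(1)[OF k(1)] by simp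
    with k show "\<exists>f. I 0 f" unfolding I_def by auto
  next
    fix f n assume f: "I n f"
    have "\<exists>k\<in>module_hom R (P (Suc n)) (Q (Suc n)). \<forall>x\<in>carrier (P (Suc n)). e n (k x) = f (d n x)"
      by (rule projective_lift[OF P.projective_term Q.left_module_term Q.left_module_term Q.d_hom module_hom_compose[OF P.d_hom]])
        (use f in \<open>auto simp: I_def\<close>)
    then obtain k where k: "k \<in> module_hom R (P (Suc n)) (Q (Suc n))"
        "\<And>x. x \<in> carrier (P (Suc n)) \<Longrightarrow> e n (k x) = f (d n x)"
      by auto
    have "k (d (Suc n) x) \<in> e (Suc n) ` carrier (Q (Suc (Suc n)))" if "x \<in> carrier (P (Suc (Suc n)))" for x
    proof -
      have "f \<zero>\<^bsub>P n\<^esub> = \<zero>\<^bsub>Q n\<^esub>"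
        using f module_hom_zero[OF P.left_module_term Q.left_module_term] unfolding I_def by simp
      then show ?thesis
        unfolding Q.exact_Suc using k(2) that P.d_closed[of x "Suc n"] P.d_d[of x n] module_homD(1)[OF k(1)] by simp
    qed
    with k show "\<exists>g. I (Suc n) g \<and> J n f g" unfolding I_def J_def by auto
  qed
  then obtain f where "\<And>n. I n (f n)" "\<And>n. J n (f n) (f (Suc n))" by auto
  then show thesis by (intro that[of f]) (auto simp: I_def J_def)
qed

text \<open>To be applied to the two composites of the comparison maps: a chain map that lifts the
  identity is homotopic to the identity.\<close>

lemma (in proj_resolution) homotopy_exists:
  assumes u: "\<And>n. u n \<in> module_hom R (P n) (P n)"
    and du: "\<And>n x. x \<in> carrier (P (Suc n)) \<Longrightarrow> d n (u (Suc n) x) = u n (d n x)"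
    and eu: "\<And>x. x \<in> carrier (P 0) \<Longrightarrow> \<epsilon> (u 0 x) = \<epsilon> x"
  obtains s where "\<And>n. s n \<in> module_hom R (P n) (P (Suc n))"
    "\<And>x. x \<in> carrier (P 0) \<Longrightarrow> d 0 (s 0 x) = u 0 x \<ominus>\<^bsub>P 0\<^esub> x"
    "\<And>n x. x \<in> carrier (P (Suc n)) \<Longrightarrow>
      d (Suc n) (s (Suc n) x) = u (Suc n) x \<ominus>\<^bsub>P (Suc n)\<^esub> x \<ominus>\<^bsub>P (Suc n)\<^esub> s n (d n x)"
proof -
  interpret M: left_module R M by (rule M)
  interpret P: left_module R "P n" for n by (rule left_module_term)
  have id: "(\<lambda>x. x) \<in> module_hom R (P n) (P n)" for n by (rule module_homI) auto
  note uc = module_homD(1)[OF u]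
  have u1: "(\<lambda>x. u n x \<ominus>\<^bsub>P n\<^esub> x) \<in> module_hom R (P n) (P n)" for n
    by (rule module_hom_diff[OF left_module_term left_module_term u id])
  \<comment> \<open>The map u - 1 - s d is killed by d, hence takes values in the image of the next
    differential by exactness. Recording this makes the next lift possible.\<close>
  define I where "I n s \<longleftrightarrow> s \<in> module_hom R (P n) (P (Suc n)) \<and>
    (\<forall>x\<in>carrier (P (Suc n)). u (Suc n) x \<ominus>\<^bsub>P (Suc n)\<^esub> x \<ominus>\<^bsub>P (Suc n)\<^esub> s (d n x) \<in> d (Suc n) ` carrier (P (Suc (Suc n)))) \<and>
    (n = 0 \<longrightarrow> (\<forall>x\<in>carrier (P 0). d 0 (s x) = u 0 x \<ominus>\<^bsub>P 0\<^esub> x))" for n s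
  define J where "J n s t \<longleftrightarrow> (\<forall>x\<in>carrier (P (Suc n)).
    d (Suc n) (t x) = u (Suc n) x \<ominus>\<^bsub>P (Suc n)\<^esub> x \<ominus>\<^bsub>P (Suc n)\<^esub> s (d n x))" for n :: nat and s t
  have cancel: "(a \<ominus>\<^bsub>P n\<^esub> b) \<ominus>\<^bsub>P n\<^esub> (a \<ominus>\<^bsub>P n\<^esub> b) = \<zero>\<^bsub>P n\<^esub>"
    if "a \<in> carrier (P n)" "b \<in> carrier (P n)" for a b n
    using that by (simp add: a_minus_def P.r_neg)
  have "\<exists>s. \<forall>n. I n (s n) \<and> J n (s n) (s (Suc n))"
  proof (rule dependent_nat_choice)
    have "\<exists>k\<in>module_hom R (P 0) (P (Suc 0)). \<forall>x\<in>carrier (P 0). d 0 (k x) = u 0 x \<ominus>\<^bsub>P 0\<^esub> x"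
    proof (rule projective_lift[OF projective_term left_module_term left_module_term d_hom u1])
      fix x assume x: "x \<in> carrier (P 0)"
      have "\<epsilon> (u 0 x \<ominus>\<^bsub>P 0\<^esub> x) = \<zero>\<^bsub>M\<^esub>"
        using module_hom_minus[OF left_module_term M \<epsilon>_hom uc[OF x] x] eu[OF x] module_homD(1)[OF \<epsilon>_hom x]
        by (simp add: a_minus_def M.M.r_neg)
      then show "u 0 x \<ominus>\<^bsub>P 0\<^esub> x \<in> d 0 ` carrier (P (Suc 0))"
        unfolding exact_0 using x uc by simp
    qed
    then obtain k where k: "k \<in> module_hom R (P 0) (P (Suc 0))"
        "\<And>x. x \<in> carrier (P 0) \<Longrightarrow> d 0 (k x) = u 0 x \<ominus>\<^bsub>P 0\<^esub> x" by auto
    have "u (Suc 0) x \<ominus>\<^bsub>P (Suc 0)\<^esub> x \<ominus>\<^bsub>P (Suc 0)\<^esub> k (d 0 x) \<in> d (Suc 0) ` carrier (P (Suc (Suc 0)))"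
      if x: "x \<in> carrier (P (Suc 0))" for x
    proof -
      have c: "u (Suc 0) x \<in> carrier (P (Suc 0))" "d 0 x \<in> carrier (P 0)" "k (d 0 x) \<in> carrier (P (Suc 0))"
        using uc[OF x] d_closed[OF x] module_homD(1)[OF k(1)] by auto
      show ?thesis
        unfolding exact_Suc using x c uc[OF c(2)]
        by (simp add: module_hom_minus[OF left_module_term left_module_term d_hom] du k(2) cancel)
    qed
    with k show "\<exists>f. I 0 f" unfolding I_def by auto
  next
    fix s n assume s: "I n s"
    then have s1: "s \<in> module_hom R (P n) (P (Suc n))" by (simp add: I_def)
    have h: "(\<lambda>x. u (Suc n) x \<ominus>\<^bsub>P (Suc n)\<^esub> x \<ominus>\<^bsub>P (Suc n)\<^esub> s (d n x)) \<in> module_hom R (P (Suc n)) (P (Suc n))"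
      by (rule module_hom_diff[OF left_module_term left_module_term u1 module_hom_compose[OF d_hom s1]])
    have "\<exists>k\<in>module_hom R (P (Suc n)) (P (Suc (Suc n))). \<forall>x\<in>carrier (P (Suc n)).
        d (Suc n) (k x) = u (Suc n) x \<ominus>\<^bsub>P (Suc n)\<^esub> x \<ominus>\<^bsub>P (Suc n)\<^esub> s (d n x)"
      by (rule projective_lift[OF projective_term left_module_term left_module_term d_hom h]) (use s in \<open>auto simp: I_def\<close>)
    then obtain k where k: "k \<in> module_hom R (P (Suc n)) (P (Suc (Suc n)))"
        "\<And>x. x \<in> carrier (P (Suc n)) \<Longrightarrow> d (Suc n) (k x) = u (Suc n) x \<ominus>\<^bsub>P (Suc n)\<^esub> x \<ominus>\<^bsub>P (Suc n)\<^esub> s (d n x)"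
      by auto
    have "u (Suc (Suc n)) x \<ominus>\<^bsub>P (Suc (Suc n))\<^esub> x \<ominus>\<^bsub>P (Suc (Suc n))\<^esub> k (d (Suc n) x)
        \<in> d (Suc (Suc n)) ` carrier (P (Suc (Suc (Suc n))))"
      if x: "x \<in> carrier (P (Suc (Suc n)))" for x
    proof -
      have c: "u (Suc (Suc n)) x \<in> carrier (P (Suc (Suc n)))" "d (Suc n) x \<in> carrier (P (Suc n))"
          "k (d (Suc n) x) \<in> carrier (P (Suc (Suc n)))"
        using uc[OF x] d_closed[OF x] module_homD(1)[OF k(1)] by auto
      have z: "s (d n (d (Suc n) x)) = \<zero>\<^bsub>P (Suc n)\<^esub>"
        using d_d[OF x] module_hom_zero[OF left_module_term left_module_term s1] by simp
      have "a \<ominus>\<^bsub>P (Suc n)\<^esub> \<zero>\<^bsub>P (Suc n)\<^esub> = a" if "a \<in> carrier (P (Suc n))" for a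
        using that by (simp add: a_minus_def)
      then show ?thesis
        unfolding exact_Suc using x c uc[OF c(2)]
        by (simp add: module_hom_minus[OF left_module_term left_module_term d_hom] du k(2) z cancel)
    qed
    with k show "\<exists>t. I (Suc n) t \<and> J n s t" unfolding I_def J_def by auto
  qed
  then obtain s where "\<And>n. I n (s n)" "\<And>n. J n (s n) (s (Suc n))" by auto
  then show thesis by (intro that[of s]) (auto simp: I_def J_def)
qed

section \<open>The Hom complex\<close>

definition hom_complex :: "('k, 'a) module \<Rightarrow> (nat \<Rightarrow> ('a, 'p) module) \<Rightarrow> ('a, 'n) module \<Rightarrow>
    nat \<Rightarrow> ('k, 'p \<Rightarrow> 'n) module" where
  "hom_complex A P N = (\<lambda>i. Hom_space A (P i) N)"

definition hom_diff :: "(nat \<Rightarrow> ('a, 'p) module) \<Rightarrow> (nat \<Rightarrow> 'p \<Rightarrow> 'p) \<Rightarrow> nat \<Rightarrow> ('p \<Rightarrow> 'n) \<Rightarrow> ('p \<Rightarrow> 'n)" where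
  "hom_diff P d = (\<lambda>i f. \<lambda>x\<in>carrier (P (Suc i)). f (d i x))"

text \<open>The properties of the scalars \<open>c \<odot> \<one>\<close> that turn
  \<open>Hom_space\<close> into a vector space. By centrality a scalar multiple of a homomorphism is
  again a homomorphism.\<close>

locale scalar_algebra = ring A for A :: "('k::field, 'a) module" (structure) +
  assumes scalar_closed: "c \<odot> \<one> \<in> carrier A"
    and scalar_add: "(c + c') \<odot> \<one> = c \<odot> \<one> \<oplus> c' \<odot> \<one>"
    and scalar_mult: "(c * c') \<odot> \<one> = (c \<odot> \<one>) \<otimes> (c' \<odot> \<one>)"
    and scalar_one: "1 \<odot> \<one> = \<one>"
    and scalar_central: "a \<in> carrier A \<Longrightarrow> (c \<odot> \<one>) \<otimes> a = a \<otimes> (c \<odot> \<one>)"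

text \<open>
  The map \<open>\<theta>\<close> induces an isomorphism from the \<open>n\<close>-th cohomology to the functions on \<open>I\<close>. Defined on
  cocycles rather than on classes, it can be pulled back along chain maps without forming quotients.
\<close>

definition cohomology_coordinates ::
    "(nat \<Rightarrow> ('k::field, 'c) module) \<Rightarrow> (nat \<Rightarrow> 'c \<Rightarrow> 'c) \<Rightarrow> nat \<Rightarrow> 'i set \<Rightarrow> ('c \<Rightarrow> 'i \<Rightarrow> 'k) \<Rightarrow> bool" where
  "cohomology_coordinates C \<delta> n I \<theta> \<longleftrightarrow>
    (\<forall>x\<in>cocycles C \<delta> n. \<forall>y\<in>cocycles C \<delta> n. \<forall>i\<in>I. \<theta> (x \<oplus>\<^bsub>C n\<^esub> y) i = \<theta> x i + \<theta> y i) \<and>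
    (\<forall>c. \<forall>x\<in>cocycles C \<delta> n. \<forall>i\<in>I. \<theta> (c \<odot>\<^bsub>C n\<^esub> x) i = c * \<theta> x i) \<and>
    (\<forall>x\<in>cocycles C \<delta> n. x \<in> coboundaries C \<delta> n \<longleftrightarrow> (\<forall>i\<in>I. \<theta> x i = 0)) \<and>
    (\<forall>t. \<exists>x\<in>cocycles C \<delta> n. \<forall>i\<in>I. \<theta> x i = t i)"

lemma Hom_space_carrier: "f \<in> carrier (Hom_space A M N) \<longleftrightarrow> f \<in> module_hom A M N \<and> f \<in> extensional (carrier M)"
  by (simp add: Hom_space_def)

lemma Hom_space_ops:
  "\<zero>\<^bsub>Hom_space A M N\<^esub> = (\<lambda>x\<in>carrier M. \<zero>\<^bsub>N\<^esub>)"
  "f \<oplus>\<^bsub>Hom_space A M N\<^esub> g = (\<lambda>x\<in>carrier M. f x \<oplus>\<^bsub>N\<^esub> g x)"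
  "c \<odot>\<^bsub>Hom_space A M N\<^esub> f = (\<lambda>x\<in>carrier M. (c \<odot>\<^bsub>A\<^esub> \<one>\<^bsub>A\<^esub>) \<odot>\<^bsub>N\<^esub> f x)"
  by (simp_all add: Hom_space_def)

lemma module_Hom_space:
  assumes A: "scalar_algebra A" and M: "left_module A M" and N: "left_module A N"
  shows "Module.module class_ring (Hom_space A M N)"
proof -
  interpret A: scalar_algebra A by fact
  interpret M: left_module A M by fact
  interpret N: left_module A N by fact
  let ?H = "Hom_space A M N"
  have add: "f \<oplus>\<^bsub>?H\<^esub> g \<in> carrier ?H" if "f \<in> carrier ?H" "g \<in> carrier ?H" for f g
  proof -
    have "(\<lambda>x\<in>carrier M. f x \<oplus>\<^bsub>N\<^esub> g x) \<in> module_hom A M N"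
      using that module_homD[of f A M N] module_homD[of g A M N]
      by (intro module_homI) (auto simp: Hom_space_carrier M.smult_closed N.smult_r_distr N.a_ac)
    then show ?thesis by (simp add: Hom_space_carrier Hom_space_ops)
  qed
  have sm: "c \<odot>\<^bsub>?H\<^esub> f \<in> carrier ?H" if f: "f \<in> carrier ?H" for c f
  proof -
    have "(\<lambda>x\<in>carrier M. (c \<odot>\<^bsub>A\<^esub> \<one>\<^bsub>A\<^esub>) \<odot>\<^bsub>N\<^esub> f x) \<in> module_hom A M N"
      using f module_homD[of f A M N] A.scalar_closed[of c]
      by (intro module_homI)
        (auto simp: Hom_space_carrier M.smult_closed N.smult_r_distr N.smult_closed
          N.smult_assoc[symmetric] A.scalar_central)
    then show ?thesis by (simp add: Hom_space_carrier Hom_space_ops)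
  qed
  have neg: "\<exists>g\<in>carrier ?H. g \<oplus>\<^bsub>?H\<^esub> f = \<zero>\<^bsub>?H\<^esub>" if f: "f \<in> carrier ?H" for f
  proof
    have "(\<lambda>x\<in>carrier M. \<ominus>\<^bsub>N\<^esub> f x) \<in> module_hom A M N"
      using f module_homD[of f A M N]
      by (intro module_homI) (auto simp: Hom_space_carrier M.smult_closed N.smult_r_minus N.minus_add)
    then show "(\<lambda>x\<in>carrier M. \<ominus>\<^bsub>N\<^esub> f x) \<in> carrier ?H" by (simp add: Hom_space_carrier)
    show "(\<lambda>x\<in>carrier M. \<ominus>\<^bsub>N\<^esub> f x) \<oplus>\<^bsub>?H\<^esub> f = \<zero>\<^bsub>?H\<^esub>"
      using f module_homD(1)[of f A M N] by (auto simp: Hom_space_carrier Hom_space_ops N.l_neg)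
  qed
  have v: "f x \<in> carrier N" if "f \<in> carrier ?H" "x \<in> carrier M" for f x
    using that module_homD(1)[of f A M N] by (simp add: Hom_space_carrier)
  have ext: "f \<in> extensional (carrier M)" if "f \<in> carrier ?H" for f
    using that by (simp add: Hom_space_carrier)
  have z: "\<zero>\<^bsub>?H\<^esub> \<in> carrier ?H"
    by (auto simp: Hom_space_carrier Hom_space_ops M.smult_closed N.smult_r_zero intro!: module_homI)
  have ab: "abelian_group ?H"
    by (rule abelian_groupI)
      (use add neg z v in \<open>auto simp: Hom_space_ops N.a_ac intro!: restrict_ext extensionalityI[OF _ ext]\<close>)
  show ?thesis
    by (rule moduleI)
      (use add sm v ab class_cring.cring_axioms A.scalar_closed in \<open>auto simp: Hom_space_ops N.smult_l_distr N.smult_r_distr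
        N.smult_assoc N.smult_closed A.scalar_add A.scalar_mult A.scalar_one N.smult_one
        intro!: restrict_ext extensionalityI[OF _ ext]\<close>)
qed

lemma coboundaries_subset_cocycles:
  assumes "proj_resolution A M P d \<epsilon>" and N: "left_module A N"
  shows "coboundaries (hom_complex A P N) (hom_diff P d) n \<subseteq> cocycles (hom_complex A P N) (hom_diff P d) n"
proof -
  interpret P: proj_resolution A M P d \<epsilon> by fact
  interpret N: left_module A N by fact
  interpret L: left_module A "P i" for i by (rule P.left_module_term)
  show ?thesis
  proof (cases n)
    case 0
    then show ?thesis
      by (auto simp: coboundaries_def cocycles_def hom_complex_def hom_diff_def Hom_space_ops Hom_space_carrier
        P.d_closed L.smult_closed N.smult_r_zero intro!: module_homI)
  next
    case (Suc m)
    have "hom_diff P d m f \<in> cocycles (hom_complex A P N) (hom_diff P d) (Suc m)"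
      if f: "f \<in> carrier (hom_complex A P N m)" for f
    proof -
      have f': "f \<in> module_hom A (P m) N" using f by (simp add: hom_complex_def Hom_space_carrier)
      have "restrict (\<lambda>x. f (d m x)) (carrier (P (Suc m))) \<in> module_hom A (P (Suc m)) N"
        by (rule module_hom_restrict[OF module_hom_compose[OF P.d_hom f'] P.left_module_term])
      moreover have "f (d m (d (Suc m) x)) = \<zero>\<^bsub>N\<^esub>" if "x \<in> carrier (P (Suc (Suc m)))" for x
        using P.d_d[OF that] module_hom_zero[OF P.left_module_term N f'] by simp
      ultimately show ?thesis
        by (auto simp: cocycles_def hom_complex_def hom_diff_def Hom_space_ops Hom_space_carrier P.d_closed
          intro!: restrict_ext)
    qed
    then show ?thesis using Suc by (auto simp: coboundaries_def)
  qed
qed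

lemma cohomology_dim:
  fixes A :: "('k::field, 'a) module"
  assumes A: "scalar_algebra A" and P: "proj_resolution A M P d \<epsilon>" and N: "left_module A N"
    and I: "finite I" and \<theta>: "cohomology_coordinates (hom_complex A P N) (hom_diff P d) n I \<theta>"
  shows "vectorspace.fin_dim class_ring (cohomology (hom_complex A P N) (hom_diff P d) n) \<and>
    vectorspace.dim class_ring (cohomology (hom_complex A P N) (hom_diff P d) n) = card I"
proof -
  interpret P: proj_resolution A M P d \<epsilon> by fact
  interpret A: scalar_algebra A by fact
  interpret N: left_module A N by fact
  interpret L: left_module A "P i" for i by (rule P.left_module_term)
  interpret H: Module.module "class_ring :: 'k ring" "Hom_space A (P i) N" for i by (rule module_Hom_space[OF A P.left_module_term N])
  let ?Z = "cocycles (hom_complex A P N) (hom_diff P d) n"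
  have Z: "f \<in> ?Z \<longleftrightarrow> f \<in> carrier (Hom_space A (P n) N) \<and> (\<forall>x\<in>carrier (P (Suc n)). f (d n x) = \<zero>\<^bsub>N\<^esub>)" for f
    by (auto simp: cocycles_def hom_complex_def hom_diff_def Hom_space_ops restrict_def fun_eq_iff; metis)
  have neg: "\<ominus>\<^bsub>Hom_space A (P n) N\<^esub> f = (\<lambda>x\<in>carrier (P n). \<ominus>\<^bsub>N\<^esub> f x)" if f: "f \<in> carrier (Hom_space A (P n) N)" for f
  proof (rule H.minus_equality)
    have fh: "f \<in> module_hom A (P n) N" using f by (simp add: Hom_space_carrier)
    show "(\<lambda>x\<in>carrier (P n). \<ominus>\<^bsub>N\<^esub> f x) \<in> carrier (Hom_space A (P n) N)"
      using module_homD[OF fh]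
      by (auto simp: Hom_space_carrier L.smult_closed N.smult_r_minus N.minus_add intro!: module_homI)
    show "(\<lambda>x\<in>carrier (P n). \<ominus>\<^bsub>N\<^esub> f x) \<oplus>\<^bsub>Hom_space A (P n) N\<^esub> f = \<zero>\<^bsub>Hom_space A (P n) N\<^esub>"
      using module_homD(1)[OF fh] by (auto simp: Hom_space_ops N.l_neg)
  qed (rule f)
  have "Module.submodule ?Z (class_ring :: 'k ring) (Hom_space A (P n) N)"
  proof (rule H.submoduleI)
    show "?Z \<subseteq> carrier (Hom_space A (P n) N)" using Z by auto
    show "\<zero>\<^bsub>Hom_space A (P n) N\<^esub> \<in> ?Z" using H.zero_closed by (auto simp: Z Hom_space_ops P.d_closed)
    show "\<ominus>\<^bsub>Hom_space A (P n) N\<^esub> f \<in> ?Z" if "f \<in> ?Z" for f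
      using that H.a_inv_closed[of f n] by (auto simp: Z neg P.d_closed)
    show "f \<oplus>\<^bsub>Hom_space A (P n) N\<^esub> g \<in> ?Z" if "f \<in> ?Z" "g \<in> ?Z" for f g
      using that H.add.m_closed[of f n g] by (auto simp: Z Hom_space_ops P.d_closed)
    show "c \<odot>\<^bsub>Hom_space A (P n) N\<^esub> f \<in> ?Z" if "f \<in> ?Z" for c f
      using that H.smult_closed[of c f n] by (auto simp: Z Hom_space_ops P.d_closed N.smult_r_zero A.scalar_closed)
  qed
  then have W: "Module.module (class_ring :: 'k ring) ((hom_complex A P N n)\<lparr>carrier := ?Z\<rparr>)"
    using Module.submodule.submodule_is_module[OF _ H.module_axioms] by (simp add: hom_complex_def)
  show ?thesis unfolding cohomology_def
    by (rule quotient_dim[OF W _ I, where \<theta> = \<theta>])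
      (use \<theta> coboundaries_subset_cocycles[OF P N] in \<open>auto simp: cohomology_coordinates_def\<close>)
qed

text \<open>The assumptions on \<open>\<alpha>\<close> say that it induces an isomorphism in degree
  n: \<open>cob\<close> makes it well defined and injective on classes, \<open>surj\<close>
  surjective. Coordinates can then be pulled back along it.\<close>

lemma cohomology_coordinates_transport:
  assumes \<theta>: "cohomology_coordinates D \<delta>' n I \<theta>"
    and closed: "\<And>x. x \<in> cocycles C \<delta> n \<Longrightarrow> \<alpha> x \<in> cocycles D \<delta>' n"
    and add: "\<And>x y. x \<in> cocycles C \<delta> n \<Longrightarrow> y \<in> cocycles C \<delta> n \<Longrightarrow> \<alpha> (x \<oplus>\<^bsub>C n\<^esub> y) = \<alpha> x \<oplus>\<^bsub>D n\<^esub> \<alpha> y"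
    and smult: "\<And>c x. x \<in> cocycles C \<delta> n \<Longrightarrow> \<alpha> (c \<odot>\<^bsub>C n\<^esub> x) = c \<odot>\<^bsub>D n\<^esub> \<alpha> x"
    and cob: "\<And>x. x \<in> cocycles C \<delta> n \<Longrightarrow> \<alpha> x \<in> coboundaries D \<delta>' n \<longleftrightarrow> x \<in> coboundaries C \<delta> n"
    and surj: "\<And>w. w \<in> cocycles D \<delta>' n \<Longrightarrow> \<exists>z\<in>cocycles C \<delta> n. \<exists>b\<in>coboundaries D \<delta>' n. \<alpha> z = w \<oplus>\<^bsub>D n\<^esub> b"
    and sub: "coboundaries D \<delta>' n \<subseteq> cocycles D \<delta>' n"
  shows "cohomology_coordinates C \<delta> n I (\<lambda>x. \<theta> (\<alpha> x))"
  unfolding cohomology_coordinates_def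
proof (intro conjI)
  note t = \<theta>[unfolded cohomology_coordinates_def]
  show "\<forall>x\<in>cocycles C \<delta> n. \<forall>y\<in>cocycles C \<delta> n. \<forall>i\<in>I. \<theta> (\<alpha> (x \<oplus>\<^bsub>C n\<^esub> y)) i = \<theta> (\<alpha> x) i + \<theta> (\<alpha> y) i"
    using t closed by (simp add: add)
  show "\<forall>c. \<forall>x\<in>cocycles C \<delta> n. \<forall>i\<in>I. \<theta> (\<alpha> (c \<odot>\<^bsub>C n\<^esub> x)) i = c * \<theta> (\<alpha> x) i"
    using t closed by (simp add: smult)
  show "\<forall>x\<in>cocycles C \<delta> n. (x \<in> coboundaries C \<delta> n) = (\<forall>i\<in>I. \<theta> (\<alpha> x) i = 0)"
    using t closed cob by simp
  show "\<forall>t. \<exists>x\<in>cocycles C \<delta> n. \<forall>i\<in>I. \<theta> (\<alpha> x) i = t i"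
  proof
    fix t'
    obtain w where w: "w \<in> cocycles D \<delta>' n" "\<forall>i\<in>I. \<theta> w i = t' i" using t by metis
    obtain z b where z: "z \<in> cocycles C \<delta> n" "b \<in> coboundaries D \<delta>' n" "\<alpha> z = w \<oplus>\<^bsub>D n\<^esub> b"
      using surj[OF w(1)] by auto
    have b: "b \<in> cocycles D \<delta>' n" using z sub by auto
    then have "\<forall>i\<in>I. \<theta> b i = 0" using t z by simp
    then have "\<forall>i\<in>I. \<theta> (\<alpha> z) i = t' i" using t z b w by simp
    then show "\<exists>x\<in>cocycles C \<delta> n. \<forall>i\<in>I. \<theta> (\<alpha> x) i = t' i" using z(1) by blast
  qed
qed

lemma hom_complex_cocycle:
  "f \<in> cocycles (hom_complex A P N) (hom_diff P d) n \<longleftrightarrow>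
    f \<in> module_hom A (P n) N \<and> f \<in> extensional (carrier (P n)) \<and> (\<forall>x\<in>carrier (P (Suc n)). f (d n x) = \<zero>\<^bsub>N\<^esub>)"
  by (auto simp: cocycles_def hom_complex_def hom_diff_def Hom_space_ops Hom_space_carrier restrict_def fun_eq_iff; metis)

text \<open>Lifting the identity of \<open>M\<close> in both directions gives chain maps f and g.
  Precomposition with g is the isomorphism on cohomology; the homotopy s from g f to 1 yields its
  injectivity, the homotopy t from f g to 1 its surjectivity.\<close>

lemma comparison_coordinates:
  assumes "proj_resolution A M P d \<epsilon>" and "proj_resolution A M Q e \<eta>" and N: "left_module A N"
    and A: "scalar_algebra A"
    and \<theta>: "cohomology_coordinates (hom_complex A Q N) (hom_diff Q e) n I \<theta>"
  shows "\<exists>\<theta>'. cohomology_coordinates (hom_complex A P N) (hom_diff P d) n I \<theta>'"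
proof -
  interpret A: scalar_algebra A by fact
  interpret P: proj_resolution A M P d \<epsilon> by fact
  interpret Q: proj_resolution A M Q e \<eta> by fact
  interpret N: left_module A N by fact
  interpret PL: left_module A "P i" for i by (rule P.left_module_term)
  interpret QL: left_module A "Q i" for i by (rule Q.left_module_term)
  obtain f where f: "\<And>n. f n \<in> module_hom A (P n) (Q n)"
    "\<And>n x. x \<in> carrier (P (Suc n)) \<Longrightarrow> e n (f (Suc n) x) = f n (d n x)"
    "\<And>x. x \<in> carrier (P 0) \<Longrightarrow> \<eta> (f 0 x) = \<epsilon> x"
    using chain_map_exists[OF assms(1,2)] by metis
  obtain g where g: "\<And>n. g n \<in> module_hom A (Q n) (P n)"
    "\<And>n x. x \<in> carrier (Q (Suc n)) \<Longrightarrow> d n (g (Suc n) x) = g n (e n x)"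
    "\<And>x. x \<in> carrier (Q 0) \<Longrightarrow> \<epsilon> (g 0 x) = \<eta> x"
    using chain_map_exists[OF assms(2,1)] by metis
  note fc = module_homD(1)[OF f(1)] and gc = module_homD(1)[OF g(1)]
  obtain s where s: "\<And>n. s n \<in> module_hom A (P n) (P (Suc n))"
    "\<And>x. x \<in> carrier (P 0) \<Longrightarrow> d 0 (s 0 x) = g 0 (f 0 x) \<ominus>\<^bsub>P 0\<^esub> x"
    "\<And>n x. x \<in> carrier (P (Suc n)) \<Longrightarrow>
      d (Suc n) (s (Suc n) x) = g (Suc n) (f (Suc n) x) \<ominus>\<^bsub>P (Suc n)\<^esub> x \<ominus>\<^bsub>P (Suc n)\<^esub> s n (d n x)"
    by (rule P.homotopy_exists[of "\<lambda>n x. g n (f n x)"])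
      (auto simp: f g fc P.d_closed intro: module_hom_compose[OF f(1) g(1)])
  obtain t where t: "\<And>n. t n \<in> module_hom A (Q n) (Q (Suc n))"
    "\<And>x. x \<in> carrier (Q 0) \<Longrightarrow> e 0 (t 0 x) = f 0 (g 0 x) \<ominus>\<^bsub>Q 0\<^esub> x"
    "\<And>n x. x \<in> carrier (Q (Suc n)) \<Longrightarrow>
      e (Suc n) (t (Suc n) x) = f (Suc n) (g (Suc n) x) \<ominus>\<^bsub>Q (Suc n)\<^esub> x \<ominus>\<^bsub>Q (Suc n)\<^esub> t n (e n x)"
    by (rule Q.homotopy_exists[of "\<lambda>n x. f n (g n x)"])
      (auto simp: f g gc Q.d_closed intro: module_hom_compose[OF g(1) f(1)])
  note sc = module_homD(1)[OF s(1)] and tc = module_homD(1)[OF t(1)]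
  have N0: "a = b" if "a \<ominus>\<^bsub>N\<^esub> b = \<zero>\<^bsub>N\<^esub>" "a \<in> carrier N" "b \<in> carrier N" for a b
    using that by (metis N.M.add.inv_closed N.M.minus_equality N.M.minus_minus a_minus_def)
  have N1: "a = b \<oplus>\<^bsub>N\<^esub> c" "b = a \<ominus>\<^bsub>N\<^esub> c"
    if "a \<ominus>\<^bsub>N\<^esub> b \<ominus>\<^bsub>N\<^esub> c = \<zero>\<^bsub>N\<^esub>" "a \<in> carrier N" "b \<in> carrier N" "c \<in> carrier N" for a b c
  proof -
    have 1: "a \<ominus>\<^bsub>N\<^esub> b = c" using N0[of "a \<ominus>\<^bsub>N\<^esub> b" c] that by simp
    then show 2: "a = b \<oplus>\<^bsub>N\<^esub> c" using that by (auto simp: a_minus_def N.a_ac N.r_neg N.r_neg1 N.r_neg2)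
    show "b = a \<ominus>\<^bsub>N\<^esub> c" using that by (subst 2) (simp add: a_minus_def N.M.a_assoc N.r_neg)
  qed
  let ?C = "hom_complex A P N" and ?\<delta> = "hom_diff P d" and ?D = "hom_complex A Q N" and ?\<delta>' = "hom_diff Q e"
  define \<alpha> where "\<alpha> \<phi> = (\<lambda>x\<in>carrier (Q n). \<phi> (g n x))" for \<phi> :: "'d \<Rightarrow> 'f"
  have hom_in: "(\<lambda>x\<in>carrier (P n). \<phi> x) \<in> carrier (?C n)" if "\<phi> \<in> module_hom A (P n) N" for \<phi> n
    using module_hom_restrict[OF that P.left_module_term] by (simp add: hom_complex_def Hom_space_carrier)
  have hom_in': "(\<lambda>x\<in>carrier (Q n). \<phi> x) \<in> carrier (?D n)" if "\<phi> \<in> module_hom A (Q n) N" for \<phi> n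
    using module_hom_restrict[OF that Q.left_module_term] by (simp add: hom_complex_def Hom_space_carrier)
  have "cohomology_coordinates ?C ?\<delta> n I (\<lambda>x. \<theta> (\<alpha> x))"
  proof (rule cohomology_coordinates_transport[OF \<theta> _ _ _ _ _ coboundaries_subset_cocycles[OF assms(2) N]])
    fix \<phi> assume \<phi>: "\<phi> \<in> cocycles ?C ?\<delta> n"
    then have \<phi>h: "\<phi> \<in> module_hom A (P n) N" and \<phi>d: "\<And>x. x \<in> carrier (P (Suc n)) \<Longrightarrow> \<phi> (d n x) = \<zero>\<^bsub>N\<^esub>"
      and \<phi>e: "\<phi> \<in> extensional (carrier (P n))"
      by (auto simp: hom_complex_cocycle)
    note \<phi>c = module_homD(1)[OF \<phi>h]
    show "\<alpha> \<phi> \<in> cocycles ?D ?\<delta>' n"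
      unfolding hom_complex_cocycle \<alpha>_def
      using module_hom_restrict[OF module_hom_compose[OF g(1) \<phi>h] Q.left_module_term]
      by (auto simp: Q.d_closed g(2)[symmetric] \<phi>d gc)
    show "\<alpha> (c \<odot>\<^bsub>?C n\<^esub> \<phi>) = c \<odot>\<^bsub>?D n\<^esub> \<alpha> \<phi>" for c
      by (auto simp: \<alpha>_def hom_complex_def Hom_space_ops gc)
    show "\<alpha> \<phi> \<in> coboundaries ?D ?\<delta>' n \<longleftrightarrow> \<phi> \<in> coboundaries ?C ?\<delta> n"
    proof (cases n)
      case 0
      have "\<phi> = (\<lambda>x\<in>carrier (P 0). \<zero>\<^bsub>N\<^esub>)" if "\<alpha> \<phi> = (\<lambda>x\<in>carrier (Q 0). \<zero>\<^bsub>N\<^esub>)"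
      proof (rule extensionalityI[OF \<phi>e[unfolded 0]])
        fix x assume x: "x \<in> carrier (P 0)"
        have "\<phi> (g 0 (f 0 x)) = \<zero>\<^bsub>N\<^esub>"
          using fun_cong[OF that, of "f 0 x"] fc[OF x] by (simp add: \<alpha>_def 0)
        moreover have "\<phi> (g 0 (f 0 x)) \<ominus>\<^bsub>N\<^esub> \<phi> x = \<zero>\<^bsub>N\<^esub>"
          using module_hom_minus[OF P.left_module_term N \<phi>h[unfolded 0] gc[OF fc[OF x]] x] s(2)[OF x] \<phi>d[of "s 0 x"] sc[OF x]
          by (simp add: 0)
        ultimately show "\<phi> x = (\<lambda>x\<in>carrier (P 0). \<zero>\<^bsub>N\<^esub>) x"
          using N0[of "\<phi> (g 0 (f 0 x))" "\<phi> x"] x \<phi>c[unfolded 0] by simp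
      qed simp
      moreover have "\<alpha> (\<lambda>x\<in>carrier (P 0). \<zero>\<^bsub>N\<^esub>) = (\<lambda>x\<in>carrier (Q 0). \<zero>\<^bsub>N\<^esub>)"
        using gc by (auto simp: \<alpha>_def 0)
      ultimately show ?thesis
        unfolding 0 coboundaries_def by (auto simp: hom_complex_def Hom_space_ops)
    next
      case (Suc m)
      show ?thesis
      proof
        assume "\<phi> \<in> coboundaries ?C ?\<delta> n"
        then obtain \<psi> where \<psi>: "\<psi> \<in> carrier (?C m)" "\<phi> = ?\<delta> m \<psi>" by (auto simp: coboundaries_def Suc)
        have \<psi>h: "\<psi> \<in> module_hom A (P m) N" using \<psi> by (simp add: hom_complex_def Hom_space_carrier)
        have "\<alpha> \<phi> = ?\<delta>' m (\<lambda>x\<in>carrier (Q m). \<psi> (g m x))"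
          by (auto simp: \<alpha>_def Suc \<psi>(2) hom_diff_def gc Q.d_closed g(2) intro!: restrict_ext)
        then show "\<alpha> \<phi> \<in> coboundaries ?D ?\<delta>' n"
          using hom_in'[OF module_hom_compose[OF g(1) \<psi>h]] by (simp add: coboundaries_def Suc)
      next
        assume "\<alpha> \<phi> \<in> coboundaries ?D ?\<delta>' n"
        then obtain \<psi> where \<psi>: "\<psi> \<in> carrier (?D m)" "\<alpha> \<phi> = ?\<delta>' m \<psi>" by (auto simp: coboundaries_def Suc)
        have \<psi>h: "\<psi> \<in> module_hom A (Q m) N" using \<psi> by (simp add: hom_complex_def Hom_space_carrier)
        have \<psi>x: "\<phi> (g n y) = \<psi> (e m y)" if "y \<in> carrier (Q n)" for y
          using fun_cong[OF \<psi>(2), of y] that by (simp add: \<alpha>_def hom_diff_def Suc)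
        have sh: "s m \<in> module_hom A (P m) (P n)" using s(1) by (simp add: Suc)
        \<comment> \<open>A cocycle \<phi> vanishes on d s = g f - 1 - s d, and \<phi> g = \<psi> e
          by assumption. Hence \<phi> = \<phi> g f - \<phi> s d = (\<psi> f - \<phi> s) d.\<close>
        let ?\<chi> = "\<lambda>x. \<psi> (f m x) \<ominus>\<^bsub>N\<^esub> \<phi> (s m x)"
        have \<chi>: "?\<chi> \<in> module_hom A (P m) N"
          by (rule module_hom_diff[OF P.left_module_term N module_hom_compose[OF f(1) \<psi>h] module_hom_compose[OF sh \<phi>h]])
        have "\<phi> = ?\<delta> m (\<lambda>x\<in>carrier (P m). ?\<chi> x)"
        proof (rule extensionalityI[OF \<phi>e])
          fix x assume x: "x \<in> carrier (P n)"
          then have x': "x \<in> carrier (P (Suc m))" by (simp add: Suc)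
          have c: "g n (f n x) \<in> carrier (P n)" "s m (d m x) \<in> carrier (P n)"
            using gc fc x sc[OF P.d_closed[OF x']] by (auto simp: Suc)
          have "\<phi> (g n (f n x) \<ominus>\<^bsub>P n\<^esub> x \<ominus>\<^bsub>P n\<^esub> s m (d m x)) = \<zero>\<^bsub>N\<^esub>"
            using s(3)[OF x'] \<phi>d[of "s n x"] sc[OF x] by (simp add: Suc)
          then have "\<phi> (g n (f n x)) \<ominus>\<^bsub>N\<^esub> \<phi> x \<ominus>\<^bsub>N\<^esub> \<phi> (s m (d m x)) = \<zero>\<^bsub>N\<^esub>"
            using c x by (simp add: module_hom_minus[OF P.left_module_term N \<phi>h])
          then have "\<phi> x = \<phi> (g n (f n x)) \<ominus>\<^bsub>N\<^esub> \<phi> (s m (d m x))"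
            by (rule N1(2)) (use c x \<phi>c in auto)
          then show "\<phi> x = ?\<delta> m (\<lambda>x\<in>carrier (P m). ?\<chi> x) x"
            using x x' \<psi>x[of "f n x"] fc[OF x] f(2)[OF x'] P.d_closed[OF x'] by (simp add: hom_diff_def Suc)
        qed (simp add: hom_diff_def Suc)
        then show "\<phi> \<in> coboundaries ?C ?\<delta> n"
          using hom_in[OF \<chi>] by (simp add: coboundaries_def Suc)
      qed
    qed
  next
    fix \<phi> \<psi> assume "\<phi> \<in> cocycles ?C ?\<delta> n" "\<psi> \<in> cocycles ?C ?\<delta> n"
    show "\<alpha> (\<phi> \<oplus>\<^bsub>?C n\<^esub> \<psi>) = \<alpha> \<phi> \<oplus>\<^bsub>?D n\<^esub> \<alpha> \<psi>"
      by (auto simp: \<alpha>_def hom_complex_def Hom_space_ops gc)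
  next
    fix w assume w: "w \<in> cocycles ?D ?\<delta>' n"
    then have wh: "w \<in> module_hom A (Q n) N" and wd: "\<And>x. x \<in> carrier (Q (Suc n)) \<Longrightarrow> w (e n x) = \<zero>\<^bsub>N\<^esub>"
      and we: "w \<in> extensional (carrier (Q n))"
      by (auto simp: hom_complex_cocycle)
    note wc = module_homD(1)[OF wh]
    \<comment> \<open>The preimage of the class of w is the class of w f: since w vanishes on e t =
      f g - 1 - t e, the cocycles w f g and w differ by the coboundary w t e.\<close>
    let ?z = "\<lambda>x\<in>carrier (P n). w (f n x)"
    have z: "?z \<in> cocycles ?C ?\<delta> n"
      unfolding hom_complex_cocycle
      using module_hom_restrict[OF module_hom_compose[OF f(1) wh] P.left_module_term]
      by (auto simp: P.d_closed f(2)[symmetric] wd fc)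
    have "\<exists>b\<in>coboundaries ?D ?\<delta>' n. \<alpha> ?z = w \<oplus>\<^bsub>?D n\<^esub> b"
    proof (cases n)
      case 0
      have "\<alpha> ?z = w \<oplus>\<^bsub>?D n\<^esub> \<zero>\<^bsub>?D n\<^esub>"
      proof (rule extensionalityI[of _ "carrier (Q n)"])
        fix x assume x: "x \<in> carrier (Q n)"
        have "w (f 0 (g 0 x)) \<ominus>\<^bsub>N\<^esub> w x = \<zero>\<^bsub>N\<^esub>"
          using module_hom_minus[OF Q.left_module_term N wh[unfolded 0], of "f 0 (g 0 x)" x] fc gc x t(2)[of x] wd[of "t 0 x"] tc[of x 0]
          by (simp add: 0)
        then show "\<alpha> ?z x = (w \<oplus>\<^bsub>?D n\<^esub> \<zero>\<^bsub>?D n\<^esub>) x"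
          using N0[of "w (f 0 (g 0 x))" "w x"] x wc fc gc
          by (simp add: \<alpha>_def hom_complex_def Hom_space_ops 0)
      qed (simp_all add: \<alpha>_def hom_complex_def Hom_space_ops)
      then show ?thesis by (simp add: coboundaries_def 0)
    next
      case (Suc m)
      have th: "t m \<in> module_hom A (Q m) (Q n)" using t(1) by (simp add: Suc)
      let ?b = "?\<delta>' m (\<lambda>x\<in>carrier (Q m). w (t m x))"
      have "\<alpha> ?z = w \<oplus>\<^bsub>?D n\<^esub> ?b"
      proof (rule extensionalityI[of _ "carrier (Q n)"])
        fix x assume x: "x \<in> carrier (Q n)"
        then have x': "x \<in> carrier (Q (Suc m))" by (simp add: Suc)
        have c: "f n (g n x) \<in> carrier (Q n)" "t m (e m x) \<in> carrier (Q n)"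
          using gc fc x tc[OF Q.d_closed[OF x']] by (auto simp: Suc)
        have "w (f n (g n x) \<ominus>\<^bsub>Q n\<^esub> x \<ominus>\<^bsub>Q n\<^esub> t m (e m x)) = \<zero>\<^bsub>N\<^esub>"
          using t(3)[OF x'] wd[of "t n x"] tc[OF x] by (simp add: Suc)
        then have "w (f n (g n x)) \<ominus>\<^bsub>N\<^esub> w x \<ominus>\<^bsub>N\<^esub> w (t m (e m x)) = \<zero>\<^bsub>N\<^esub>"
          using c x by (simp add: module_hom_minus[OF Q.left_module_term N wh])
        then have "w (f n (g n x)) = w x \<oplus>\<^bsub>N\<^esub> w (t m (e m x))"
          by (rule N1(1)) (use c x wc in auto)
        then show "\<alpha> ?z x = (w \<oplus>\<^bsub>?D n\<^esub> ?b) x"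
          using x x' gc[OF x] Q.d_closed[OF x']
          by (simp add: \<alpha>_def hom_complex_def Hom_space_ops hom_diff_def Suc)
      qed (simp_all add: \<alpha>_def hom_complex_def Hom_space_ops)
      then show ?thesis
        using hom_in'[OF module_hom_compose[OF th wh]] by (auto simp: coboundaries_def Suc)
    qed
    then show "\<exists>z\<in>cocycles ?C ?\<delta> n. \<exists>b\<in>coboundaries ?D ?\<delta>' n. \<alpha> z = w \<oplus>\<^bsub>?D n\<^esub> b" using z by blast
  qed
  then show ?thesis by blast
qed

text \<open>\<open>Q\<close> serves twice. It witnesses that the triple picked by
  \<open>SOME\<close> is a resolution at all, for which it must live in the type fixed in
  \<open>Ext\<close>, and it is the resolution from which the answer is read off.\<close>

lemma Ext_dim:
  fixes A :: "('k::field, 'a) module" and M :: "('a, 'm) module"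
    and Q :: "nat \<Rightarrow> ('a, ('a + 'm) list \<Rightarrow> 'a) module"
  assumes A: "scalar_algebra A" and M: "left_module A M" and N: "left_module A N" and I: "finite I"
    and Q: "projective_resolution A M Q e \<eta>"
    and \<theta>: "cohomology_coordinates (hom_complex A Q N) (hom_diff Q e) n I \<theta>"
  shows "vectorspace.fin_dim class_ring (Ext A M N n) \<and> vectorspace.dim class_ring (Ext A M N n) = card I"
proof -
  define p where "p = (SOME (P :: nat \<Rightarrow> ('a, ('a + 'm) list \<Rightarrow> 'a) module, d, \<epsilon>). projective_resolution A M P d \<epsilon>)"
  obtain P d \<epsilon> where p: "p = (P, d, \<epsilon>)" by (cases p)
  have "case p of (P, d, \<epsilon>) \<Rightarrow> projective_resolution A M P d \<epsilon>"
    unfolding p_def by (rule someI[of _ "(Q, e, \<eta>)"]) (use Q in simp)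
  then have P: "proj_resolution A M P d \<epsilon>" using M by (simp add: p proj_resolution_def)
  have Q': "proj_resolution A M Q e \<eta>" using Q M by (simp add: proj_resolution_def)
  obtain \<theta>' where "cohomology_coordinates (hom_complex A P N) (hom_diff P d) n I \<theta>'"
    using comparison_coordinates[OF P Q' N A \<theta>] by blast
  from cohomology_dim[OF A P N I this] show ?thesis
    by (simp add: Ext_def p_def[symmetric] p hom_complex_def hom_diff_def)
qed

section \<open>Monoid algebras\<close>

definition linear_extension :: "('k::field \<Rightarrow> 'b::ab_group_add \<Rightarrow> 'b) \<Rightarrow> ('g \<Rightarrow> 'b) \<Rightarrow> ('g \<Rightarrow> 'k) \<Rightarrow> 'b" where
  "linear_extension sc u f = (\<Sum>g\<in>{g. f g \<noteq> 0}. sc (f g) (u g))"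

context vector_space
begin


lemma ext_superset:
  fixes f f' :: "'g \<Rightarrow> 'a"
  shows "finite T \<Longrightarrow> {g. f g \<noteq> 0} \<subseteq> T \<Longrightarrow> linear_extension scale u f = (\<Sum>g\<in>T. scale (f g) (u g))"
  unfolding linear_extension_def by (rule sum.mono_neutral_left) auto

lemma ext_add:
  fixes f f' :: "'g \<Rightarrow> 'a"
  assumes "finite {g. f g \<noteq> 0}" "finite {g. f' g \<noteq> 0}"
  shows "linear_extension scale u (\<lambda>g. f g + f' g) = linear_extension scale u f + linear_extension scale u f'"
proof -
  let ?T = "{g. f g \<noteq> 0} \<union> {g. f' g \<noteq> 0}"
  have T: "finite ?T" using assms by simp
  have "linear_extension scale u (\<lambda>g. f g + f' g) = (\<Sum>g\<in>?T. scale (f g + f' g) (u g))" by (rule ext_superset[OF T]) auto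
  also have "\<dots> = linear_extension scale u f + linear_extension scale u f'"
    by (subst (1 2) ext_superset[OF T]) (auto simp: scale_left_distrib sum.distrib)
  finally show ?thesis .
qed

lemma ext_scale:
  fixes f f' :: "'g \<Rightarrow> 'a"
  assumes "finite {g. f g \<noteq> 0}"
  shows "linear_extension scale u (\<lambda>g. c * f g) = scale c (linear_extension scale u f)"
proof -
  have "linear_extension scale u (\<lambda>g. c * f g) = (\<Sum>g\<in>{g. f g \<noteq> 0}. scale (c * f g) (u g))"
    by (rule ext_superset[OF assms]) auto
  then show ?thesis by (simp add: linear_extension_def scale_sum_right)
qed

lemma ext_diff:
  fixes f f' :: "'g \<Rightarrow> 'a"
  assumes "finite {g. f g \<noteq> 0}" "finite {g. f' g \<noteq> 0}"
  shows "linear_extension scale u (\<lambda>g. f g - f' g) = linear_extension scale u f - linear_extension scale u f'"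
proof -
  have "finite {g. - 1 * f' g \<noteq> 0}" using assms(2) by simp
  then have "linear_extension scale u (\<lambda>g. f g + - 1 * f' g) =
      linear_extension scale u f + linear_extension scale u (\<lambda>g. - 1 * f' g)"
    by (rule ext_add[OF assms(1)])
  also have "linear_extension scale u (\<lambda>g. - 1 * f' g) = - linear_extension scale u f'"
    by (subst ext_scale[OF assms(2)]) simp
  finally show ?thesis by simp
qed

lemma ext_delta [simp]: "linear_extension scale u (delta g) = u g"
proof -
  have "linear_extension scale u (delta g) = (\<Sum>h\<in>{g}. scale (delta g h) (u h))"
    by (rule ext_superset) (auto simp: delta_def)
  then show ?thesis by (simp add: delta_def)
qed

lemma ext_zero [simp]: "linear_extension scale u (\<lambda>_. 0) = 0"
  by (simp add: linear_extension_def)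

end

section \<open>Finite supports and the ring structure of a monoid algebra\<close>

abbreviation support :: "('g \<Rightarrow> 'k::zero) \<Rightarrow> 'g set" where "support f \<equiv> {g. f g \<noteq> 0}"

lemma finite_support_delta: "finite (support (delta g))"
  by (rule finite_subset[of _ "{g}"]) (auto simp: delta_def)

lemma finite_support_add:
  fixes f f' :: "'g \<Rightarrow> 'k::field"
  shows "finite (support f) \<Longrightarrow> finite (support f') \<Longrightarrow> finite (support (\<lambda>g. f g + f' g))"
  by (rule finite_subset[of _ "support f \<union> support f'"]) auto

lemma finite_support_scale:
  fixes f :: "'g \<Rightarrow> 'k::field"
  shows "finite (support f) \<Longrightarrow> finite (support (\<lambda>g. c * f g))"
  by (erule rev_finite_subset) auto

lemma finite_support_neq:
  fixes f f' :: "'g \<Rightarrow> 'k::field"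
  shows "finite (support f) \<Longrightarrow> finite (support f') \<Longrightarrow> finite {g. f g \<noteq> f' g}"
  by (rule finite_subset[of _ "support f \<union> support f'"]) auto

lemmas finite_support = finite_support_delta finite_support_add finite_support_scale

lemma monoid_algebra_simps:
  "f \<in> carrier (monoid_algebra G) \<longleftrightarrow> finite (support f) \<and> support f \<subseteq> carrier G"
  "\<one>\<^bsub>monoid_algebra G\<^esub> = delta \<one>\<^bsub>G\<^esub>"
  "\<zero>\<^bsub>monoid_algebra G\<^esub> = (\<lambda>_. 0)"
  "f \<oplus>\<^bsub>monoid_algebra G\<^esub> f' = (\<lambda>g. f g + f' g)"
  "c \<odot>\<^bsub>monoid_algebra G\<^esub> f = (\<lambda>g. c * f g)"
  by (simp_all add: monoid_algebra_def)

lemma delta_carrier [simp]: "g \<in> carrier G \<Longrightarrow> delta g \<in> carrier (monoid_algebra G)"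
  by (auto simp: monoid_algebra_simps finite_support_delta) (auto simp: delta_def split: if_splits)

interpretation field_space: vector_space "(*) :: 'k::field \<Rightarrow> 'k \<Rightarrow> 'k"
  by unfold_locales (auto simp: algebra_simps)

text \<open>As a rewrite rule, \<open>scale_scale\<close> for the field itself reverses \<open>mult.assoc\<close>.\<close>

declare field_space.scale_scale [simp del]

lemma ext_point: "finite (support f) \<Longrightarrow> linear_extension (*) (\<lambda>g. if g = h then 1 else 0) f = f h"
  by (auto simp: linear_extension_def if_distrib sum.delta' cong: if_cong)

text \<open>Identities in the monoid algebra are tested on all linear functionals, because
  \<open>ext_mult\<close> evaluates a product there without any knowledge of its support.\<close>

lemma fun_eq_by_extI:
  fixes f f' :: "'g \<Rightarrow> 'k::field"
  assumes "finite (support f)" "finite (support f')"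
    and "\<And>u :: 'g \<Rightarrow> 'k. linear_extension (*) u f = linear_extension (*) u f'"
  shows "f = f'"
  using ext_point[OF assms(1)] ext_point[OF assms(2)] assms(3) by (metis ext)

lemma monoid_algebra_mult_support:
  assumes "f \<in> carrier (monoid_algebra G)" "f' \<in> carrier (monoid_algebra G)"
  shows "support (f \<otimes>\<^bsub>monoid_algebra G\<^esub> f') \<subseteq> (\<lambda>(a, b). a \<otimes>\<^bsub>G\<^esub> b) ` (support f \<times> support f')"
proof
  fix h assume "h \<in> support (f \<otimes>\<^bsub>monoid_algebra G\<^esub> f')"
  then have "(\<Sum>a\<in>support f. \<Sum>b\<in>support f'. if a \<otimes>\<^bsub>G\<^esub> b = h then f a * f' b else 0) \<noteq> 0"
    by (simp add: monoid_algebra_def)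
  then obtain a where "a \<in> support f" "(\<Sum>b\<in>support f'. if a \<otimes>\<^bsub>G\<^esub> b = h then f a * f' b else 0) \<noteq> 0"
    by (rule sum.not_neutral_contains_not_neutral)
  moreover from this(2) obtain b where "b \<in> support f'" "a \<otimes>\<^bsub>G\<^esub> b = h"
    by (rule sum.not_neutral_contains_not_neutral) (metis (full_types))
  ultimately show "h \<in> (\<lambda>(a, b). a \<otimes>\<^bsub>G\<^esub> b) ` (support f \<times> support f')" by force
qed

text \<open>The sum over the fibres of the multiplication collapses to one over pairs of monoid
  elements, so that laws of the convolution follow from laws of \<open>G\<close>.\<close>

lemma (in vector_space) ext_mult:
  fixes f f' :: "'g \<Rightarrow> 'a"
  assumes f: "f \<in> carrier (monoid_algebra G)" and f': "f' \<in> carrier (monoid_algebra G)"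
  shows "linear_extension scale u (f \<otimes>\<^bsub>monoid_algebra G\<^esub> f') = linear_extension scale (\<lambda>a. linear_extension scale (\<lambda>b. u (a \<otimes>\<^bsub>G\<^esub> b)) f') f"
proof -
  let ?T = "(\<lambda>(a, b). a \<otimes>\<^bsub>G\<^esub> b) ` (support f \<times> support f')"
  have fin: "finite (support f)" "finite (support f')" using f f' by (auto simp: monoid_algebra_simps)
  then have T: "finite ?T" by simp
  have "linear_extension scale u (f \<otimes>\<^bsub>monoid_algebra G\<^esub> f') =
      (\<Sum>h\<in>?T. scale (\<Sum>a\<in>support f. \<Sum>b\<in>support f'. if a \<otimes>\<^bsub>G\<^esub> b = h then f a * f' b else 0) (u h))"
    by (subst ext_superset[OF T monoid_algebra_mult_support[OF f f']]) (simp add: monoid_algebra_def)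
  also have "\<dots> = (\<Sum>h\<in>?T. \<Sum>a\<in>support f. \<Sum>b\<in>support f'.
      if a \<otimes>\<^bsub>G\<^esub> b = h then scale (f a * f' b) (u h) else 0)"
    unfolding scale_sum_left by (intro sum.cong refl) auto
  also have "\<dots> = (\<Sum>a\<in>support f. \<Sum>b\<in>support f'. \<Sum>h\<in>?T.
      if a \<otimes>\<^bsub>G\<^esub> b = h then scale (f a * f' b) (u h) else 0)"
    by (rule trans[OF sum.swap sum.cong[OF refl sum.swap]])
  also have "\<dots> = (\<Sum>a\<in>support f. \<Sum>b\<in>support f'. scale (f a * f' b) (u (a \<otimes>\<^bsub>G\<^esub> b)))"
    by (intro sum.cong refl, subst sum.delta'[OF T]) auto
  also have "\<dots> = linear_extension scale (\<lambda>a. linear_extension scale (\<lambda>b. u (a \<otimes>\<^bsub>G\<^esub> b)) f') f"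
    by (simp add: linear_extension_def scale_sum_right)
  finally show ?thesis .
qed

lemma (in vector_space) ext_cong:
  fixes f f' :: "'g \<Rightarrow> 'a"
  shows   "(\<And>g. f g \<noteq> 0 \<Longrightarrow> u g = v g) \<Longrightarrow> linear_extension scale u f = linear_extension scale v f"
  unfolding linear_extension_def by (intro sum.cong) auto

lemma ring_monoid_algebra:
  fixes G :: "('g, 'm) monoid_scheme"
  assumes "Group.monoid G"
  shows "ring (monoid_algebra G :: ('k::field, 'g \<Rightarrow> 'k) module)"
proof -
  interpret G: Group.monoid G by fact
  let ?M = "monoid_algebra G :: ('k, 'g \<Rightarrow> 'k) module"
  have closed: "f \<otimes>\<^bsub>?M\<^esub> f' \<in> carrier ?M" if "f \<in> carrier ?M" "f' \<in> carrier ?M" for f f'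
  proof -
    let ?T = "(\<lambda>(a, b). a \<otimes>\<^bsub>G\<^esub> b) ` (support f \<times> support f')"
    have "finite ?T" "?T \<subseteq> carrier G" using that by (auto simp: monoid_algebra_simps(1) subset_iff)
    with monoid_algebra_mult_support[OF that] show ?thesis
      unfolding monoid_algebra_simps(1) by (meson finite_subset order_trans)
  qed
  have fin: "finite (support f)" if "f \<in> carrier ?M" for f using that by (simp add: monoid_algebra_simps)
  have add: "f \<oplus>\<^bsub>?M\<^esub> f' \<in> carrier ?M" if "f \<in> carrier ?M" "f' \<in> carrier ?M" for f f'
  proof -
    have "support (f \<oplus>\<^bsub>?M\<^esub> f') \<subseteq> support f \<union> support f'" by (auto simp: monoid_algebra_simps(4))
    moreover have "finite (support f \<union> support f')" "support f \<union> support f' \<subseteq> carrier G"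
      using that by (auto simp: monoid_algebra_simps(1))
    ultimately show ?thesis unfolding monoid_algebra_simps(1) by (meson finite_subset order_trans)
  qed
  note E = field_space.ext_mult field_space.ext_add
  have ab: "abelian_group ?M"
  proof (rule abelian_groupI)
    fix f assume "f \<in> carrier ?M"
    then show "\<exists>g\<in>carrier ?M. g \<oplus>\<^bsub>?M\<^esub> f = \<zero>\<^bsub>?M\<^esub>"
      by (intro bexI[of _ "\<lambda>g. - f g"]) (auto simp: monoid_algebra_simps)
  qed (use add in \<open>auto simp: monoid_algebra_simps ac_simps\<close>)
  have mon: "Group.monoid ?M"
  proof (rule monoidI)
    show "\<one>\<^bsub>?M\<^esub> \<in> carrier ?M" using G.one_closed delta_carrier by (simp add: monoid_algebra_simps(2))
    fix f assume f: "f \<in> carrier ?M"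
    have one: "delta \<one>\<^bsub>G\<^esub> \<in> carrier ?M" by simp
    have u: "linear_extension (*) (\<lambda>a. u (a \<otimes>\<^bsub>G\<^esub> \<one>\<^bsub>G\<^esub>)) f = linear_extension (*) u f"
      "linear_extension (*) (\<lambda>a. u (\<one>\<^bsub>G\<^esub> \<otimes>\<^bsub>G\<^esub> a)) f = linear_extension (*) u f" for u :: "'g \<Rightarrow> 'k"
      using f by (auto simp: monoid_algebra_simps intro!: field_space.ext_cong)
    show "\<one>\<^bsub>?M\<^esub> \<otimes>\<^bsub>?M\<^esub> f = f"
      unfolding monoid_algebra_simps
      by (rule fun_eq_by_extI) (use fin f closed one in \<open>auto simp: E u\<close>)
    show "f \<otimes>\<^bsub>?M\<^esub> \<one>\<^bsub>?M\<^esub> = f"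
      unfolding monoid_algebra_simps
      by (rule fun_eq_by_extI) (use fin f closed one in \<open>auto simp: E u\<close>)
    fix g h assume g: "g \<in> carrier ?M" and h: "h \<in> carrier ?M"
    show "f \<otimes>\<^bsub>?M\<^esub> g \<otimes>\<^bsub>?M\<^esub> h = f \<otimes>\<^bsub>?M\<^esub> (g \<otimes>\<^bsub>?M\<^esub> h)"
    proof (rule fun_eq_by_extI)
      fix u :: "'g \<Rightarrow> 'k"
      show "linear_extension (*) u (f \<otimes>\<^bsub>?M\<^esub> g \<otimes>\<^bsub>?M\<^esub> h) = linear_extension (*) u (f \<otimes>\<^bsub>?M\<^esub> (g \<otimes>\<^bsub>?M\<^esub> h))"
        using f g h
        by (simp add: E closed)
          (intro field_space.ext_cong, auto simp: monoid_algebra_simps G.m_assoc subset_iff intro!: field_space.ext_cong)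
    qed (use fin f g h closed in auto)
  qed (rule closed)
  have sum_in: "linear_extension (*) (\<lambda>a. linear_extension (*) (v a) g + linear_extension (*) (v a) h) f
      = linear_extension (*) (\<lambda>a. linear_extension (*) (v a) g) f + linear_extension (*) (\<lambda>a. linear_extension (*) (v a) h) f"
    for f g h :: "'g \<Rightarrow> 'k" and v :: "'g \<Rightarrow> 'g \<Rightarrow> 'k"
    by (simp add: linear_extension_def distrib_left sum.distrib)
  show ?thesis
  proof (rule ringI[OF ab mon])
    fix f g h assume fgh: "f \<in> carrier ?M" "g \<in> carrier ?M" "h \<in> carrier ?M"
    show "(f \<oplus>\<^bsub>?M\<^esub> g) \<otimes>\<^bsub>?M\<^esub> h = f \<otimes>\<^bsub>?M\<^esub> h \<oplus>\<^bsub>?M\<^esub> g \<otimes>\<^bsub>?M\<^esub> h"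
    proof (rule fun_eq_by_extI)
      fix u :: "'g \<Rightarrow> 'k"
      have "linear_extension (*) u ((f \<oplus>\<^bsub>?M\<^esub> g) \<otimes>\<^bsub>?M\<^esub> h) = linear_extension (*) (\<lambda>a. linear_extension (*) (\<lambda>b. u (a \<otimes>\<^bsub>G\<^esub> b)) h) (\<lambda>x. f x + g x)"
        using add[OF fgh(1,2)] fgh by (simp add: field_space.ext_mult monoid_algebra_simps(4))
      then show "linear_extension (*) u ((f \<oplus>\<^bsub>?M\<^esub> g) \<otimes>\<^bsub>?M\<^esub> h) = linear_extension (*) u (f \<otimes>\<^bsub>?M\<^esub> h \<oplus>\<^bsub>?M\<^esub> g \<otimes>\<^bsub>?M\<^esub> h)"
        using fgh by (simp add: E fin closed monoid_algebra_simps(4))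
    qed (use fin fgh closed add in auto)
    show "h \<otimes>\<^bsub>?M\<^esub> (f \<oplus>\<^bsub>?M\<^esub> g) = h \<otimes>\<^bsub>?M\<^esub> f \<oplus>\<^bsub>?M\<^esub> h \<otimes>\<^bsub>?M\<^esub> g"
    proof (rule fun_eq_by_extI)
      fix u :: "'g \<Rightarrow> 'k"
      have "linear_extension (*) u (h \<otimes>\<^bsub>?M\<^esub> (f \<oplus>\<^bsub>?M\<^esub> g)) = linear_extension (*) (\<lambda>a. linear_extension (*) (\<lambda>b. u (a \<otimes>\<^bsub>G\<^esub> b)) (\<lambda>x. f x + g x)) h"
        using add[OF fgh(1,2)] fgh by (simp add: field_space.ext_mult monoid_algebra_simps(4))
      then show "linear_extension (*) u (h \<otimes>\<^bsub>?M\<^esub> (f \<oplus>\<^bsub>?M\<^esub> g)) = linear_extension (*) u (h \<otimes>\<^bsub>?M\<^esub> f \<oplus>\<^bsub>?M\<^esub> h \<otimes>\<^bsub>?M\<^esub> g)"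
        using fgh by (simp add: E fin closed monoid_algebra_simps(4) sum_in)
    qed (use fin fgh closed add in auto)
  qed
qed

lemma monoid_algebra_smult_closed: "f \<in> carrier (monoid_algebra G) \<Longrightarrow> (\<lambda>g. c * f g) \<in> carrier (monoid_algebra G)"
  by (auto simp: monoid_algebra_simps finite_support_scale)

lemma monoid_algebra_add_closed:
  fixes f f' :: "'h \<Rightarrow> 'k::field"
  assumes "f \<in> carrier (monoid_algebra H)" "f' \<in> carrier (monoid_algebra H)"
  shows "(\<lambda>g. f g + f' g) \<in> carrier (monoid_algebra H)"
proof -
  have "support (\<lambda>g. f g + f' g) \<subseteq> support f \<union> support f'" by auto
  with assms show ?thesis unfolding monoid_algebra_simps(1) by (meson finite_UnI finite_subset le_sup_iff order_trans)
qed

lemma monoid_algebra_diff_closed: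
  fixes f f' :: "'h \<Rightarrow> 'k::field"
  assumes "f \<in> carrier (monoid_algebra H)" "f' \<in> carrier (monoid_algebra H)"
  shows "(\<lambda>g. f g - f' g) \<in> carrier (monoid_algebra H)"
  using monoid_algebra_add_closed[OF assms(1) monoid_algebra_smult_closed[OF assms(2), of "-1"]] by simp

lemma delta_mult:
  assumes "Group.monoid G" "a \<in> carrier G" "b \<in> carrier G"
  shows "delta a \<otimes>\<^bsub>monoid_algebra G\<^esub> delta b = (delta (a \<otimes>\<^bsub>G\<^esub> b) :: 'g \<Rightarrow> 'k::field)"
proof -
  interpret ring "monoid_algebra G :: ('k, 'g \<Rightarrow> 'k) module" by (rule ring_monoid_algebra[OF assms(1)])
  have c: "(delta a :: 'g \<Rightarrow> 'k) \<in> carrier (monoid_algebra G)" "(delta b :: 'g \<Rightarrow> 'k) \<in> carrier (monoid_algebra G)"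
    using assms by simp_all
  show ?thesis
    by (rule fun_eq_by_extI)
      (use m_closed[OF c] c in \<open>auto simp: monoid_algebra_simps(1) finite_support_delta field_space.ext_mult[OF c]\<close>)
qed

lemma monoid_algebra_ideal_add:
  assumes "ideal J (monoid_algebra G)" "f \<in> J" "f' \<in> J"
  shows "(\<lambda>g. f g + f' g) \<in> J"
proof -
  interpret additive_subgroup J "monoid_algebra G" using assms(1) by (rule ideal.axioms(1))
  show ?thesis using a_closed[OF assms(2,3)] by (simp add: monoid_algebra_simps(4))
qed

text \<open>An ideal is closed under ring multiplication only; scaling by c is multiplication by c
  times the unit.\<close>

lemma monoid_algebra_ideal_scale:
  fixes G :: "('g, 'm) monoid_scheme" and J :: "('g \<Rightarrow> 'k::field) set"
  assumes "Group.monoid G" "ideal J (monoid_algebra G)" and f: "f \<in> J"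
  shows "(\<lambda>g. c * f g) \<in> J"
proof -
  interpret G: Group.monoid G by fact
  let ?M = "monoid_algebra G :: ('k, 'g \<Rightarrow> 'k) module"
  interpret ideal J ?M by fact
  have fc: "f \<in> carrier ?M" using f a_subset by auto
  have c1: "(\<lambda>g. c * delta \<one>\<^bsub>G\<^esub> g) \<in> carrier ?M"
    by (intro monoid_algebra_smult_closed delta_carrier) simp
  have "(\<lambda>g. c * delta \<one>\<^bsub>G\<^esub> g) \<otimes>\<^bsub>?M\<^esub> f = (\<lambda>g. c * f g)"
  proof (rule fun_eq_by_extI)
    fix v :: "'g \<Rightarrow> 'k"
    have "linear_extension (*) (\<lambda>b. v (\<one>\<^bsub>G\<^esub> \<otimes>\<^bsub>G\<^esub> b)) f = linear_extension (*) v f"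
      using fc by (auto simp: monoid_algebra_simps intro!: field_space.ext_cong)
    then show "linear_extension (*) v ((\<lambda>g. c * delta \<one>\<^bsub>G\<^esub> g) \<otimes>\<^bsub>?M\<^esub> f) = linear_extension (*) v (\<lambda>g. c * f g)"
      using fc c1 by (simp add: field_space.ext_mult field_space.ext_scale finite_support_delta monoid_algebra_simps(1))
  qed (use m_closed[OF c1 fc] fc in \<open>auto simp: monoid_algebra_simps(1) finite_support_scale\<close>)
  then show ?thesis using I_l_closed[OF f c1] by simp
qed

section \<open>Algebras in coordinates\<close>

text \<open>Scalar action and product are parameters and not class operations, because the same type
  carries a different product for each q.\<close>

locale bilinear_mult = vector_space sc for sc :: "'k::field \<Rightarrow> 'b::ab_group_add \<Rightarrow> 'b" +
  fixes mu :: "'b \<Rightarrow> 'b \<Rightarrow> 'b"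
  assumes mu_add_left: "mu (x + y) z = mu x z + mu y z"
    and mu_add_right: "mu x (y + z) = mu x y + mu x z"
    and mu_scale_left: "mu (sc c x) y = sc c (mu x y)"
    and mu_scale_right: "mu x (sc c y) = sc c (mu x y)"
begin

abbreviation lext :: "('g \<Rightarrow> 'b) \<Rightarrow> ('g \<Rightarrow> 'k) \<Rightarrow> 'b" where "lext \<equiv> linear_extension sc"

lemma mu_zero_left [simp]: "mu 0 x = 0" using mu_add_left[of 0 0 x] by simp
lemma mu_zero_right [simp]: "mu x 0 = 0" using mu_add_right[of x 0 0] by simp

lemma mu_ext: "mu (lext u f) (lext v f') = lext (\<lambda>a. lext (\<lambda>b. mu (u a) (v b)) f') f"
proof -
  have l: "mu (\<Sum>g\<in>T. sc (c g) (w g)) y = (\<Sum>g\<in>T. sc (c g) (mu (w g) y))" for T c w y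
    by (induction T rule: infinite_finite_induct) (auto simp: mu_add_left mu_scale_left)
  have r: "mu y (\<Sum>g\<in>T. sc (c g) (w g)) = (\<Sum>g\<in>T. sc (c g) (mu y (w g)))" for T c w y
    by (induction T rule: infinite_finite_induct) (auto simp: mu_add_right mu_scale_right)
  have "mu (lext u f) (lext v f') = (\<Sum>g\<in>support f. sc (f g) (mu (u g) (lext v f')))"
    unfolding linear_extension_def[of sc u f] by (rule l)
  then show ?thesis by (simp add: linear_extension_def r)
qed

end

text \<open>Identifying \<open>A\<close> with a whole type makes carrier conditions disappear on the
  coordinate side and turns equality of cosets into equality of coordinates.\<close>

locale coordinate_algebra = ring A + bilinear_mult sc mu
  for A :: "('k::field, 'a) module" (structure) and sc :: "'k \<Rightarrow> 'b::ab_group_add \<Rightarrow> 'b"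
    and mu :: "'b \<Rightarrow> 'b \<Rightarrow> 'b" and e :: 'b and \<Lambda> :: "'a \<Rightarrow> 'b" +
  assumes coord_bij: "bij_betw \<Lambda> (carrier A) UNIV"
    and coord_add: "x \<in> carrier A \<Longrightarrow> y \<in> carrier A \<Longrightarrow> \<Lambda> (x \<oplus> y) = \<Lambda> x + \<Lambda> y"
    and coord_mult: "x \<in> carrier A \<Longrightarrow> y \<in> carrier A \<Longrightarrow> \<Lambda> (x \<otimes> y) = mu (\<Lambda> x) (\<Lambda> y)"
    and coord_one: "\<Lambda> \<one> = e"
    and smult_carrier: "x \<in> carrier A \<Longrightarrow> c \<odot> x \<in> carrier A"
    and coord_smult: "x \<in> carrier A \<Longrightarrow> \<Lambda> (c \<odot> x) = sc c (\<Lambda> x)"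
begin

lemma coord_zero: "\<Lambda> \<zero> = 0"
  using coord_add[of \<zero> \<zero>] by simp

lemma coord_inj: "x \<in> carrier A \<Longrightarrow> y \<in> carrier A \<Longrightarrow> \<Lambda> x = \<Lambda> y \<longleftrightarrow> x = y"
  using coord_bij by (auto simp: bij_betw_def inj_on_def)

lemma coord_finsum: "finite T \<Longrightarrow> (\<And>i. i \<in> T \<Longrightarrow> f i \<in> carrier A) \<Longrightarrow> \<Lambda> (\<Oplus>i\<in>T. f i) = (\<Sum>i\<in>T. \<Lambda> (f i))"
  by (induction T rule: finite_induct) (auto simp: coord_zero coord_add Pi_def)

definition el :: "'b \<Rightarrow> 'a" where "el v = inv_into (carrier A) \<Lambda> v"

lemma el_carrier [simp]: "el v \<in> carrier A" and coord_el [simp]: "\<Lambda> (el v) = v"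
proof -
  have "v \<in> \<Lambda> ` carrier A" using coord_bij by (simp add: bij_betw_def)
  then show "el v \<in> carrier A" "\<Lambda> (el v) = v" by (simp_all add: el_def inv_into_into f_inv_into_f)
qed

lemma el_coord [simp]: "a \<in> carrier A \<Longrightarrow> el (\<Lambda> a) = a"
  using coord_inj[of "el (\<Lambda> a)" a] by simp

lemma scalar_closed: "c \<odot> \<one> \<in> carrier A"
  by (simp add: smult_carrier)

lemma scalar_eqs:
  "(c + c') \<odot> \<one> = c \<odot> \<one> \<oplus> c' \<odot> \<one>"
  "(c * c') \<odot> \<one> = (c \<odot> \<one>) \<otimes> (c' \<odot> \<one>)"
  "1 \<odot> \<one> = \<one>"
  "a \<in> carrier A \<Longrightarrow> (c \<odot> \<one>) \<otimes> a = a \<otimes> (c \<odot> \<one>)"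
proof -
  have e: "mu e (\<Lambda> x) = \<Lambda> x" "mu (\<Lambda> x) e = \<Lambda> x" if "x \<in> carrier A" for x
    using coord_mult[of \<one> x] coord_mult[of x \<one>] that by (simp_all add: coord_one)
  have ee: "mu e e = e" using e(1)[of \<one>] by (simp add: coord_one)
  show "(c + c') \<odot> \<one> = c \<odot> \<one> \<oplus> c' \<odot> \<one>"
    by (subst coord_inj[symmetric]) (simp_all add: smult_carrier coord_add coord_smult coord_one scale_left_distrib)
  show "(c * c') \<odot> \<one> = (c \<odot> \<one>) \<otimes> (c' \<odot> \<one>)"
    by (subst coord_inj[symmetric])
      (simp_all add: smult_carrier coord_mult coord_smult coord_one mu_scale_left mu_scale_right ee)
  show "1 \<odot> \<one> = \<one>"
    by (subst coord_inj[symmetric]) (simp_all add: smult_carrier coord_smult)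
  show "a \<in> carrier A \<Longrightarrow> (c \<odot> \<one>) \<otimes> a = a \<otimes> (c \<odot> \<one>)"
    by (subst coord_inj[symmetric])
      (simp_all add: smult_carrier coord_mult coord_smult coord_one mu_scale_left mu_scale_right e)
qed

end

definition coset_value :: "('a \<Rightarrow> 'b) \<Rightarrow> 'a set \<Rightarrow> 'b" where
  "coset_value \<Phi> C = \<Phi> (SOME f. f \<in> C)"

text \<open>The section \<open>\<sigma>\<close> serves to show that the ideal generated by \<open>S\<close> is the whole kernel of the extension of \<open>u\<close>.\<close>

locale presented_algebra = G?: Group.monoid G + bilinear_mult sc mu
  for G :: "('g, 'm) monoid_scheme" and sc :: "'k::field \<Rightarrow> 'b::ab_group_add \<Rightarrow> 'b" and mu :: "'b \<Rightarrow> 'b \<Rightarrow> 'b" +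
  fixes u :: "'g \<Rightarrow> 'b" and S :: "('g \<Rightarrow> 'k) set" and \<sigma> :: "'b \<Rightarrow> 'g \<Rightarrow> 'k"
  assumes u_mult: "a \<in> carrier G \<Longrightarrow> b \<in> carrier G \<Longrightarrow> u (a \<otimes>\<^bsub>G\<^esub> b) = mu (u a) (u b)"
    and S_carrier: "S \<subseteq> carrier (monoid_algebra G)"
    and S_zero: "s \<in> S \<Longrightarrow> lext u s = 0"
    and \<sigma>_carrier: "\<sigma> w \<in> carrier (monoid_algebra G)"
    and \<sigma>_add: "\<sigma> (w + w') = (\<lambda>g. \<sigma> w g + \<sigma> w' g)"
    and \<sigma>_scale: "\<sigma> (sc c w) = (\<lambda>g. c * \<sigma> w g)"
    and ext_\<sigma>: "lext u (\<sigma> w) = w"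
    and \<sigma>_mod: "g \<in> carrier G \<Longrightarrow> (\<lambda>h. delta g h - \<sigma> (u g) h) \<in> Idl\<^bsub>monoid_algebra G\<^esub> S"
begin

abbreviation "MA \<equiv> monoid_algebra G :: ('k, 'g \<Rightarrow> 'k) module"
abbreviation "J \<equiv> Idl\<^bsub>MA\<^esub> S"

lemma ring_MA: "ring MA" by (rule ring_monoid_algebra[OF G.monoid_axioms])

lemma ideal_J: "ideal J MA" by (rule ring.genideal_ideal[OF ring_MA S_carrier])

lemma ext_MA_mult: "f \<in> carrier MA \<Longrightarrow> f' \<in> carrier MA \<Longrightarrow> lext u (f \<otimes>\<^bsub>MA\<^esub> f') = mu (lext u f) (lext u f')"
  unfolding mu_ext
  by (subst ext_mult) (auto simp: monoid_algebra_simps subset_iff u_mult intro!: ext_cong)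

lemma ext_MA_add: "f \<in> carrier MA \<Longrightarrow> f' \<in> carrier MA \<Longrightarrow> lext u (f \<oplus>\<^bsub>MA\<^esub> f') = lext u f + lext u f'"
  by (simp add: monoid_algebra_simps ext_add)

lemma MA_smult_closed: "f \<in> carrier MA \<Longrightarrow> c \<odot>\<^bsub>MA\<^esub> f \<in> carrier MA"
  by (auto simp: monoid_algebra_simps finite_support_scale)

lemma MA_minus: "f \<in> carrier MA \<Longrightarrow> \<ominus>\<^bsub>MA\<^esub> f = (\<lambda>g. - f g)"
proof -
  assume f: "f \<in> carrier MA"
  interpret ring MA by (rule ring_MA)
  show ?thesis by (rule minus_equality) (use f in \<open>auto simp: monoid_algebra_simps\<close>)
qed

lemma ext_MA_minus: "f \<in> carrier MA \<Longrightarrow> lext u (\<ominus>\<^bsub>MA\<^esub> f) = - lext u f"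
  using ext_scale[of f u "-1"] by (simp add: MA_minus monoid_algebra_simps)

lemma J_zero: "f \<in> J \<Longrightarrow> lext u f = 0"
proof -
  interpret ring MA by (rule ring_MA)
  let ?K = "{f \<in> carrier MA. lext u f = 0}"
  have "ideal ?K MA"
  proof (rule idealI[OF ring_MA])
    have "\<zero>\<^bsub>MA\<^esub> \<in> ?K" using zero_closed by (simp add: monoid_algebra_simps(3) linear_extension_def)
    then have "?K \<noteq> {}" by blast
    then show "subgroup ?K (add_monoid MA)"
      by (intro add.subgroupI) (auto simp: ext_MA_add ext_MA_minus)
  qed (auto simp: ext_MA_mult)
  then have "J \<subseteq> ?K" by (rule genideal_minimal) (use S_carrier S_zero in auto)
  then show "f \<in> J \<Longrightarrow> lext u f = 0" by auto
qed

lemmas J_add = monoid_algebra_ideal_add[OF ideal_J]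
lemmas J_scale = monoid_algebra_ideal_scale[OF G.monoid_axioms ideal_J]

lemma \<sigma>_zero: "\<sigma> 0 = (\<lambda>_. 0)"
  using \<sigma>_scale[of 0 0] by simp

text \<open>This is the harder inclusion between the ideal and the kernel: modulo the ideal every f
  is the section of its value, so an f of value 0 lies in the ideal. By linearity over the support
  it suffices to know this for single monoid elements.\<close>

lemma mod_J: "f \<in> carrier MA \<Longrightarrow> (\<lambda>h. f h - \<sigma> (lext u f) h) \<in> J"
proof -
  interpret ideal J MA by (rule ideal_J)
  have "(\<lambda>h. f h - \<sigma> (lext u f) h) \<in> J" if "finite T" "f \<in> carrier MA" "support f \<subseteq> T" for T f
    using that
  proof (induction T arbitrary: f rule: finite_induct)
    case empty
    then have "f = (\<lambda>_. 0)" by auto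
    then show ?case
      using additive_subgroup.zero_closed[OF ideal.axioms(1)[OF ideal_J]] by (simp add: \<sigma>_zero monoid_algebra_simps(3))
  next
    case (insert s T)
    show ?case
    proof (cases "f s = 0")
      case True
      then show ?thesis using insert.prems by (intro insert.IH) auto
    next
      case False
      then have s: "s \<in> carrier G" using insert.prems(1) by (auto simp: monoid_algebra_simps)
      let ?f = "f(s := 0)"
      have f': "?f \<in> carrier MA" using insert.prems(1)
        by (auto simp: monoid_algebra_simps fun_upd_def elim: rev_finite_subset)
      have IH: "(\<lambda>h. ?f h - \<sigma> (lext u ?f) h) \<in> J"
        by (rule insert.IH[OF f']) (use insert.prems in \<open>auto simp: fun_upd_def\<close>)
      have f: "f = (\<lambda>h. ?f h + f s * delta s h)" by (auto simp: delta_def)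
      have "lext u f = lext u (\<lambda>h. ?f h + f s * delta s h)" by (rule arg_cong[OF f])
      also have "\<dots> = lext u ?f + lext u (\<lambda>h. f s * delta s h)"
        using f' by (intro ext_add finite_support) (simp add: monoid_algebra_simps(1))
      also have "\<dots> = lext u ?f + sc (f s) (u s)" by (simp add: ext_scale finite_support_delta)
      finally have "lext u f = lext u ?f + sc (f s) (u s)" .
      then have "(\<lambda>h. f h - \<sigma> (lext u f) h) =
          (\<lambda>h. (?f h - \<sigma> (lext u ?f) h) + f s * (delta s h - \<sigma> (u s) h))"
        by (intro HOL.ext) (simp add: \<sigma>_add \<sigma>_scale delta_def algebra_simps)
      then show ?thesis using J_add[OF IH J_scale[OF \<sigma>_mod[OF s], of "f s"]] by simp
    qed
  qed
  from this[of "support f" f] show "f \<in> carrier MA \<Longrightarrow> (\<lambda>h. f h - \<sigma> (lext u f) h) \<in> J"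
    by (simp add: monoid_algebra_simps(1))
qed

lemma J_iff: "f \<in> carrier MA \<Longrightarrow> f \<in> J \<longleftrightarrow> lext u f = 0"
  using J_zero mod_J[of f] by (auto simp: \<sigma>_zero)

abbreviation "coord \<equiv> coset_value (lext u)"

lemma coord_eq:
  assumes "C \<in> carrier (quotient MA J)" "f \<in> C"
  shows "f \<in> carrier MA" "coord C = lext u f"
proof -
  interpret ideal J MA by (rule ideal_J)
  obtain g where g: "g \<in> carrier MA" "C = J +>\<^bsub>MA\<^esub> g"
    using assms by (auto simp: quotient_def FactRing_def A_RCOSETS_defs a_r_coset_def)
  have *: "f \<in> carrier MA \<and> lext u f = lext u g" if "f \<in> C" for f
  proof -
    from that obtain j where "j \<in> J" "f = j \<oplus>\<^bsub>MA\<^esub> g" by (auto simp: g a_r_coset_def r_coset_def)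
    then show ?thesis using g a_subset J_zero by (auto simp: ext_MA_add)
  qed
  show "f \<in> carrier MA" using * assms by auto
  have "(SOME f. f \<in> C) \<in> C" by (rule someI[of _ f]) (rule assms)
  then show "coord C = lext u f" unfolding coset_value_def using * assms by metis
qed

lemma carrier_nonempty: "C \<in> carrier (quotient MA J) \<Longrightarrow> C \<noteq> {}"
proof -
  interpret ideal J MA by (rule ideal_J)
  assume "C \<in> carrier (quotient MA J)"
  then obtain g where g: "g \<in> carrier MA" "C = J +>\<^bsub>MA\<^esub> g"
    by (auto simp: quotient_def FactRing_def A_RCOSETS_defs a_r_coset_def)
  then show ?thesis using a_rcos_self by auto
qed

lemma coordinate_algebra_quotient:
  "coordinate_algebra (quotient MA J) sc mu (u \<one>\<^bsub>G\<^esub>) coord"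
proof -
  interpret J: ideal J MA by (rule ideal_J)
  let ?Q = "quotient MA J" and ?c = "\<lambda>f. J +>\<^bsub>MA\<^esub> f"
  have Qc: "carrier ?Q = ?c ` carrier MA"
    by (auto simp: quotient_def FactRing_def A_RCOSETS_defs a_r_coset_def)
  have self: "f \<in> ?c f" if "f \<in> carrier MA" for f using that by (rule J.a_rcos_self)
  have cv: "coord (?c f) = lext u f" if "f \<in> carrier MA" for f
    using coord_eq(2)[of "?c f" f] self[OF that] that by (auto simp: Qc)
  have add: "?c f \<oplus>\<^bsub>?Q\<^esub> ?c g = ?c (f \<oplus>\<^bsub>MA\<^esub> g)" if "f \<in> carrier MA" "g \<in> carrier MA" for f g
    using that by (simp add: quotient_def FactRing_def J.a_rcos_sum)
  have mult: "?c f \<otimes>\<^bsub>?Q\<^esub> ?c g = ?c (f \<otimes>\<^bsub>MA\<^esub> g)" if "f \<in> carrier MA" "g \<in> carrier MA" for f g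
    using that by (simp add: quotient_def FactRing_def J.rcoset_mult_add)
  have eq: "?c f = ?c g" if "f \<in> carrier MA" "g \<in> carrier MA" "lext u f = lext u g" for f g
  proof -
    have "f \<ominus>\<^bsub>MA\<^esub> g \<in> J" using that by (simp add: J_iff a_minus_def ext_MA_add ext_MA_minus)
    then show ?thesis using that J.quotient_eq_iff_same_a_r_cos[OF ideal_J] by auto
  qed
  have sm: "c \<odot>\<^bsub>?Q\<^esub> ?c f = ?c (c \<odot>\<^bsub>MA\<^esub> f)" if f: "f \<in> carrier MA" for f c
  proof -
    have "(\<Union>x\<in>?c f. ?c (c \<odot>\<^bsub>MA\<^esub> x)) = (\<Union>x\<in>?c f. ?c (c \<odot>\<^bsub>MA\<^esub> f))"
    proof (intro SUP_cong refl)
      fix x assume x: "x \<in> ?c f"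
      have "x \<in> carrier MA" "lext u x = lext u f"
        using coord_eq[of "?c f" x] x f cv by (auto simp: Qc)
      then show "?c (c \<odot>\<^bsub>MA\<^esub> x) = ?c (c \<odot>\<^bsub>MA\<^esub> f)"
        using f by (intro eq MA_smult_closed) (auto simp: monoid_algebra_simps ext_scale)
    qed
    also have "\<dots> = ?c (c \<odot>\<^bsub>MA\<^esub> f)"
      using self[OF f] by (simp only: UN_constant) (auto split: if_splits)
    finally show ?thesis by (simp add: quotient_def)
  qed
  have "ring (MA Quot J)" by (rule J.quotient_is_ring)
  \<comment> \<open>\<open>quotient\<close> shares its ring operations with \<open>Quot\<close> but
    is a different record, so the ring laws are carried over one by one.\<close>
  then have rQ: "ring ?Q"
  proof -
    assume "ring (MA Quot J)"
    then interpret F: ring "MA Quot J" .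
    have Q: "carrier ?Q = carrier (MA Quot J)" "mult ?Q = mult (MA Quot J)" "one ?Q = one (MA Quot J)"
      "zero ?Q = zero (MA Quot J)" "add ?Q = add (MA Quot J)"
      by (simp_all add: quotient_def)
    have "abelian_group ?Q"
      by (rule abelian_groupI; unfold Q)
        (assumption | rule F.a_closed F.zero_closed F.a_assoc F.add.m_comm F.l_zero F.add.l_inv_ex)+
    moreover have "Group.monoid ?Q"
      by (rule monoidI; unfold Q) (assumption | rule F.m_closed F.one_closed F.m_assoc F.l_one F.r_one)+
    ultimately show ?thesis
      by (rule ringI; unfold Q) (assumption | rule F.l_distr F.r_distr)+
  qed
  show ?thesis
  proof (rule coordinate_algebra.intro[OF rQ bilinear_mult_axioms], rule coordinate_algebra_axioms.intro)
    show "bij_betw coord (carrier ?Q) UNIV"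
      unfolding bij_betw_def
    proof
      show "inj_on coord (carrier ?Q)"
      proof (rule inj_onI)
        fix x y assume "x \<in> carrier ?Q" "y \<in> carrier ?Q" and xy: "coord x = coord y"
        then obtain f g where "f \<in> carrier MA" "x = ?c f" "g \<in> carrier MA" "y = ?c g" by (auto simp: Qc)
        then show "x = y" using xy eq[of f g] by (simp add: cv)
      qed
      show "coord ` carrier ?Q = UNIV"
      proof (intro equalityI subset_UNIV subsetI)
        fix w
        show "w \<in> coord ` carrier ?Q"
          unfolding Qc using \<sigma>_carrier[of w] cv[of "\<sigma> w"] by (simp add: ext_\<sigma> image_comp rev_image_eqI)
      qed
    qed
    show "coord \<one>\<^bsub>?Q\<^esub> = u \<one>\<^bsub>G\<^esub>"
      using cv[of "\<one>\<^bsub>MA\<^esub>"] by (simp add: quotient_def FactRing_def monoid_algebra_simps(2))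
    have es: "lext u (c \<odot>\<^bsub>MA\<^esub> f) = sc c (lext u f)" if "f \<in> carrier MA" for c f
      using that by (simp add: monoid_algebra_simps(1,5) ext_scale)
    interpret ring MA by (rule ring_MA)
    fix x y c assume x: "x \<in> carrier ?Q"
    then obtain f where f: "f \<in> carrier MA" "x = ?c f" by (auto simp: Qc)
    show "c \<odot>\<^bsub>?Q\<^esub> x \<in> carrier ?Q" using f MA_smult_closed[OF f(1), of c] by (auto simp: Qc sm)
    show "coord (c \<odot>\<^bsub>?Q\<^esub> x) = sc c (coord x)" using f MA_smult_closed[OF f(1), of c] by (simp add: sm cv es)
    assume y: "y \<in> carrier ?Q"
    then obtain g where g: "g \<in> carrier MA" "y = ?c g" by (auto simp: Qc)
    show "coord (x \<oplus>\<^bsub>?Q\<^esub> y) = coord x + coord y" using f g by (simp add: add cv ext_MA_add)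
    show "coord (x \<otimes>\<^bsub>?Q\<^esub> y) = mu (coord x) (coord y)" using f g by (simp add: mult cv ext_MA_mult)
  qed
qed

end

section \<open>The four-dimensional algebra in coordinates\<close>

text \<open>\<open>Quad a b c d\<close> stands for \<open>a + b x + c y + d y x\<close>, with coefficients multiplied from the right.\<close>

datatype 'a quad = Quad (c1: 'a) (cx: 'a) (cy: 'a) (cz: 'a)

lemma quad_eqI: "c1 v = c1 w \<Longrightarrow> cx v = cx w \<Longrightarrow> cy v = cy w \<Longrightarrow> cz v = cz w \<Longrightarrow> v = w"
  by (rule quad.expand) simp

instantiation quad :: (ab_group_add) ab_group_add
begin
definition "0 = Quad 0 0 0 0"
definition "v + w = Quad (c1 v + c1 w) (cx v + cx w) (cy v + cy w) (cz v + cz w)"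
definition "- v = Quad (- c1 v) (- cx v) (- cy v) (- cz v)"
definition "v - w = Quad (c1 v - c1 w) (cx v - cx w) (cy v - cy w) (cz v - cz w)" for v w :: "'a quad"
instance
  by standard (auto simp: zero_quad_def plus_quad_def uminus_quad_def minus_quad_def ac_simps)
end

lemma quad_sel [simp]:
  "c1 0 = 0" "cx 0 = 0" "cy 0 = 0" "cz 0 = 0"
  "c1 (v + w) = c1 v + c1 w" "cx (v + w) = cx v + cx w" "cy (v + w) = cy v + cy w" "cz (v + w) = cz v + cz w"
  "c1 (- v) = - c1 v" "cx (- v) = - cx v" "cy (- v) = - cy v" "cz (- v) = - cz v"
  "c1 (v - w) = c1 v - c1 w" "cx (v - w) = cx v - cx w" "cy (v - w) = cy v - cy w" "cz (v - w) = cz v - cz w"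
  for v w :: "'a::ab_group_add quad"
  by (simp_all add: zero_quad_def plus_quad_def uminus_quad_def minus_quad_def)

definition quad_scale :: "('k \<Rightarrow> 'a \<Rightarrow> 'a) \<Rightarrow> 'k \<Rightarrow> 'a quad \<Rightarrow> 'a quad" where
  "quad_scale sc c v = Quad (sc c (c1 v)) (sc c (cx v)) (sc c (cy v)) (sc c (cz v))"

text \<open>The rules are x x = y y = 0 and x y = - q y x, over a coefficient algebra with product
  \<open>m\<close>. Keeping the coefficients general allows iteration: over the field this is
  \<Lambda>, over the opposite of \<Lambda> it is the enveloping algebra.\<close>

definition quad_mult :: "('k \<Rightarrow> 'a \<Rightarrow> 'a) \<Rightarrow> ('a \<Rightarrow> 'a \<Rightarrow> 'a) \<Rightarrow> 'k \<Rightarrow> 'a::ab_group_add quad \<Rightarrow> 'a quad \<Rightarrow> 'a quad" where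
  "quad_mult sc m q v w = Quad
    (m (c1 v) (c1 w))
    (m (c1 v) (cx w) + m (cx v) (c1 w))
    (m (c1 v) (cy w) + m (cy v) (c1 w))
    (m (c1 v) (cz w) + m (cz v) (c1 w) + m (cy v) (cx w) - sc q (m (cx v) (cy w)))"

lemma quad_scale_sel [simp]:
  "c1 (quad_scale sc c v) = sc c (c1 v)" "cx (quad_scale sc c v) = sc c (cx v)"
  "cy (quad_scale sc c v) = sc c (cy v)" "cz (quad_scale sc c v) = sc c (cz v)"
  by (simp_all add: quad_scale_def)

lemma quad_mult_sel [simp]:
  "c1 (quad_mult sc m q v w) = m (c1 v) (c1 w)"
  "cx (quad_mult sc m q v w) = m (c1 v) (cx w) + m (cx v) (c1 w)"
  "cy (quad_mult sc m q v w) = m (c1 v) (cy w) + m (cy v) (c1 w)"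
  "cz (quad_mult sc m q v w) = m (c1 v) (cz w) + m (cz v) (c1 w) + m (cy v) (cx w) - sc q (m (cx v) (cy w))"
  by (simp_all add: quad_mult_def)

lemma bilinear_mult_quad:
  assumes "bilinear_mult sc m"
  shows "bilinear_mult (quad_scale sc) (quad_mult sc m q)"
proof -
  interpret bilinear_mult sc m by fact
  show ?thesis
  proof
    fix a b x y z
    show "quad_scale sc a (x + y) = quad_scale sc a x + quad_scale sc a y"
      "quad_scale sc (a + b) x = quad_scale sc a x + quad_scale sc b x"
      "quad_scale sc a (quad_scale sc b x) = quad_scale sc (a * b) x"
      "quad_scale sc 1 x = x"
      by (rule quad_eqI; simp add: scale_right_distrib scale_left_distrib)+
    show "quad_mult sc m q (x + y) z = quad_mult sc m q x z + quad_mult sc m q y z"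
      by (rule quad_eqI; simp add: mu_add_left mu_add_right scale_right_distrib)
    show "quad_mult sc m q x (y + z) = quad_mult sc m q x y + quad_mult sc m q x z"
      by (rule quad_eqI; simp add: mu_add_right scale_right_distrib)
    show "quad_mult sc m q (quad_scale sc a x) y = quad_scale sc a (quad_mult sc m q x y)"
      "quad_mult sc m q x (quad_scale sc a y) = quad_scale sc a (quad_mult sc m q x y)"
      by (rule quad_eqI; simp add: mu_scale_left mu_scale_right scale_right_distrib scale_right_diff_distrib mult.commute)+
  qed
qed

lemma bilinear_mult_field: "bilinear_mult (*) ((*) :: 'k::field \<Rightarrow> 'k \<Rightarrow> 'k)"
  by (rule bilinear_mult.intro[OF field_space.vector_space_axioms], rule bilinear_mult_axioms.intro)
    (simp_all add: distrib_left distrib_right mult.assoc mult.left_commute)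

lemma bilinear_mult_opposite: "bilinear_mult sc m \<Longrightarrow> bilinear_mult sc (\<lambda>x y. m y x)"
proof -
  assume "bilinear_mult sc m"
  then interpret bilinear_mult sc m .
  show ?thesis by unfold_locales (simp_all add: mu_add_left mu_add_right mu_scale_left mu_scale_right)
qed

abbreviation lscale :: "'k::field \<Rightarrow> 'k quad \<Rightarrow> 'k quad" where "lscale \<equiv> quad_scale (*)"
abbreviation lmult :: "'k::field \<Rightarrow> 'k quad \<Rightarrow> 'k quad \<Rightarrow> 'k quad" where "lmult q \<equiv> quad_mult (*) (*) q"
abbreviation escale :: "'k::field \<Rightarrow> 'k quad quad \<Rightarrow> 'k quad quad" where "escale \<equiv> quad_scale lscale"
abbreviation emult :: "'k::field \<Rightarrow> 'k quad quad \<Rightarrow> 'k quad quad \<Rightarrow> 'k quad quad" where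
  "emult q \<equiv> quad_mult lscale (\<lambda>v w. lmult q w v) q"

lemma bilinear_lmult: "bilinear_mult lscale (lmult q)"
  by (rule bilinear_mult_quad[OF bilinear_mult_field])

lemma bilinear_emult: "bilinear_mult escale (emult q)"
  by (rule bilinear_mult_quad[OF bilinear_mult_opposite[OF bilinear_lmult]])

lemma lmult_assoc: "lmult q (lmult q u v) w = lmult q u (lmult q v w)"
  by (rule quad_eqI) (simp_all add: algebra_simps)

definition one4 :: "'k::field quad" where "one4 = Quad 1 0 0 0"
definition x4 :: "'k::field quad" where "x4 = Quad 0 1 0 0"
definition y4 :: "'k::field quad" where "y4 = Quad 0 0 1 0"
definition z4 :: "'k::field quad" where "z4 = Quad 0 0 0 1"

lemmas basis4 = one4_def x4_def y4_def z4_def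

fun gen_coord :: "gen \<Rightarrow> 'k::field quad" where
  "gen_coord gen.X = x4" | "gen_coord gen.Y = y4"

fun word_coord :: "'k::field \<Rightarrow> gen list \<Rightarrow> 'k quad" where
  "word_coord q [] = one4" | "word_coord q (g # w) = lmult q (gen_coord g) (word_coord q w)"

lemma lmult_one4 [simp]: "lmult q one4 v = v" "lmult q v one4 = v"
  by (rule quad_eqI; simp add: basis4)+

lemma word_coord_append: "word_coord q (v @ w) = lmult q (word_coord q v) (word_coord q w)"
  by (induction v) (simp_all add: lmult_assoc)

section \<open>Normal forms of words and the presentation of \<Lambda>\<close>

definition word_section :: "'k::field quad \<Rightarrow> gen list \<Rightarrow> 'k" where
  "word_section v = (\<lambda>w. c1 v * delta [] w + cx v * delta [gen.X] w + cy v * delta [gen.Y] w + cz v * delta [gen.Y, gen.X] w)"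

definition lambda_relations :: "'k::field \<Rightarrow> (gen list \<Rightarrow> 'k) set" where
  "lambda_relations q = {delta [gen.X, gen.X], \<lambda>w. delta [gen.X, gen.Y] w + q * delta [gen.Y, gen.X] w, delta [gen.Y, gen.Y]}"

lemma monoid_word: "Group.monoid word_monoid"
  by (rule monoidI) (auto simp: word_monoid_def)

lemma word_simps: "carrier word_monoid = UNIV" "mult word_monoid = (@)" "one word_monoid = []"
  by (simp_all add: word_monoid_def)

lemma free_delta_mult: "delta v \<otimes>\<^bsub>free_algebra\<^esub> delta w = (delta (v @ w) :: gen list \<Rightarrow> 'k::field)"
  unfolding free_algebra_def by (subst delta_mult[OF monoid_word]) (simp_all add: word_simps)

lemma Lambda_eq: "Lambda q = quotient (monoid_algebra word_monoid) (Idl\<^bsub>monoid_algebra word_monoid\<^esub> (lambda_relations q))"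
  by (simp add: Lambda_def Let_def free_delta_mult lambda_relations_def)
    (simp add: free_algebra_def monoid_algebra_simps)

text \<open>Induction on the word. Putting a letter in front of a normal form 1, x, y or y x gives a
  normal form or one of x x, x y, x y x, y y, y y x; of these, x y is congruent to - q y x and the
  others lie in the ideal.\<close>

lemma word_section_mod:
  fixes q :: "'k::field"
  defines "F \<equiv> monoid_algebra word_monoid :: ('k, gen list \<Rightarrow> 'k) module"
  shows "(\<lambda>h. delta w h - word_section (word_coord q w) h) \<in> Idl\<^bsub>F\<^esub> (lambda_relations q)"
proof -
  let ?J = "Idl\<^bsub>F\<^esub> (lambda_relations q)"
  interpret F: ring F unfolding F_def by (rule ring_monoid_algebra[OF monoid_word])
  have dc: "delta v \<in> carrier F" for v by (simp add: F_def word_simps)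
  have Fadd: "f \<oplus>\<^bsub>F\<^esub> g = (\<lambda>h. f h + g h)" for f g by (simp add: F_def monoid_algebra_simps)
  have Fsc: "(\<lambda>h. c * f h) \<in> carrier F" if "f \<in> carrier F" for c f
    using that unfolding F_def by (rule monoid_algebra_smult_closed)
  have Fad: "(\<lambda>h. f h + g h) \<in> carrier F" if "f \<in> carrier F" "g \<in> carrier F" for f g
    using F.a_closed[OF that] by (simp add: Fadd)
  have rel: "lambda_relations q \<subseteq> carrier F"
    unfolding lambda_relations_def by (auto intro!: dc Fad Fsc)
  interpret J: ideal ?J F by (rule F.genideal_ideal[OF rel])
  note add = monoid_algebra_ideal_add[OF J.is_ideal[unfolded F_def], folded F_def]
  note sc = monoid_algebra_ideal_scale[OF monoid_word J.is_ideal[unfolded F_def], folded F_def]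
  have in_J: "delta [gen.X, gen.X] \<in> ?J" "(\<lambda>w. delta [gen.X, gen.Y] w + q * delta [gen.Y, gen.X] w) \<in> ?J" "delta [gen.Y, gen.Y] \<in> ?J"
    using F.genideal_self[OF rel] by (auto simp: lambda_relations_def)
  have dm: "delta v \<otimes>\<^bsub>F\<^esub> delta w = delta (v @ w)" for v w
    using free_delta_mult[of v w, where 'k = 'k] by (simp add: F_def free_algebra_def)
  have dl: "delta v \<otimes>\<^bsub>F\<^esub> (\<lambda>h. c * f h) = (\<lambda>h. c * (delta v \<otimes>\<^bsub>F\<^esub> f) h)" if f: "f \<in> carrier F" for v c f
  proof (rule fun_eq_by_extI)
    show "finite (support (delta v \<otimes>\<^bsub>F\<^esub> (\<lambda>h. c * f h)))" "finite (support (\<lambda>h. c * (delta v \<otimes>\<^bsub>F\<^esub> f) h))"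
      using F.m_closed[OF dc Fsc[OF f]] Fsc[OF F.m_closed[OF dc f]] by (simp_all add: F_def monoid_algebra_simps(1))
    show "linear_extension (*) u (delta v \<otimes>\<^bsub>F\<^esub> (\<lambda>h. c * f h)) = linear_extension (*) u (\<lambda>h. c * (delta v \<otimes>\<^bsub>F\<^esub> f) h)" for u
      using f dc Fsc[OF f, of c] F.m_closed[OF dc f, of v] unfolding F_def
      by (simp add: field_space.ext_mult field_space.ext_scale monoid_algebra_simps(1))
  qed
  have dr: "delta v \<otimes>\<^bsub>F\<^esub> word_section s = (\<lambda>h. c1 s * delta v h + cx s * delta (v @ [gen.X]) h
      + cy s * delta (v @ [gen.Y]) h + cz s * delta (v @ [gen.Y, gen.X]) h)" for v s
  proof -
    have eq: "word_section s = (\<lambda>h. c1 s * delta [] h) \<oplus>\<^bsub>F\<^esub> (\<lambda>h. cx s * delta [gen.X] h)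
        \<oplus>\<^bsub>F\<^esub> (\<lambda>h. cy s * delta [gen.Y] h) \<oplus>\<^bsub>F\<^esub> (\<lambda>h. cz s * delta [gen.Y, gen.X] h)"
      by (simp add: Fadd word_section_def)
    show ?thesis
      using dc Fsc by (subst eq) (simp add: F.r_distr dl dm, simp add: Fadd)
  qed
  have secc: "word_section s \<in> carrier F" for s
    unfolding word_section_def by (intro Fad Fsc dc)
  \<comment> \<open>x y x is (x y + q y x) x minus q y (x x).\<close>
  have xyx: "(\<lambda>w. delta [gen.X, gen.Y, gen.X] w) \<in> ?J"
  proof -
    have "(\<lambda>w. delta [gen.X, gen.Y] w + q * delta [gen.Y, gen.X] w) \<otimes>\<^bsub>F\<^esub> delta [gen.X] \<in> ?J"
      by (rule J.I_r_closed[OF in_J(2) dc])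
    moreover have "(\<lambda>w. delta [gen.X, gen.Y] w + q * delta [gen.Y, gen.X] w) \<otimes>\<^bsub>F\<^esub> delta [gen.X] =
        (\<lambda>w. delta [gen.X, gen.Y, gen.X] w + q * delta [gen.Y, gen.X, gen.X] w)"
    proof (rule fun_eq_by_extI)
      have c: "(\<lambda>w. delta [gen.X, gen.Y] w + q * delta [gen.Y, gen.X] w) \<in> carrier F" by (intro Fad Fsc dc)
      show "finite (support ((\<lambda>w. delta [gen.X, gen.Y] w + q * delta [gen.Y, gen.X] w) \<otimes>\<^bsub>F\<^esub> delta [gen.X]))"
        using F.m_closed[OF c dc] by (simp add: F_def monoid_algebra_simps(1))
      show "linear_extension (*) u ((\<lambda>w. delta [gen.X, gen.Y] w + q * delta [gen.Y, gen.X] w) \<otimes>\<^bsub>F\<^esub> delta [gen.X]) =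
        linear_extension (*) u (\<lambda>w. delta [gen.X, gen.Y, gen.X] w + q * delta [gen.Y, gen.X, gen.X] w)" for u
        using c dc unfolding F_def
        by (simp add: field_space.ext_mult field_space.ext_add field_space.ext_scale finite_support word_simps)
    qed (intro finite_support)
    ultimately have 1: "(\<lambda>w. delta [gen.X, gen.Y, gen.X] w + q * delta [gen.Y, gen.X, gen.X] w) \<in> ?J" by simp
    have 2: "delta [gen.Y, gen.X, gen.X] \<in> ?J"
      using J.I_l_closed[OF in_J(1) dc[of "[gen.Y]"]] by (simp add: dm)
    show ?thesis using add[OF 1 sc[OF 2, of "- q"]] by simp
  qed
  have yyx: "delta [gen.Y, gen.Y, gen.X] \<in> ?J"
    using J.I_r_closed[OF in_J(3) dc[of "[gen.X]"]] by (simp add: dm)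
  show ?thesis
  proof (induction w)
    case Nil
    have "(\<lambda>h. delta [] h - word_section (word_coord q []) h) = \<zero>\<^bsub>F\<^esub>"
      by (auto simp: word_section_def basis4 F_def monoid_algebra_simps)
    then show ?case using additive_subgroup.zero_closed[OF J.additive_subgroup_axioms] by simp
  next
    case (Cons g w)
    let ?s = "word_coord q w"
    have "delta [g] \<otimes>\<^bsub>F\<^esub> (\<lambda>h. delta w h - word_section ?s h) \<in> ?J"
      by (rule J.I_l_closed[OF Cons.IH dc])
    moreover have "delta [g] \<otimes>\<^bsub>F\<^esub> (\<lambda>h. delta w h - word_section ?s h) =
        (\<lambda>h. delta (g # w) h - (delta [g] \<otimes>\<^bsub>F\<^esub> word_section ?s) h)"
    proof -
      have eq: "(\<lambda>h. delta w h - word_section ?s h) = delta w \<oplus>\<^bsub>F\<^esub> (\<lambda>h. -1 * word_section ?s h)"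
        by (simp add: Fadd)
      have "delta [g] \<otimes>\<^bsub>F\<^esub> (delta w \<oplus>\<^bsub>F\<^esub> (\<lambda>h. -1 * word_section ?s h)) =
          delta (g # w) \<oplus>\<^bsub>F\<^esub> (\<lambda>h. -1 * (delta [g] \<otimes>\<^bsub>F\<^esub> word_section ?s) h)"
        unfolding F.r_distr[OF dc Fsc[OF secc] dc] dl[OF secc] dm by simp
      then show ?thesis unfolding eq by (simp add: Fadd)
    qed
    ultimately have A: "(\<lambda>h. delta (g # w) h - (delta [g] \<otimes>\<^bsub>F\<^esub> word_section ?s) h) \<in> ?J" by simp
    have B: "(\<lambda>h. (delta [g] \<otimes>\<^bsub>F\<^esub> word_section ?s) h - word_section (lmult q (gen_coord g) ?s) h) \<in> ?J"
    proof (cases g)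
      case X
      have "(\<lambda>h. (delta [g] \<otimes>\<^bsub>F\<^esub> word_section ?s) h - word_section (lmult q (gen_coord g) ?s) h) =
        (\<lambda>h. (cx ?s * delta [gen.X, gen.X] h + cy ?s * (delta [gen.X, gen.Y] h + q * delta [gen.Y, gen.X] h))
          + cz ?s * delta [gen.X, gen.Y, gen.X] h)"
        unfolding dr by (auto simp: X word_section_def basis4 algebra_simps)
      then show ?thesis using add[OF add[OF sc[OF in_J(1)] sc[OF in_J(2)]] sc[OF xyx]] by simp
    next
      case Y
      have "(\<lambda>h. (delta [g] \<otimes>\<^bsub>F\<^esub> word_section ?s) h - word_section (lmult q (gen_coord g) ?s) h) =
        (\<lambda>h. cy ?s * delta [gen.Y, gen.Y] h + cz ?s * delta [gen.Y, gen.Y, gen.X] h)"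
        unfolding dr by (auto simp: Y word_section_def basis4 algebra_simps)
      then show ?thesis using add[OF sc[OF in_J(3)] sc[OF yyx]] by simp
    qed
    show ?case using add[OF A B] by simp
  qed
qed

lemma presented_Lambda:
  "presented_algebra word_monoid lscale (lmult q) (word_coord q) (lambda_relations q) word_section"
proof -
  interpret bilinear_mult lscale "lmult q" by (rule bilinear_lmult)
  interpret F: ring "monoid_algebra word_monoid :: ('a, gen list \<Rightarrow> 'a) module" by (rule ring_monoid_algebra[OF monoid_word])
  have fin: "f \<in> carrier (monoid_algebra word_monoid) \<longleftrightarrow> finite (support f)" for f :: "gen list \<Rightarrow> 'a"
    by (simp add: monoid_algebra_simps word_simps)
  show ?thesis
  proof (intro presented_algebra.intro presented_algebra_axioms.intro monoid_word bilinear_mult_axioms)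
    show "s \<in> lambda_relations q \<Longrightarrow> lext (word_coord q) s = 0" for s
      by (auto simp: lambda_relations_def ext_add ext_scale finite_support intro!: quad_eqI) (simp_all add: basis4)
    show "lext (word_coord q) (word_section w) = w" for w
      unfolding word_section_def
      by (rule quad_eqI; simp add: ext_add ext_scale finite_support; simp add: basis4)
    show "(\<lambda>h. delta w h - word_section (word_coord q w) h) \<in> Idl\<^bsub>monoid_algebra word_monoid\<^esub> lambda_relations q" for w
      by (rule word_section_mod)
    show "word_section w \<in> carrier (monoid_algebra word_monoid)" for w :: "'a quad"
      unfolding fin word_section_def by (intro finite_support)
    show "lambda_relations q \<subseteq> carrier (monoid_algebra word_monoid)"
      by (auto simp: fin lambda_relations_def intro!: finite_support)
  qed (auto simp: word_simps word_coord_append word_section_def algebra_simps)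
qed

definition lambda_coord :: "'k::field \<Rightarrow> (gen list \<Rightarrow> 'k) set \<Rightarrow> 'k quad" where
  "lambda_coord q = coset_value (linear_extension lscale (word_coord q))"

lemma coordinate_Lambda: "coordinate_algebra (Lambda q) lscale (lmult q) one4 (lambda_coord q)"
  using presented_algebra.coordinate_algebra_quotient[OF presented_Lambda[of q]]
  by (simp add: Lambda_eq lambda_coord_def word_simps)

section \<open>The enveloping algebra in coordinates\<close>

text \<open>\<open>tens r l\<close> are the coordinates of \<open>r \<otimes> l\<close>; the inner quadruples belong to the opposite factor.\<close>

definition tens :: "'k::field quad \<Rightarrow> 'k quad \<Rightarrow> 'k quad quad" where
  "tens r l = Quad (lscale (c1 l) r) (lscale (cx l) r) (lscale (cy l) r) (lscale (cz l) r)"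

lemma tens_sel [simp]:
  "c1 (tens r l) = lscale (c1 l) r" "cx (tens r l) = lscale (cx l) r"
  "cy (tens r l) = lscale (cy l) r" "cz (tens r l) = lscale (cz l) r"
  by (simp_all add: tens_def)

lemma tens_mult: "tens (lmult q r' r) (lmult q l l') = emult q (tens r l) (tens r' l')"
  by (intro quad_eqI) (simp_all add: algebra_simps)

lemma tens_linear:
  "tens (r + r') l = tens r l + tens r' l" "tens r (l + l') = tens r l + tens r l'"
  "tens (lscale c r) l = escale c (tens r l)" "tens r (lscale c l) = escale c (tens r l)"
  by (intro quad_eqI; simp add: algebra_simps)+

lemma tens_zero [simp]: "tens 0 l = 0"
  by (intro quad_eqI) simp_all

lemma opposite_simps [simp]:
  "carrier (opposite A) = carrier A" "mult (opposite A) = (\<lambda>a b. b \<otimes>\<^bsub>A\<^esub> a)" "one (opposite A) = one A"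
  "zero (opposite A) = zero A" "add (opposite A) = add A" "smult (opposite A) = smult A"
  by (simp_all add: opposite_def)

text \<open>From here to the dimension formula the algebra is known only through its coordinates;
  \<open>Lambda q\<close> is substituted in \<open>HH_Lambda_dim\<close>.\<close>

locale coordinate_lambda = coordinate_algebra A lscale "lmult q" one4 \<Lambda>
  for A :: "('k::field, 'a) module" (structure) and q :: 'k and \<Lambda> :: "'a \<Rightarrow> 'k quad"
begin

lemma expand:
  assumes "a \<in> carrier A"
  shows "a = c1 (\<Lambda> a) \<odot> el one4 \<oplus> (cx (\<Lambda> a) \<odot> el x4 \<oplus> (cy (\<Lambda> a) \<odot> el y4 \<oplus> cz (\<Lambda> a) \<odot> el z4))"
  by (subst coord_inj[symmetric])
    (use assms in \<open>auto simp: smult_carrier coord_add coord_smult basis4 intro!: quad_eqI\<close>)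

abbreviation "G \<equiv> opposite A \<times>\<times> A"

lemma G_simps: "carrier G = carrier A \<times> carrier A" "(a, b) \<otimes>\<^bsub>G\<^esub> (a', b') = (a' \<otimes> a, b \<otimes> b')" "\<one>\<^bsub>G\<^esub> = (\<one>, \<one>)"
  by (simp_all add: DirProd_def opposite_simps)

lemma monoid_G: "Group.monoid G"
proof (rule DirProd_monoid)
  show "Group.monoid (opposite A)" by (rule monoidI) (auto simp: opposite_simps m_assoc)
  show "Group.monoid A" by (rule monoid_axioms)
qed

definition pair_coord :: "'a \<times> 'a \<Rightarrow> 'k quad quad" where
  "pair_coord p = tens (\<Lambda> (fst p)) (\<Lambda> (snd p))"

definition section1 :: "'k quad \<Rightarrow> 'a \<Rightarrow> 'a \<times> 'a \<Rightarrow> 'k" where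
  "section1 r l = (\<lambda>p. c1 r * delta (el one4, l) p + (cx r * delta (el x4, l) p + (cy r * delta (el y4, l) p + cz r * delta (el z4, l) p)))"

definition pair_section :: "'k quad quad \<Rightarrow> 'a \<times> 'a \<Rightarrow> 'k" where
  "pair_section Q = (\<lambda>p. section1 (c1 Q) (el one4) p + (section1 (cx Q) (el x4) p +
    (section1 (cy Q) (el y4) p + section1 (cz Q) (el z4) p)))"

abbreviation "TR \<equiv> tensor_relations (opposite A) A"

lemma fin_section1: "finite (support (section1 r l))"
  unfolding section1_def by (intro finite_support)

lemma delta_G: "a \<in> carrier A \<Longrightarrow> b \<in> carrier A \<Longrightarrow> delta (a, b) \<in> carrier (monoid_algebra G)"
  by (rule delta_carrier) (simp add: G_simps)

lemma TR_carrier: "TR \<subseteq> carrier (monoid_algebra G)"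
  unfolding tensor_relations_def opposite_simps
  by (auto intro!: monoid_algebra_diff_closed delta_G monoid_algebra_smult_closed smult_carrier)

text \<open>By the bilinearity relations a pair may be expanded in the basis, first in its second
  entry and then in its first. Congruence modulo the ideal respects sums and scalar multiples, so
  the steps can be chained.\<close>

lemma section_mod:
  assumes a: "a \<in> carrier A" and b: "b \<in> carrier A"
  shows "(\<lambda>p. delta (a, b) p - pair_section (pair_coord (a, b)) p) \<in> Idl\<^bsub>monoid_algebra G\<^esub> TR"
proof -
  let ?M = "monoid_algebra G :: ('k, 'a \<times> 'a \<Rightarrow> 'k) module"
  let ?J = "Idl\<^bsub>?M\<^esub> TR"
  interpret M: ring ?M by (rule ring_monoid_algebra[OF monoid_G])
  interpret J: ideal ?J ?M by (rule M.genideal_ideal[OF TR_carrier])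
  note J_add = monoid_algebra_ideal_add[OF J.is_ideal]
  note J_scale = monoid_algebra_ideal_scale[OF monoid_G J.is_ideal]
  have TRJ: "f \<in> ?J" if "f \<in> TR" for f using M.genideal_self[OF TR_carrier] that by auto
  define eqv (infix \<open>\<approx>\<close> 50) where "f \<approx> g \<longleftrightarrow> (\<lambda>p. f p - g p) \<in> ?J" for f g :: "'a \<times> 'a \<Rightarrow> 'k"
  have tr [trans]: "f \<approx> h" if "f \<approx> g" "g \<approx> h" for f g h
    using J_add[OF that[unfolded eqv_def]] by (simp add: eqv_def)
  have ad: "(\<lambda>p. f p + g p) \<approx> (\<lambda>p. f' p + g' p)" if "f \<approx> f'" "g \<approx> g'" for f g f' g'
    using J_add[OF that[unfolded eqv_def]] by (simp add: eqv_def algebra_simps)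
  have sc: "(\<lambda>p. c * f p) \<approx> (\<lambda>p. c * g p)" if "f \<approx> g" for c f g
    using J_scale[OF that[unfolded eqv_def], of c] by (simp add: eqv_def algebra_simps)
  have l_add: "delta (a \<oplus> a', b) \<approx> (\<lambda>p. delta (a, b) p + delta (a', b) p)"
    if "a \<in> carrier A" "a' \<in> carrier A" "b \<in> carrier A" for a a' b
  proof -
    have "(\<lambda>p. delta (a \<oplus> a', b) p - delta (a, b) p - delta (a', b) p) \<in> TR"
      unfolding tensor_relations_def opposite_simps using that by (intro UnI1) blast
    from TRJ[OF this] show ?thesis by (simp only: eqv_def diff_diff_eq)
  qed
  have r_add: "delta (a, b \<oplus> b') \<approx> (\<lambda>p. delta (a, b) p + delta (a, b') p)"
    if "a \<in> carrier A" "b' \<in> carrier A" "b \<in> carrier A" for a b b'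
  proof -
    have "(\<lambda>p. delta (a, b \<oplus> b') p - delta (a, b) p - delta (a, b') p) \<in> TR"
      unfolding tensor_relations_def opposite_simps using that by (rule_tac UnI1, rule_tac UnI1, rule_tac UnI2) blast
    from TRJ[OF this] show ?thesis by (simp only: eqv_def diff_diff_eq)
  qed
  have l_sc: "delta (c \<odot> a, b) \<approx> (\<lambda>p. c * delta (a, b) p)" if "a \<in> carrier A" "b \<in> carrier A" for a b c
  proof -
    have "(\<lambda>p. delta (c \<odot> a, b) p - c * delta (a, b) p) \<in> TR"
      unfolding tensor_relations_def opposite_simps using that by (rule_tac UnI1, rule_tac UnI2) blast
    from TRJ[OF this] show ?thesis by (simp only: eqv_def)
  qed
  have r_sc: "delta (a, c \<odot> b) \<approx> (\<lambda>p. c * delta (a, b) p)" if "a \<in> carrier A" "b \<in> carrier A" for a b c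
  proof -
    have "(\<lambda>p. delta (a, c \<odot> b) p - c * delta (a, b) p) \<in> TR"
      unfolding tensor_relations_def opposite_simps using that by (rule_tac UnI2) blast
    from TRJ[OF this] show ?thesis by (simp only: eqv_def)
  qed
  have L: "delta (a, b) \<approx> section1 (\<Lambda> a) b" if "b \<in> carrier A" for b
    unfolding section1_def
    by (subst expand[OF a])
      (intro tr[OF l_add ad[OF l_sc]] tr[OF l_add ad] l_sc smult_carrier el_carrier a_closed that)
  have R: "delta (a, b) \<approx> (\<lambda>p. c1 (\<Lambda> b) * delta (a, el one4) p + (cx (\<Lambda> b) * delta (a, el x4) p +
      (cy (\<Lambda> b) * delta (a, el y4) p + cz (\<Lambda> b) * delta (a, el z4) p)))"
    by (subst (1) expand[OF b])
      (intro tr[OF r_add ad[OF r_sc]] tr[OF r_add ad] r_sc smult_carrier el_carrier a_closed a)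
  also have "\<dots> \<approx> (\<lambda>p. c1 (\<Lambda> b) * section1 (\<Lambda> a) (el one4) p + (cx (\<Lambda> b) * section1 (\<Lambda> a) (el x4) p +
      (cy (\<Lambda> b) * section1 (\<Lambda> a) (el y4) p + cz (\<Lambda> b) * section1 (\<Lambda> a) (el z4) p)))"
    by (intro ad sc L el_carrier)
  also have "\<dots> = pair_section (pair_coord (a, b))"
    by (simp add: pair_section_def pair_coord_def section1_def algebra_simps)
  finally show ?thesis by (simp add: eqv_def)
qed

lemma presented_enveloping:
  "presented_algebra G escale (emult q) pair_coord TR pair_section"
proof -
  interpret E: bilinear_mult escale "emult q" by (rule bilinear_emult)
  have d: "finite (support (delta p))" for p :: "'a \<times> 'a" by (rule finite_support_delta)
  show ?thesis
  proof (intro presented_algebra.intro presented_algebra_axioms.intro monoid_G E.bilinear_mult_axioms)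
    show "s \<in> TR \<Longrightarrow> linear_extension escale pair_coord s = 0" for s
      unfolding tensor_relations_def opposite_simps
      by (auto simp: E.ext_diff E.ext_scale finite_support_delta finite_support_neq finite_support_scale
          pair_coord_def coord_add coord_smult tens_linear)
    show "linear_extension escale pair_coord (pair_section Q) = Q" for Q
    proof -
      have s1: "linear_extension escale pair_coord (section1 r l) = tens r (\<Lambda> l)" for r l
        unfolding section1_def
        by (simp add: E.ext_add E.ext_scale finite_support) (intro quad_eqI; simp add: pair_coord_def basis4)
      show ?thesis
        unfolding pair_section_def
        by (simp add: E.ext_add fin_section1 finite_support_add s1) (intro quad_eqI; simp add: basis4)
    qed
    show "pair_section (w + w') = (\<lambda>g. pair_section w g + pair_section w' g)" for w w'
      by (simp add: pair_section_def section1_def algebra_simps)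
    show "pair_section (escale c w) = (\<lambda>g. c * pair_section w g)" for c w
      by (simp add: pair_section_def section1_def algebra_simps)
    show "pair_section w \<in> carrier (monoid_algebra G)" for w
      unfolding pair_section_def section1_def
      by (intro monoid_algebra_add_closed monoid_algebra_smult_closed delta_G el_carrier)
    show "TR \<subseteq> carrier (monoid_algebra G)" by (rule TR_carrier)
    show "pair_coord (a \<otimes>\<^bsub>G\<^esub> b) = emult q (pair_coord a) (pair_coord b)"
      if "a \<in> carrier G" "b \<in> carrier G" for a b
      using that by (cases a; cases b) (simp add: G_simps pair_coord_def coord_mult tens_mult)
    show "(\<lambda>h. delta g h - pair_section (pair_coord g) h) \<in> Idl\<^bsub>monoid_algebra G\<^esub> TR"
      if "g \<in> carrier G" for g
      using that section_mod by (cases g) (simp add: G_simps)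
  qed
qed

definition env_coord :: "('a \<times> 'a \<Rightarrow> 'k) set \<Rightarrow> 'k quad quad" where
  "env_coord = coset_value (linear_extension escale pair_coord)"

lemma coordinate_enveloping:
  "coordinate_algebra (enveloping A) escale (emult q) (tens one4 one4) env_coord"
  using presented_algebra.coordinate_algebra_quotient[OF presented_enveloping]
  by (simp add: enveloping_def tensor_algebra_def env_coord_def G_simps pair_coord_def coord_one)

section \<open>The algebra as a bimodule\<close>

text \<open>If \<open>Q\<close> is the sum of r_i \<otimes> e_i over the basis e_i = 1, x, y, y x,
  it acts by sending m to the sum of e_i m r_i; here \<open>c1 Q\<close>, \<open>cx Q\<close>,
  \<open>cy Q\<close>, \<open>cz Q\<close> are the r_i.\<close>

definition act :: "'k quad quad \<Rightarrow> 'k quad \<Rightarrow> 'k quad" where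
  "act Q m = lmult q m (c1 Q) + lmult q (lmult q x4 m) (cx Q) + lmult q (lmult q y4 m) (cy Q) + lmult q (lmult q z4 m) (cz Q)"

lemma act_tens: "act (tens r l) m = lmult q (lmult q l m) r"
  by (rule quad_eqI) (simp_all add: act_def basis4 algebra_simps)

lemma act_emult: "act (emult q P Q) m = act P (act Q m)"
  by (rule quad_eqI) (simp_all add: act_def basis4 algebra_simps)

lemma act_add: "act (P + Q) m = act P m + act Q m" "act P (m + n) = act P m + act P n"
  by (rule quad_eqI; simp add: act_def basis4 algebra_simps)+

lemma act_scale: "act (escale c P) m = lscale c (act P m)" "act P (lscale c m) = lscale c (act P m)"
  by (rule quad_eqI; simp add: act_def basis4 algebra_simps)+

lemma act_zero [simp]: "act 0 m = 0" "act P 0 = 0"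
  by (rule quad_eqI; simp add: act_def basis4)+

lemma act_sum: "act (sum h T) m = (\<Sum>i\<in>T. act (h i) m)"
  by (induction T rule: infinite_finite_induct) (simp_all add: act_add)

text \<open>The sum in \<open>regular_bimodule\<close> depends on a representative only through its
  linear extension, which is constant on a coset. So the set of its values is a singleton, as
  \<open>the_elem\<close> requires.\<close>

lemma bimodule_smult:
  assumes u: "u \<in> carrier (enveloping A)" and m: "m \<in> carrier A"
  shows "u \<odot>\<^bsub>regular_bimodule A\<^esub> m = el (act (env_coord u) (\<Lambda> m))"
proof -
  interpret P: presented_algebra G escale "emult q" pair_coord TR pair_section by (rule presented_enveloping)
  let ?g = "\<lambda>f. \<Oplus>p\<in>{p. f p \<noteq> 0}. f p \<odot> (snd p \<otimes> m \<otimes> fst p)"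
  have uQ: "u \<in> carrier (quotient P.MA P.J)" using u by (simp add: enveloping_def tensor_algebra_def)
  have "?g f = el (act (env_coord u) (\<Lambda> m))" if f: "f \<in> u" for f
  proof -
    have fM: "f \<in> carrier P.MA" and ev: "env_coord u = P.lext pair_coord f"
      using P.coord_eq[OF uQ f] by (simp_all add: env_coord_def)
    have sup: "finite (support f)" "\<And>p. f p \<noteq> 0 \<Longrightarrow> fst p \<in> carrier A \<and> snd p \<in> carrier A"
      using fM by (auto simp: monoid_algebra_simps(1) G_simps)
    have c: "f p \<odot> (snd p \<otimes> m \<otimes> fst p) \<in> carrier A" if "f p \<noteq> 0" for p
      using sup(2)[OF that] m by (simp add: smult_carrier)
    have gA: "?g f \<in> carrier A" using c by (intro finsum_closed) auto
    have "\<Lambda> (?g f) = (\<Sum>p\<in>support f. lscale (f p) (lmult q (lmult q (\<Lambda> (snd p)) (\<Lambda> m)) (\<Lambda> (fst p))))"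
      using sup m c by (subst coord_finsum) (auto simp: coord_smult coord_mult intro!: sum.cong)
    also have "\<dots> = (\<Sum>p\<in>support f. act (escale (f p) (pair_coord p)) (\<Lambda> m))"
      by (simp add: act_scale act_tens pair_coord_def)
    also have "\<dots> = act (\<Sum>p\<in>support f. escale (f p) (pair_coord p)) (\<Lambda> m)"
      by (rule act_sum[symmetric])
    also have "\<dots> = act (env_coord u) (\<Lambda> m)" by (simp add: ev linear_extension_def)
    finally have "\<Lambda> (?g f) = act (env_coord u) (\<Lambda> m)" .
    from arg_cong[OF this, of el] show ?thesis unfolding el_coord[OF gA] .
  qed
  then have "?g ` u = (\<lambda>f. el (act (env_coord u) (\<Lambda> m))) ` u" by (rule image_cong[OF refl])
  also have "\<dots> = {el (act (env_coord u) (\<Lambda> m))}"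
    using P.carrier_nonempty[OF uQ] by (simp add: image_constant_conv)
  finally show ?thesis by (simp add: regular_bimodule_def)
qed

lemma bimodule_simps:
  "carrier (regular_bimodule A) = carrier A" "add (regular_bimodule A) = add A" "zero (regular_bimodule A) = zero A"
  by (simp_all add: regular_bimodule_def)

lemma left_module_bimodule: "left_module (enveloping A) (regular_bimodule A)"
proof -
  interpret E: coordinate_algebra "enveloping A" escale "emult q" "tens one4 one4" env_coord
    by (rule coordinate_enveloping)
  have ab: "abelian_group (regular_bimodule A)"
    by (rule abelian_groupI; unfold bimodule_simps)
      (assumption | rule a_closed zero_closed a_assoc add.m_comm l_zero add.l_inv_ex)+
  have eladd: "el (v + w) = el v \<oplus> el w" for v w
    by (subst coord_inj[symmetric]) (simp_all add: coord_add)
  have actone: "act (tens one4 one4) v = v" for v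
    by (simp add: act_tens)
  show ?thesis
    by (intro left_module.intro left_module_axioms.intro E.ring_axioms ab)
      (simp_all add: bimodule_smult bimodule_simps E.coord_add E.coord_mult E.coord_one act_add act_emult
        eladd coord_add actone)
qed

lemma scalar_algebra_enveloping: "scalar_algebra (enveloping A)"
proof -
  interpret E: coordinate_algebra "enveloping A" escale "emult q" "tens one4 one4" env_coord
    by (rule coordinate_enveloping)
  show ?thesis
    by (intro scalar_algebra.intro scalar_algebra_axioms.intro E.ring_axioms E.scalar_closed E.scalar_eqs)
qed

end

section \<open>The Koszul bimodule resolution\<close>

text \<open>
  The generators of degree \<open>n\<close> are \<open>f a b\<close> with \<open>a + b = n\<close>, indexed by \<open>a\<close>: the sum of all words
  with \<open>a\<close> letters \<open>x\<close> and \<open>b\<close> letters \<open>y\<close>, weighted by powers of \<open>q\<close>, so that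
  \<open>f a b = x f (a-1) b + q^a y f a (b-1) = q^b f (a-1) b x + f a (b-1) y\<close>.
  The differential maps \<open>f a b\<close> to \<open>x f (a-1) b + q^a y f a (b-1) + (-1)^n (q^b f (a-1) b x + f a (b-1) y)\<close>.
\<close>

definition X_coeff :: "'k::field \<Rightarrow> nat \<Rightarrow> nat \<Rightarrow> 'k quad quad" where
  "X_coeff q n b = tens one4 x4 + escale ((-1) ^ Suc n * q ^ b) (tens x4 one4)"

definition Y_coeff :: "'k::field \<Rightarrow> nat \<Rightarrow> nat \<Rightarrow> 'k quad quad" where
  "Y_coeff q n a = escale (q ^ a) (tens one4 y4) + escale ((-1) ^ Suc n) (tens y4 one4)"

text \<open>n is the degree of the target, hence \<open>Suc n\<close> in the signs. The coefficient
  at f a (n-a) receives contributions from f (a+1) (n-a) by x and from f a (n+1-a) by y.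
  Coefficients are multiplied from the right because the modules are left modules.\<close>

definition kdiff :: "'k::field \<Rightarrow> nat \<Rightarrow> (nat \<Rightarrow> 'k quad quad) \<Rightarrow> nat \<Rightarrow> 'k quad quad" where
  "kdiff q n V a = (if a \<le> n then emult q (V (Suc a)) (X_coeff q n (n - a)) + emult q (V a) (Y_coeff q n a) else 0)"

text \<open>
  A contracting homotopy that is linear for the right action: it maps \<open>x f a b\<close> to \<open>f (a+1) b\<close>,
  \<open>y f 0 b\<close> to \<open>f 0 (b+1)\<close> and \<open>y x f a b\<close> to \<open>y f (a+1) b\<close>, plus \<open>(-q)^b f 0 (b+1) x\<close> if \<open>a = 0\<close>; the other
  left multiples \<open>f a b\<close> and, for \<open>a > 0\<close>, \<open>y f a b\<close> are mapped to \<open>0\<close>.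
\<close>

definition khomotopy :: "'k::field \<Rightarrow> nat \<Rightarrow> (nat \<Rightarrow> 'k quad quad) \<Rightarrow> nat \<Rightarrow> 'k quad quad" where
  "khomotopy q n V a = (case a of
    0 \<Rightarrow> Quad (cy (V 0) + lscale ((- q) ^ n) (lmult q x4 (cz (V 0)))) 0 0 0
  | Suc a \<Rightarrow> Quad (cx (V a)) 0 (cz (V a)) 0)"

lemma kdiff_kdiff: "kdiff q n (kdiff q (Suc n) V) = (\<lambda>_. 0)"
proof
  fix a
  show "kdiff q n (kdiff q (Suc n) V) a = 0"
  proof (cases "a \<le> n")
    case True
    then obtain b where n: "n = a + b" using le_Suc_ex by blast
    have s: "(-1) ^ n * (-1) ^ n = (1 :: 'a)" "\<And>x. (-1) ^ n * ((-1) ^ n * x) = (x :: 'a)"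
      by (simp_all flip: power_add mult.assoc)
    obtain s :: 'a where s': "s = (-1) ^ n" by simp
    have ss: "s * s = 1" "\<And>x. s * (s * x) = x" using s by (simp_all add: s')
    \<comment> \<open>With s for the sign and p, t for the powers of q, this is a polynomial
      identity whose only extra input is s s = 1.\<close>
    have key: "emult q (emult q P (tens one4 x4 + escale (s * p) (tens x4 one4)) +
          emult q Q (escale (q * t) (tens one4 y4) + escale s (tens y4 one4)))
        (tens one4 x4 + escale (- s * p) (tens x4 one4)) +
      emult q (emult q Q (tens one4 x4 + escale (s * (q * p)) (tens x4 one4)) +
          emult q T (escale t (tens one4 y4) + escale s (tens y4 one4)))
        (escale t (tens one4 y4) + escale (- s) (tens y4 one4)) = 0" for P Q T p t
      by (intro quad_eqI) (simp_all add: basis4 algebra_simps ss)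
    show ?thesis
      using key[of "V (Suc (Suc a))" "q ^ b" "V (Suc a)" "q ^ a" "V a"] True
      by (simp add: kdiff_def X_coeff_def Y_coeff_def n s' Suc_diff_le)
  qed (simp add: kdiff_def)
qed

lemma khomotopy_outside: "(\<And>a. a > n \<Longrightarrow> V a = 0) \<Longrightarrow> a > Suc n \<Longrightarrow> khomotopy q n V a = 0"
  by (cases a) (auto simp: khomotopy_def intro!: quad_eqI)

lemma khomotopy_zero: "khomotopy q n (\<lambda>_. 0) = (\<lambda>_. 0)"
  by (rule HOL.ext) (auto simp: khomotopy_def intro!: quad_eqI split: nat.splits)

text \<open>If the differential kills V, this exhibits V as a boundary. The homotopy is no
  homomorphism of bimodules, but exactness asks for nothing more than a preimage.\<close>

lemma khomotopy_identity:
  assumes "\<And>a. a > Suc n \<Longrightarrow> V a = 0"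
  shows "kdiff q (Suc n) (khomotopy q (Suc n) V) a + khomotopy q n (kdiff q n V) a = V a"
proof -
  obtain s :: 'a where s': "s = (-1) ^ n" by simp
  have ss: "s * s = 1" "\<And>x. s * (s * x) = x" by (simp_all add: s' flip: power_add mult.assoc)
  show ?thesis
  proof (cases "a \<le> Suc n")
    case False
    then show ?thesis
      using assms[of a] by (cases a) (auto simp: kdiff_def khomotopy_def zero_quad_def)
  next
    case True
    show ?thesis
    proof (cases a)
      case 0
      \<comment> \<open>Here p stands for q^n, so that s p is (-q)^n, the factor in entry 0 of the
        homotopy.\<close>
      have "emult q (Quad (cx P) 0 (cz P) 0) (tens one4 x4 + escale (s * (q * p)) (tens x4 one4)) +
          emult q (Quad (cy P + lscale (- q * (s * p)) (lmult q x4 (cz P))) 0 0 0) (tens one4 y4 + escale s (tens y4 one4)) +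
          Quad (cy U + lscale (s * p) (lmult q x4 (cz U))) 0 0 0 = P"
        if "U = emult q Q (tens one4 x4 + escale (- s * p) (tens x4 one4)) + emult q P (tens one4 y4 + escale (- s) (tens y4 one4))"
        for P Q U p
        unfolding that by (intro quad_eqI) (simp_all add: basis4 algebra_simps ss)
      from this[OF refl, of "V 0" "q ^ n" "V (Suc 0)"] show ?thesis
        by (simp add: 0 kdiff_def khomotopy_def X_coeff_def Y_coeff_def s' power_minus[of q] mult.assoc mult.left_commute quad_scale_def tens_def)
    next
      case (Suc a')
      then have "a' \<le> n" using True by simp
      then obtain b where n: "n = a' + b" using le_Suc_ex by blast
      have "emult q (Quad (cx Q) 0 (cz Q) 0) (tens one4 x4 + escale (s * p) (tens x4 one4)) +
          emult q (Quad (cx P) 0 (cz P) 0) (escale (q * t) (tens one4 y4) + escale s (tens y4 one4)) +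
          Quad (cx U) 0 (cz U) 0 = Q"
        if "U = emult q Q (tens one4 x4 + escale (- s * p) (tens x4 one4)) + emult q P (escale t (tens one4 y4) + escale (- s) (tens y4 one4))"
        for P Q U p t
        unfolding that by (intro quad_eqI) (simp_all add: basis4 algebra_simps ss)
      from this[OF refl, of "V (Suc a')" "q ^ b" "V a'" "q ^ a'"] show ?thesis
        by (simp add: Suc kdiff_def khomotopy_def X_coeff_def Y_coeff_def s' n)
    qed
  qed
qed

section \<open>The resolution by free modules over the enveloping algebra\<close>

type_synonym ('a, 'k) gens = "(('a \<times> 'a \<Rightarrow> 'k) set + 'a) list"

context coordinate_lambda
begin

text \<open>In degree 0 the augmentation replaces the outgoing differential, and its right-linear
  section, which sends m to \<open>tens m one4\<close>, completes the homotopy.\<close>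

lemma khomotopy_identity_0: "kdiff q 0 (khomotopy q 0 V) 0 + tens (act (V 0) one4) one4 = V 0"
  by (intro quad_eqI) (simp_all add: kdiff_def khomotopy_def X_coeff_def Y_coeff_def act_def basis4 algebra_simps)

lemma act_kdiff_0: "act (kdiff q 0 V 0) one4 = 0"
  by (intro quad_eqI) (simp_all add: kdiff_def X_coeff_def Y_coeff_def act_def basis4 algebra_simps)

abbreviation "R \<equiv> enveloping A"

interpretation E: coordinate_algebra "enveloping A" escale "emult q" "tens one4 one4" env_coord
  by (rule coordinate_enveloping)

interpretation B: left_module "enveloping A" "regular_bimodule A"
  by (rule left_module_bimodule)

text \<open>\<open>Ext\<close> prescribes lists as index type of the free modules, so the generator
  f a (n-a) is represented by a list of length a.\<close>

definition code :: "nat \<Rightarrow> ('a, 'k) gens" where "code a = replicate a undefined"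

lemma length_code [simp]: "length (code a) = a" by (simp add: code_def)

lemma code_eq_iff [simp]: "code a = (code b :: ('a, 'k) gens) \<longleftrightarrow> a = b"
  by (metis length_code)

lemma code_in [simp]: "code a \<in> code ` {..n} \<longleftrightarrow> a \<le> n" by auto

definition koszul :: "nat \<Rightarrow> (('a \<times> 'a \<Rightarrow> 'k) set, ('a, 'k) gens \<Rightarrow> ('a \<times> 'a \<Rightarrow> 'k) set) module" where
  "koszul n = free_module R (code ` {..n})"

definition koszul_d :: "nat \<Rightarrow> (('a, 'k) gens \<Rightarrow> ('a \<times> 'a \<Rightarrow> 'k) set) \<Rightarrow> (('a, 'k) gens \<Rightarrow> ('a \<times> 'a \<Rightarrow> 'k) set)" where
  "koszul_d n v = (\<lambda>s. if s \<in> code ` {..n}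
    then v (code (Suc (length s))) \<otimes>\<^bsub>R\<^esub> E.el (X_coeff q n (n - length s)) \<oplus>\<^bsub>R\<^esub> v s \<otimes>\<^bsub>R\<^esub> E.el (Y_coeff q n (length s))
    else \<zero>\<^bsub>R\<^esub>)"

definition koszul_\<epsilon> :: "(('a, 'k) gens \<Rightarrow> ('a \<times> 'a \<Rightarrow> 'k) set) \<Rightarrow> 'a" where
  "koszul_\<epsilon> v = v (code 0) \<odot>\<^bsub>regular_bimodule A\<^esub> \<one>"

definition coords :: "(('a, 'k) gens \<Rightarrow> ('a \<times> 'a \<Rightarrow> 'k) set) \<Rightarrow> nat \<Rightarrow> 'k quad quad" where
  "coords v a = env_coord (v (code a))"

definition of_coords :: "nat \<Rightarrow> (nat \<Rightarrow> 'k quad quad) \<Rightarrow> (('a, 'k) gens \<Rightarrow> ('a \<times> 'a \<Rightarrow> 'k) set)" where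
  "of_coords n V = (\<lambda>s. if s \<in> code ` {..n} then E.el (V (length s)) else \<zero>\<^bsub>R\<^esub>)"

lemma koszul_carrier: "v \<in> carrier (koszul n) \<longleftrightarrow> (\<forall>s. v s \<in> carrier R) \<and> (\<forall>s. s \<notin> code ` {..n} \<longrightarrow> v s = \<zero>\<^bsub>R\<^esub>)"
  (is "?l \<longleftrightarrow> ?r")
proof -
  have "finite {s. v s \<noteq> \<zero>\<^bsub>R\<^esub>}" if ?r
    by (rule finite_subset[of _ "code ` {..n}"]) (use that in auto)
  then show ?thesis unfolding koszul_def free_module_carrier[OF E.ring_axioms] by auto
qed

lemma koszul_ops:
  "v \<oplus>\<^bsub>koszul n\<^esub> w = (\<lambda>s. v s \<oplus>\<^bsub>R\<^esub> w s)" "r \<odot>\<^bsub>koszul n\<^esub> v = (\<lambda>s. r \<otimes>\<^bsub>R\<^esub> v s)" "\<zero>\<^bsub>koszul n\<^esub> = (\<lambda>_. \<zero>\<^bsub>R\<^esub>)"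
  by (simp_all add: koszul_def free_module_ops)

lemma koszul_closed: "v \<in> carrier (koszul n) \<Longrightarrow> v s \<in> carrier R"
  by (simp add: koszul_carrier)

lemma coords_outside: "v \<in> carrier (koszul n) \<Longrightarrow> a > n \<Longrightarrow> coords v a = 0"
  by (auto simp: coords_def koszul_carrier E.coord_zero)

lemma coords_inj: "v \<in> carrier (koszul n) \<Longrightarrow> w \<in> carrier (koszul n) \<Longrightarrow> (\<And>a. a \<le> n \<Longrightarrow> coords v a = coords w a) \<Longrightarrow> v = w"
  by (rule HOL.ext, rename_tac s, case_tac "s \<in> code ` {..n}") (auto simp: koszul_carrier coords_def E.coord_inj)

lemma of_coords_closed: "of_coords n V \<in> carrier (koszul n)"
  by (auto simp: koszul_carrier of_coords_def)

lemma coords_of_coords: "(\<And>a. a > n \<Longrightarrow> V a = 0) \<Longrightarrow> coords (of_coords n V) = V"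
  by (rule HOL.ext) (auto simp: coords_def of_coords_def E.coord_zero not_le)

lemma koszul_d_closed: "v \<in> carrier (koszul (Suc n)) \<Longrightarrow> koszul_d n v \<in> carrier (koszul n)"
  by (auto simp: koszul_carrier koszul_d_def)

lemma coords_koszul_d: "v \<in> carrier (koszul (Suc n)) \<Longrightarrow> coords (koszul_d n v) = kdiff q n (coords v)"
  by (rule HOL.ext) (auto simp: coords_def koszul_d_def kdiff_def koszul_closed E.coord_add E.coord_mult E.coord_zero)

lemma koszul_d_hom: "(koszul_d n :: (('a, 'k) gens \<Rightarrow> _) \<Rightarrow> _) \<in> module_hom R (koszul (Suc n)) (koszul n)"
proof (rule module_homI)
  fix v w :: "('a, 'k) gens \<Rightarrow> _" assume "v \<in> carrier (koszul (Suc n))" "w \<in> carrier (koszul (Suc n))"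
  then have c: "v s \<in> carrier R" "w s \<in> carrier R" for s by (simp_all add: koszul_closed)
  show "koszul_d n (v \<oplus>\<^bsub>koszul (Suc n)\<^esub> w) = koszul_d n v \<oplus>\<^bsub>koszul n\<^esub> koszul_d n w"
    by (rule HOL.ext) (simp add: koszul_ops koszul_d_def c E.l_distr E.a_ac)
next
  fix r v assume "r \<in> carrier R" "v \<in> carrier (koszul (Suc n))"
  moreover from this(2) have c: "v s \<in> carrier R" for s by (simp add: koszul_closed)
  ultimately show "koszul_d n (r \<odot>\<^bsub>koszul (Suc n)\<^esub> v) = r \<odot>\<^bsub>koszul n\<^esub> koszul_d n v"
    by (intro HOL.ext) (simp add: koszul_ops koszul_d_def E.r_distr E.m_assoc)
qed (rule koszul_d_closed)

lemma koszul_\<epsilon>_eq: "v \<in> carrier (koszul 0) \<Longrightarrow> koszul_\<epsilon> v = el (act (coords v 0) one4)"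
  by (simp add: koszul_\<epsilon>_def bimodule_smult koszul_closed coords_def coord_one)

lemma koszul_\<epsilon>_hom: "koszul_\<epsilon> \<in> module_hom R (koszul 0) (regular_bimodule A)"
proof -
  have 1: "\<one> \<in> carrier (regular_bimodule A)" by (simp add: bimodule_simps)
  show ?thesis
    by (rule module_homI)
      (simp_all add: koszul_\<epsilon>_def koszul_closed koszul_ops 1 B.smult_closed B.smult_l_distr B.smult_assoc)
qed

lemma projective_koszul: "projective R (koszul n)"
proof -
  have "env_coord \<one>\<^bsub>R\<^esub> \<noteq> env_coord \<zero>\<^bsub>R\<^esub>"
    by (simp add: E.coord_one E.coord_zero tens_def basis4 zero_quad_def quad_scale_def)
  then have "\<one>\<^bsub>R\<^esub> \<noteq> \<zero>\<^bsub>R\<^esub>" by auto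
  then show ?thesis unfolding koszul_def by (rule projective_free_module[OF E.ring_axioms])
qed

lemma projective_resolution_koszul: "projective_resolution R (regular_bimodule A) koszul koszul_d koszul_\<epsilon>"
  unfolding projective_resolution_def
proof (intro conjI allI projective_koszul koszul_d_hom koszul_\<epsilon>_hom)
  note \<epsilon>c = module_homD(1)[OF koszul_\<epsilon>_hom]
  show "koszul_\<epsilon> ` carrier (koszul 0) = carrier (regular_bimodule A)"
  proof (intro equalityI subsetI)
    fix m assume "m \<in> carrier (regular_bimodule A)"
    then have m: "m \<in> carrier A" by (simp add: bimodule_simps)
    \<comment> \<open>The right-linear section of the augmentation.\<close>
    let ?v = "of_coords 0 (\<lambda>a. if a = 0 then tens (\<Lambda> m) one4 else 0)"
    have "koszul_\<epsilon> ?v = m"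
      using m by (simp add: koszul_\<epsilon>_eq of_coords_closed coords_of_coords act_tens)
    from sym[OF this] show "m \<in> koszul_\<epsilon> ` carrier (koszul 0)" by (rule image_eqI[OF _ of_coords_closed])
  qed (use \<epsilon>c in auto)
  show "koszul_d 0 ` carrier (koszul (Suc 0)) = {v \<in> carrier (koszul 0). koszul_\<epsilon> v = \<zero>\<^bsub>regular_bimodule A\<^esub>}"
  proof (intro equalityI subsetI CollectI conjI)
    fix w assume "w \<in> koszul_d 0 ` carrier (koszul (Suc 0))"
    then obtain v where v: "v \<in> carrier (koszul (Suc 0))" "w = koszul_d 0 v" by auto
    then show wc: "w \<in> carrier (koszul 0)" by (simp add: koszul_d_closed)
    have "\<Lambda> (koszul_\<epsilon> w) = \<Lambda> \<zero>"
      using v wc by (simp add: koszul_\<epsilon>_eq coords_koszul_d act_kdiff_0 coord_zero)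
    then show "koszul_\<epsilon> w = \<zero>\<^bsub>regular_bimodule A\<^esub>"
      using \<epsilon>c[OF wc] by (simp add: coord_inj bimodule_simps)
  next
    fix v assume "v \<in> {v \<in> carrier (koszul 0). koszul_\<epsilon> v = \<zero>\<^bsub>regular_bimodule A\<^esub>}"
    then have v: "v \<in> carrier (koszul 0)" "\<Lambda> (koszul_\<epsilon> v) = 0" by (auto simp: bimodule_simps coord_zero)
    then have z: "act (coords v 0) one4 = 0" by (simp add: koszul_\<epsilon>_eq)
    \<comment> \<open>The homotopy supplies the preimage: its identity reduces to d h V = V, since
      the augmentation kills V.\<close>
    let ?w = "of_coords (Suc 0) (khomotopy q 0 (coords v))"
    have c: "coords ?w = khomotopy q 0 (coords v)"
      by (rule coords_of_coords, rule khomotopy_outside[where V = "coords v", OF coords_outside[OF v(1)]])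
    have "koszul_d 0 ?w = v"
      using khomotopy_identity_0[of "coords v"] z
      by (intro coords_inj[of _ 0] koszul_d_closed of_coords_closed v)
        (simp add: coords_koszul_d of_coords_closed c)
    from sym[OF this] show "v \<in> koszul_d 0 ` carrier (koszul (Suc 0))" by (rule image_eqI[OF _ of_coords_closed])
  qed
  fix n
  show "koszul_d (Suc n) ` carrier (koszul (Suc (Suc n))) = {v \<in> carrier (koszul (Suc n)). koszul_d n v = \<zero>\<^bsub>koszul n\<^esub>}"
  proof (intro equalityI subsetI CollectI conjI)
    fix w assume "w \<in> koszul_d (Suc n) ` carrier (koszul (Suc (Suc n)))"
    then obtain v where v: "v \<in> carrier (koszul (Suc (Suc n)))" "w = koszul_d (Suc n) v" by auto
    then show wc: "w \<in> carrier (koszul (Suc n))" by (simp add: koszul_d_closed)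
    have "\<zero>\<^bsub>koszul n\<^esub> \<in> carrier (koszul n)" by (simp add: koszul_carrier koszul_ops)
    then show "koszul_d n w = \<zero>\<^bsub>koszul n\<^esub>"
      by (rule coords_inj[OF koszul_d_closed[OF wc]])
        (use v wc in \<open>simp add: coords_koszul_d kdiff_kdiff\<close>, simp add: coords_def koszul_ops E.coord_zero)
  next
    fix v assume "v \<in> {v \<in> carrier (koszul (Suc n)). koszul_d n v = \<zero>\<^bsub>koszul n\<^esub>}"
    then have v: "v \<in> carrier (koszul (Suc n))" "koszul_d n v = \<zero>\<^bsub>koszul n\<^esub>" by auto
    have "kdiff q n (coords v) = (\<lambda>_. 0)"
    proof
      fix a
      have "kdiff q n (coords v) a = coords (koszul_d n v) a" by (simp only: coords_koszul_d[OF v(1)])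
      also have "\<dots> = 0" by (simp only: v(2)) (simp add: coords_def koszul_ops E.coord_zero)
      finally show "kdiff q n (coords v) a = 0" .
    qed
    then have key: "kdiff q (Suc n) (khomotopy q (Suc n) (coords v)) a = coords v a" for a
      using khomotopy_identity[of n "coords v" q a, OF coords_outside[OF v(1)]] by (simp add: khomotopy_zero)
    let ?w = "of_coords (Suc (Suc n)) (khomotopy q (Suc n) (coords v))"
    have c: "coords ?w = khomotopy q (Suc n) (coords v)"
      by (rule coords_of_coords, rule khomotopy_outside[where V = "coords v", OF coords_outside[OF v(1)]])
    have "koszul_d (Suc n) ?w = v"
      by (intro coords_inj[of _ "Suc n"] koszul_d_closed of_coords_closed v)
        (simp add: coords_koszul_d of_coords_closed c key)
    from sym[OF this] show "v \<in> koszul_d (Suc n) ` carrier (koszul (Suc (Suc n)))" by (rule image_eqI[OF _ of_coords_closed])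
  qed
qed

end

section \<open>The Hom complex in coordinates\<close>

context coordinate_lambda
begin

interpretation E: coordinate_algebra "enveloping A" escale "emult q" "tens one4 one4" env_coord
  by (rule coordinate_enveloping)

interpretation B: left_module "enveloping A" "regular_bimodule A"
  by (rule left_module_bimodule)

definition val :: "((('a, 'k) gens \<Rightarrow> ('a \<times> 'a \<Rightarrow> 'k) set) \<Rightarrow> 'a) \<Rightarrow> nat \<Rightarrow> 'k quad" where
  "val f a = \<Lambda> (f (free_basis R (code a)))"

text \<open>A cochain is determined by its values V on the generators. This is the value on f a
  (n+1-a) of the cochain composed with the Koszul differential, which involves f (a-1) (n+1-a) and f
  a (n-a).\<close>

definition cdiff :: "nat \<Rightarrow> (nat \<Rightarrow> 'k quad) \<Rightarrow> nat \<Rightarrow> 'k quad" where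
  "cdiff n V a = (case a of 0 \<Rightarrow> 0 | Suc c \<Rightarrow> act (X_coeff q n (n - c)) (V c)) + (if a \<le> n then act (Y_coeff q n a) (V a) else 0)"

lemma left_module_koszul: "left_module R (koszul n)"
  unfolding koszul_def by (rule left_module_free_module[OF E.ring_axioms])

lemma basis_koszul: "a \<le> n \<Longrightarrow> free_basis R (code a) \<in> carrier (koszul n)"
  unfolding koszul_def by (rule free_basis_closed[OF E.ring_axioms]) simp

lemma coords_basis: "coords (free_basis R (code a)) c = (if c = a then tens one4 one4 else 0)"
  by (simp add: coords_def free_basis_def E.coord_one E.coord_zero)

lemma emult_one: "emult q (tens one4 one4) Q = Q" "emult q Q (tens one4 one4) = Q"
  by (intro quad_eqI; simp add: basis4)+

lemma emult_zero: "emult q 0 Q = 0" "emult q Q 0 = 0"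
  by (intro quad_eqI; simp)+

lemma koszul_d_basis:
  assumes a: "a \<le> Suc n"
  shows "koszul_d n (free_basis R (code a)) =
    (case a of 0 \<Rightarrow> \<zero>\<^bsub>koszul n\<^esub> | Suc c \<Rightarrow> E.el (X_coeff q n (n - c)) \<odot>\<^bsub>koszul n\<^esub> free_basis R (code c)) \<oplus>\<^bsub>koszul n\<^esub>
    (if a \<le> n then E.el (Y_coeff q n a) \<odot>\<^bsub>koszul n\<^esub> free_basis R (code a) else \<zero>\<^bsub>koszul n\<^esub>)"
    (is "?l = ?r1 \<oplus>\<^bsub>koszul n\<^esub> ?r2")
proof -
  interpret K: left_module R "koszul n" by (rule left_module_koszul)
  have r1: "?r1 \<in> carrier (koszul n)" using a by (auto simp: basis_koszul K.smult_closed split: nat.split)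
  have r2: "?r2 \<in> carrier (koszul n)" by (auto simp: basis_koszul K.smult_closed)
  have add: "coords (v \<oplus>\<^bsub>koszul n\<^esub> w) c = coords v c + coords w c" if "v \<in> carrier (koszul n)" "w \<in> carrier (koszul n)" for v w c
    using that by (simp add: coords_def koszul_ops koszul_closed E.coord_add)
  have sm: "coords (E.el u \<odot>\<^bsub>koszul n\<^esub> v) c = emult q u (coords v c)" if "v \<in> carrier (koszul n)" for u v c
    using that by (simp add: coords_def koszul_ops koszul_closed E.coord_mult)
  have z: "coords \<zero>\<^bsub>koszul n\<^esub> c = 0" for c by (simp add: coords_def koszul_ops E.coord_zero)
  have "coords ?r1 c = (if a = Suc c then X_coeff q n (n - c) else 0)" if "c \<le> n" for c
    using a by (cases a) (auto simp: z sm basis_koszul coords_basis emult_one emult_zero)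
  moreover have "coords ?r2 c = (if a = c then Y_coeff q n c else 0)" if "c \<le> n" for c
    using that by (auto simp: z sm basis_koszul coords_basis emult_one emult_zero)
  ultimately show ?thesis
    using a by (intro coords_inj[of _ n] koszul_d_closed basis_koszul K.a_closed r1 r2)
      (auto simp: coords_koszul_d basis_koszul add r1 r2 kdiff_def coords_basis emult_one emult_zero)
qed

lemma hom_smult_coord:
  assumes "f \<in> module_hom R (koszul n) (regular_bimodule A)" "u \<in> carrier R" "v \<in> carrier (koszul n)"
  shows "\<Lambda> (f (u \<odot>\<^bsub>koszul n\<^esub> v)) = act (env_coord u) (\<Lambda> (f v))"
  using module_homD[OF assms(1)] assms by (simp add: bimodule_smult bimodule_simps)

lemma val_hom_koszul_d:
  assumes f: "f \<in> module_hom R (koszul n) (regular_bimodule A)" and a: "a \<le> Suc n"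
  shows "\<Lambda> (f (koszul_d n (free_basis R (code a)))) = cdiff n (val f) a"
proof -
  interpret K: left_module R "koszul n" by (rule left_module_koszul)
  note h = module_homD[OF f]
  have z: "\<Lambda> (f \<zero>\<^bsub>koszul n\<^esub>) = 0"
    using module_hom_zero[OF left_module_koszul left_module_bimodule f] by (simp add: bimodule_simps coord_zero)
  have fc: "f v \<in> carrier A" if "v \<in> carrier (koszul n)" for v using h(1)[OF that] by (simp add: bimodule_simps)
  let ?r1 = "case a of 0 \<Rightarrow> \<zero>\<^bsub>koszul n\<^esub> | Suc c \<Rightarrow> E.el (X_coeff q n (n - c)) \<odot>\<^bsub>koszul n\<^esub> free_basis R (code c)"
  let ?r2 = "if a \<le> n then E.el (Y_coeff q n a) \<odot>\<^bsub>koszul n\<^esub> free_basis R (code a) else \<zero>\<^bsub>koszul n\<^esub>"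
  have r1: "?r1 \<in> carrier (koszul n)" using a by (auto simp: basis_koszul K.smult_closed split: nat.split)
  have r2: "?r2 \<in> carrier (koszul n)" by (auto simp: basis_koszul K.smult_closed)
  have 1: "\<Lambda> (f ?r1) = (case a of 0 \<Rightarrow> 0 | Suc c \<Rightarrow> act (X_coeff q n (n - c)) (val f c))"
    using a by (cases a) (simp_all add: z hom_smult_coord[OF f] basis_koszul val_def)
  have 2: "\<Lambda> (f ?r2) = (if a \<le> n then act (Y_coeff q n a) (val f a) else 0)"
    by (simp add: z hom_smult_coord[OF f] basis_koszul val_def)
  have "\<Lambda> (f (?r1 \<oplus>\<^bsub>koszul n\<^esub> ?r2)) = \<Lambda> (f ?r1) + \<Lambda> (f ?r2)"
    unfolding h(2)[OF r1 r2] using fc[OF r1] fc[OF r2] by (simp only: bimodule_simps coord_add)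
  then show ?thesis unfolding koszul_d_basis[OF a] cdiff_def 1 2 .
qed

lemma hom_eq_by_val:
  assumes "f \<in> module_hom R (koszul n) (regular_bimodule A)" "g \<in> module_hom R (koszul n) (regular_bimodule A)"
    and "\<And>a. a \<le> n \<Longrightarrow> val f a = val g a" and v: "v \<in> carrier (koszul n)"
  shows "f v = g v"
proof (rule free_module_hom_eqI[OF left_module_bimodule, where S = "code ` {..n}" and f = f and g = g and v = v])
  show "f \<in> module_hom R (free_module R (code ` {..n})) (regular_bimodule A)"
    "g \<in> module_hom R (free_module R (code ` {..n})) (regular_bimodule A)"
    "v \<in> carrier (free_module R (code ` {..n}))"
    using assms by (simp_all add: koszul_def)
  fix s assume "s \<in> code ` {..n}"
  then obtain a where a: "a \<le> n" "s = code a" by auto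
  have "f (free_basis R s) \<in> carrier A" "g (free_basis R s) \<in> carrier A"
    using module_homD(1)[OF assms(1) basis_koszul[OF a(1)]] module_homD(1)[OF assms(2) basis_koszul[OF a(1)]] a(2)
    by (simp_all add: bimodule_simps)
  then show "f (free_basis R s) = g (free_basis R s)"
    using assms(3)[OF a(1)] coord_inj by (simp add: val_def a(2))
qed

lemma hom_of_val:
  obtains f where "f \<in> module_hom R (koszul n) (regular_bimodule A)" "f \<in> extensional (carrier (koszul n))"
    "\<And>a. a \<le> n \<Longrightarrow> val f a = V a"
proof -
  obtain f where f: "f \<in> module_hom R (free_module R (code ` {..n})) (regular_bimodule A)"
      "\<And>s. s \<in> code ` {..n} \<Longrightarrow> f (free_basis R s) = el (V (length s))"
    using free_module_lift[where R = R and N = "regular_bimodule A" and S = "code ` {..n}" and b = "\<lambda>s. el (V (length s))"]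
      left_module_bimodule by (auto simp: bimodule_simps)
  let ?f = "restrict f (carrier (koszul n))"
  have "?f \<in> module_hom R (koszul n) (regular_bimodule A)"
    using f(1) by (intro module_hom_restrict left_module_koszul) (simp add: koszul_def)
  moreover have "val ?f a = V a" if "a \<le> n" for a
    using that f(2)[of "code a"] by (simp add: val_def basis_koszul)
  ultimately show thesis by (intro that[of ?f]) auto
qed

abbreviation "HC \<equiv> hom_complex R koszul (regular_bimodule A)"
abbreviation "HD \<equiv> hom_diff koszul koszul_d"

lemma cocycle_val:
  assumes "f \<in> module_hom R (koszul n) (regular_bimodule A)" "f \<in> extensional (carrier (koszul n))"
  shows "f \<in> cocycles HC HD n \<longleftrightarrow> (\<forall>a\<le>Suc n. cdiff n (val f) a = 0)"
proof
  assume "f \<in> cocycles HC HD n"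
  then have "f (koszul_d n x) = \<zero>" if "x \<in> carrier (koszul (Suc n))" for x
    using that by (simp add: hom_complex_cocycle bimodule_simps)
  then show "\<forall>a\<le>Suc n. cdiff n (val f) a = 0"
    using val_hom_koszul_d[OF assms(1)] by (metis basis_koszul coord_zero)
next
  assume c: "\<forall>a\<le>Suc n. cdiff n (val f) a = 0"
  have 0: "(\<lambda>x. \<zero>) \<in> module_hom R (koszul (Suc n)) (regular_bimodule A)"
    using B.smult_r_zero by (intro module_homI) (simp_all add: bimodule_simps)
  have "f (koszul_d n x) = \<zero>" if "x \<in> carrier (koszul (Suc n))" for x
    by (rule hom_eq_by_val[OF module_hom_compose[OF koszul_d_hom assms(1)] 0 _ that])
      (use c val_hom_koszul_d[OF assms(1)] in \<open>simp add: val_def coord_zero\<close>)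
  then show "f \<in> cocycles HC HD n" using assms by (simp add: hom_complex_cocycle bimodule_simps)
qed

lemma coboundary_val_Suc:
  assumes "f \<in> module_hom R (koszul (Suc n)) (regular_bimodule A)" "f \<in> extensional (carrier (koszul (Suc n)))"
  shows "f \<in> coboundaries HC HD (Suc n) \<longleftrightarrow> (\<exists>V. \<forall>a\<le>Suc n. val f a = cdiff n V a)"
proof
  assume "f \<in> coboundaries HC HD (Suc n)"
  then obtain g where g: "g \<in> module_hom R (koszul n) (regular_bimodule A)" "f = HD n g"
    by (auto simp: coboundaries_def hom_complex_def Hom_space_carrier)
  then have "val f a = cdiff n (val g) a" if "a \<le> Suc n" for a
    using val_hom_koszul_d[OF g(1) that] basis_koszul[OF that] by (simp add: val_def hom_diff_def)
  then show "\<exists>V. \<forall>a\<le>Suc n. val f a = cdiff n V a" by blast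
next
  assume "\<exists>V. \<forall>a\<le>Suc n. val f a = cdiff n V a"
  then obtain V where V: "\<And>a. a \<le> Suc n \<Longrightarrow> val f a = cdiff n V a" by blast
  obtain g :: "(('a, 'k) gens \<Rightarrow> _) \<Rightarrow> _" where g: "g \<in> module_hom R (koszul n) (regular_bimodule A)" "g \<in> extensional (carrier (koszul n))"
      "\<And>a. a \<le> n \<Longrightarrow> val g a = V a"
    using hom_of_val[of n V] by blast
  \<comment> \<open>\<open>cdiff n\<close> reads its argument only at indices up to n, which is as
    far as the values of g are prescribed.\<close>
  have cd: "cdiff n V a = cdiff n (val g) a" if "a \<le> Suc n" for a
    using that g(3) by (cases a) (auto simp: cdiff_def)
  have "f = HD n g"
  proof (rule extensionalityI[OF assms(2)])
    fix x assume x: "x \<in> carrier (koszul (Suc n))"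
    have "f x = g (koszul_d n x)"
      by (rule hom_eq_by_val[OF assms(1) module_hom_compose[OF koszul_d_hom g(1)] _ x])
        (use V cd val_hom_koszul_d[OF g(1)] in \<open>simp add: val_def[of "\<lambda>x. g (koszul_d n x)"]\<close>)
    then show "f x = HD n g x" using x by (simp add: hom_diff_def)
  qed (simp add: hom_diff_def)
  then show "f \<in> coboundaries HC HD (Suc n)"
    using g by (auto simp: coboundaries_def hom_complex_def Hom_space_carrier)
qed

lemma coboundary_val_0:
  assumes "f \<in> module_hom R (koszul 0) (regular_bimodule A)" "f \<in> extensional (carrier (koszul 0))"
  shows "f \<in> coboundaries HC HD 0 \<longleftrightarrow> val f 0 = 0"
proof
  assume "f \<in> coboundaries HC HD 0"
  then show "val f 0 = 0"
    using basis_koszul[of 0 0] by (simp add: coboundaries_def hom_complex_def Hom_space_ops val_def bimodule_simps coord_zero)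
next
  assume c: "val f 0 = 0"
  have 0: "(\<lambda>x. \<zero>) \<in> module_hom R (koszul 0) (regular_bimodule A)"
    using B.smult_r_zero by (intro module_homI) (simp_all add: bimodule_simps)
  have "f x = \<zero>" if "x \<in> carrier (koszul 0)" for x
    by (rule hom_eq_by_val[OF assms(1) 0 _ that]) (use c in \<open>simp add: val_def coord_zero\<close>)
  then have "f = (\<lambda>x\<in>carrier (koszul 0). \<zero>)"
    using assms(2) by (intro extensionalityI[of _ "carrier (koszul 0)"]) auto
  then show "f \<in> coboundaries HC HD 0"
    by (simp add: coboundaries_def hom_complex_def Hom_space_ops bimodule_simps)
qed

lemma val_add:
  assumes "f \<in> module_hom R (koszul n) (regular_bimodule A)" "g \<in> module_hom R (koszul n) (regular_bimodule A)" "a \<le> n"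
  shows "val (f \<oplus>\<^bsub>HC n\<^esub> g) a = val f a + val g a"
  using module_homD(1)[OF assms(1) basis_koszul[OF assms(3)]] module_homD(1)[OF assms(2) basis_koszul[OF assms(3)]] basis_koszul[OF assms(3)]
  by (simp add: val_def hom_complex_def Hom_space_ops bimodule_simps coord_add)

lemma val_smult:
  assumes "f \<in> module_hom R (koszul n) (regular_bimodule A)" "a \<le> n"
  shows "val (c \<odot>\<^bsub>HC n\<^esub> f) a = lscale c (val f a)"
  using module_homD(1)[OF assms(1) basis_koszul[OF assms(2)]] basis_koszul[OF assms(2)]
  by (simp add: val_def hom_complex_def Hom_space_ops bimodule_simps bimodule_smult E.scalar_closed
    E.coord_smult E.coord_one act_scale act_tens)

text \<open>The two coefficients act as twisted commutators with x and y and so raise the bidegree: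
  1 goes to x and y, and these go to y x. Exactness of the blocks is decided by which of these
  scalars vanish.\<close>

lemma cdiff_sel:
  assumes "a \<le> Suc n"
  shows "c1 (cdiff n V a) = 0"
    "cx (cdiff n V a) = (case a of 0 \<Rightarrow> 0 | Suc c \<Rightarrow> (1 + (-1) ^ Suc n * q ^ (n - c)) * c1 (V c))"
    "cy (cdiff n V a) = (if a \<le> n then (q ^ a + (-1) ^ Suc n) * c1 (V a) else 0)"
    "cz (cdiff n V a) = (case a of 0 \<Rightarrow> 0 | Suc c \<Rightarrow> ((-1) ^ Suc n * q ^ (n - c) - q) * cy (V c)) +
      (if a \<le> n then (q ^ a - (-1) ^ Suc n * q) * cx (V a) else 0)"
  by (cases a; simp add: cdiff_def act_def X_coeff_def Y_coeff_def basis4 algebra_simps)+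

end

section \<open>The cohomology of the Hom complex\<close>

text \<open>Put n = u + v. The scalars leaving 1 at f u v are 1 - (-1)^n q^v and q^u - (-1)^n, and
  those entering y x at f (u+1) (v+1) are the same up to sign and a factor q. So this is the
  condition that all four vanish.\<close>

definition good :: "'k::field \<Rightarrow> nat \<Rightarrow> nat \<Rightarrow> bool" where
  "good q u v \<longleftrightarrow> q ^ u = (-1) ^ (u + v) \<and> q ^ v = (-1) ^ (u + v)"

text \<open>The condition that the scalars 1 - (-1)^(n+1) q and (-1)^(n+1) - q of the two edges
  starting in degree n vanish.\<close>

definition edge :: "'k::field \<Rightarrow> nat \<Rightarrow> bool" where
  "edge q n \<longleftrightarrow> q = (-1) ^ Suc n"

text \<open>
  The Hom complex is a direct sum of small complexes: for each \<open>u, v \<ge> 0\<close> a square spanned by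
  \<open>1\<close> at \<open>f u v\<close>, \<open>x\<close> at \<open>f (u+1) v\<close>, \<open>y\<close> at \<open>f u (v+1)\<close> and \<open>y x\<close> at \<open>f (u+1) (v+1)\<close>; edges spanned by
  \<open>x\<close> at \<open>f 0 v\<close> and \<open>y x\<close> at \<open>f 0 (v+1)\<close>, and symmetrically for \<open>y\<close>; and \<open>y x\<close> at \<open>f 0 0\<close>. A square is exact
  unless \<open>good q u v\<close>, when its differential is zero, and an edge starting in degree \<open>n\<close> is exact
  unless \<open>edge q n\<close>. Below, \<open>(c, a)\<close> is the \<open>c\<close>-th basis element at \<open>f a (n - a)\<close>.
\<close>

definition good_index :: "'k::field \<Rightarrow> nat \<Rightarrow> (nat \<times> nat) set" where
  "good_index q n = {(c, a). a \<le> n \<and>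
    (c = 0 \<and> good q a (n - a) \<or>
     c = 1 \<and> (case a of 0 \<Rightarrow> edge q n | Suc u \<Rightarrow> good q u (n - Suc u)) \<or>
     c = 2 \<and> (if a = n then edge q n else good q a (n - Suc a)) \<or>
     c = 3 \<and> (n = 0 \<or> (if a = 0 \<or> a = n then edge q (n - 1) else good q (a - 1) (n - Suc a))))}"

definition quad_coeff :: "nat \<Rightarrow> 'k quad \<Rightarrow> 'k" where
  "quad_coeff c v = (if c = 0 then c1 v else if c = 1 then cx v else if c = 2 then cy v else cz v)"

lemma sign_sq: "(-1) ^ n * (-1) ^ n = (1 :: 'a::field)" "(-1) ^ n * ((-1) ^ n * x) = (x :: 'a)"
  by (simp_all flip: power_add mult.assoc)

context coordinate_lambda
begin

text \<open>An indexed coordinate belongs to a block with zero differential, so nothing maps onto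
  it. Hence these coordinates vanish on coboundaries.\<close>

lemma cdiff_good_zero:
  assumes "(c, a) \<in> good_index q (Suc m)"
  shows "quad_coeff c (cdiff m V a) = 0"
proof -
  have a: "a \<le> Suc m" using assms by (auto simp: good_index_def)
  from assms consider "c = 0" | "c = 1" "case a of 0 \<Rightarrow> edge q (Suc m) | Suc u \<Rightarrow> good q u (Suc m - Suc u)"
    | "c = 2" "if a = Suc m then edge q (Suc m) else good q a (Suc m - Suc a)"
    | "c = 3" "if a = 0 \<or> a = Suc m then edge q (Suc m - 1) else good q (a - 1) (Suc m - Suc a)"
    by (auto simp: good_index_def)
  then show ?thesis
  proof cases
    case 1
    then show ?thesis by (simp add: quad_coeff_def cdiff_sel a)
  next
    case 2
    then show ?thesis using a
      by (cases a) (auto simp: quad_coeff_def cdiff_sel good_def sign_sq)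
  next
    case 3
    then show ?thesis using a
      by (auto simp: quad_coeff_def cdiff_sel good_def split: if_splits)
  next
    case 4
    consider "a = 0" | "a = Suc m" | u d where "a = Suc u" "m = Suc (u + d)"
      using a by (cases a) (auto simp: le_less dest!: less_imp_Suc_add)
    then show ?thesis
    proof cases
      case 1
      then have e: "q = (-1) ^ Suc m" using 4 by (simp add: edge_def)
      have "quad_coeff c (cdiff m V a) = (1 - (-1) ^ Suc m * q) * cx (V 0)" using 4 1 by (simp add: quad_coeff_def cdiff_sel)
      also have "\<dots> = 0" using e by (simp add: sign_sq)
      finally show ?thesis .
    next
      case 2
      then have e: "q = (-1) ^ Suc m" using 4 by (simp add: edge_def)
      have "quad_coeff c (cdiff m V a) = ((-1) ^ Suc m - q) * cy (V m)" using 4 2 by (simp add: quad_coeff_def cdiff_sel)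
      also have "\<dots> = 0" using e by simp
      finally show ?thesis .
    next
      case 3
      then have "q ^ u = (-1) ^ (u + d)" "q ^ d = (-1) ^ (u + d)" using 4 by (simp_all add: good_def)
      then show ?thesis using 4 3 by (simp add: quad_coeff_def cdiff_sel Suc_diff_le mult.left_commute sign_sq)
    qed
  qed
qed

text \<open>Values at the indexed coordinates, extended by 0, form a cocycle because nothing nonzero
  leaves a block with zero differential.\<close>

lemma good_cocycle_exists:
  "\<exists>V. (\<forall>a\<le>Suc n. cdiff n V a = 0) \<and> (\<forall>(c, a)\<in>good_index q n. quad_coeff c (V a) = t (c, a))"
proof -
  define V where "V a = Quad (if (0, a) \<in> good_index q n then t (0, a) else 0) (if (1, a) \<in> good_index q n then t (1, a) else 0)
    (if (2, a) \<in> good_index q n then t (2, a) else 0) (if (3, a) \<in> good_index q n then t (3, a) else 0)" for a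
  have c: "quad_coeff c (V a) = t (c, a)" if "(c, a) \<in> good_index q n" for c a
  proof -
    have "c \<in> {0, 1, 2, 3}" using that by (auto simp: good_index_def)
    then show ?thesis using that by (auto simp: quad_coeff_def V_def)
  qed
  have "cdiff n V a = 0" if a: "a \<le> Suc n" for a
  proof (rule quad_eqI)
    show "c1 (cdiff n V a) = c1 0" using a by (simp add: cdiff_sel)
    show "cx (cdiff n V a) = cx 0"
    proof (cases a)
      case (Suc u)
      then obtain d where n: "n = u + d" using a le_Suc_ex by auto
      show ?thesis by (simp add: cdiff_sel a) (auto simp: Suc n V_def good_index_def good_def sign_sq)
    qed (simp add: cdiff_sel a)
    show "cy (cdiff n V a) = cy 0"
      by (simp add: cdiff_sel a) (auto simp: V_def good_index_def good_def)
    have x: "(q ^ a - (-1) ^ Suc n * q) * cx (V a) = 0" if "a \<le> n"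
    proof (cases a)
      case 0
      then show ?thesis by (auto simp: V_def good_index_def edge_def sign_sq)
    next
      case (Suc u)
      then obtain d where n: "n = Suc (u + d)" using \<open>a \<le> n\<close> by (auto dest!: le_Suc_ex)
      show ?thesis by (auto simp: Suc n V_def good_index_def good_def)
    qed
    have y: "((-1) ^ Suc n * q ^ (n - u) - q) * cy (V u) = 0" if "u \<le> n" for u
    proof (cases "u = n")
      case True
      then show ?thesis by (auto simp: V_def good_index_def edge_def)
    next
      case False
      then obtain d where n: "n = Suc (u + d)" using \<open>u \<le> n\<close> by (metis le_neq_implies_less less_imp_Suc_add)
      show ?thesis by (auto simp: n V_def good_index_def good_def Suc_diff_le mult.left_commute sign_sq)
    qed
    show "cz (cdiff n V a) = cz 0"
    proof (cases a)
      case 0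
      then show ?thesis using x by (simp add: cdiff_sel)
    next
      case (Suc u)
      then have "u \<le> n" using a by simp
      then show ?thesis using x unfolding cdiff_sel(4)[OF a] by (simp only: Suc nat.case y) (simp add: Suc)
    qed
  qed
  then show ?thesis using c by (intro exI[of _ V]) auto
qed

text \<open>At 1 and at the start of an edge, a nonzero outgoing scalar forces the coordinate to
  vanish. In the middle of a square the cocycle condition makes (x, y) a multiple p of the image of
  1; for this the factor q between the two maps of the square has to be cancelled.\<close>

lemma cocycle_zero_of_good:
  assumes q: "q \<noteq> 0" and coc: "\<And>a. a \<le> Suc n \<Longrightarrow> cdiff n V a = 0"
    and z: "\<And>c a. (c, a) \<in> good_index q n \<Longrightarrow> quad_coeff c (V a) = 0"
  shows "a \<le> n \<Longrightarrow> c1 (V a) = 0" "cx (V 0) = 0" "cy (V n) = 0"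
    "a < n \<Longrightarrow> \<exists>p. cx (V (Suc a)) = (1 + (-1) ^ n * q ^ (n - Suc a)) * p \<and> cy (V a) = (q ^ a + (-1) ^ n) * p"
proof -
  define s :: 'k where "s = (-1) ^ n"
  have ss: "s * s = 1" by (simp add: s_def sign_sq)
  show "c1 (V a) = 0" if a: "a \<le> n"
  proof (cases "good q a (n - a)")
    case True
    then show ?thesis using z[of 0 a] a by (simp add: good_index_def quad_coeff_def)
  next
    case False
    have "(1 - s * q ^ (n - a)) * c1 (V a) = 0"
      using arg_cong[OF coc[of "Suc a"], of cx] a by (simp add: cdiff_sel s_def)
    moreover have "(q ^ a - s) * c1 (V a) = 0"
      using arg_cong[OF coc[of a], of cy] a by (simp add: cdiff_sel s_def)
    moreover have "q ^ a \<noteq> s \<or> q ^ (n - a) \<noteq> s" using False a by (auto simp: good_def s_def)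
    moreover have "1 - s * q ^ (n - a) = 0 \<Longrightarrow> q ^ (n - a) = s"
      using ss by (metis eq_iff_diff_eq_0 mult.left_neutral mult.right_neutral mult.assoc)
    ultimately show ?thesis by auto
  qed
  show "cx (V 0) = 0"
  proof (cases "edge q n")
    case True
    then show ?thesis using z[of 1 0] by (simp add: good_index_def quad_coeff_def)
  next
    case False
    have "(1 + s * q) * cx (V 0) = 0"
      using arg_cong[OF coc[of 0], of cz] by (simp add: cdiff_sel s_def)
    moreover have "1 + s * q \<noteq> 0"
    proof
      assume "1 + s * q = 0"
      then have "s * (1 + s * q) = 0" by simp
      then have "q = - s" using ss by (simp add: distrib_left add_eq_0_iff flip: mult.assoc)
      then show False using False by (simp add: edge_def s_def)
    qed
    ultimately show ?thesis by simp
  qed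
  show "cy (V n) = 0"
  proof (cases "edge q n")
    case True
    then show ?thesis using z[of 2 n] by (simp add: good_index_def quad_coeff_def)
  next
    case False
    have "(- s - q) * cy (V n) = 0"
      using arg_cong[OF coc[of "Suc n"], of cz] by (simp add: cdiff_sel s_def)
    moreover have "- s - q \<noteq> 0" using False by (auto simp: edge_def s_def)
    ultimately show ?thesis by simp
  qed
  show "\<exists>p. cx (V (Suc a)) = (1 + (-1) ^ n * q ^ (n - Suc a)) * p \<and> cy (V a) = (q ^ a + (-1) ^ n) * p" if a: "a < n"
  proof -
    obtain d where n: "n = Suc (a + d)" using a less_imp_Suc_add by blast
    have nd: "n - a = Suc d" "n - Suc a = d" by (simp_all add: n)
    let ?x = "cx (V (Suc a))" and ?y = "cy (V a)"
    let ?A = "1 + s * q ^ d" and ?B = "q ^ a + s"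
    have "(- s * q ^ Suc d - q) * ?y + (q ^ Suc a + s * q) * ?x = 0"
      using arg_cong[OF coc[of "Suc a"], of cz] a by (simp add: cdiff_sel s_def nd del: power_Suc)
    then have "q * (?B * ?x - ?A * ?y) = 0" by (simp add: algebra_simps)
    then have rel: "?B * ?x = ?A * ?y" using q by simp
    \<comment> \<open>p is obtained by dividing by a nonzero scalar. If both are zero the square is
      good, its coordinates x and y are indexed, hence 0, and p = 0 works.\<close>
    consider "?A \<noteq> 0" | "?A = 0" "?B \<noteq> 0" | "?A = 0" "?B = 0" by blast
    then have "\<exists>p. ?x = ?A * p \<and> ?y = ?B * p"
    proof cases
      case 1
      then show ?thesis using rel by (intro exI[of _ "?x / ?A"]) (simp add: field_simps)
    next
      case 2
      then show ?thesis using rel by (intro exI[of _ "?y / ?B"]) simp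
    next
      case 3
      have "s * ?A = 0" using 3 by simp
      then have "q ^ d = - s" using ss by (simp add: distrib_left add_eq_0_iff flip: mult.assoc)
      moreover have "q ^ a = - s" using 3 by (simp add: add_eq_0_iff2)
      moreover have "- s = (-1) ^ (a + d)" by (simp add: s_def n)
      ultimately have "good q a d" by (simp add: good_def)
      then have "(1, Suc a) \<in> good_index q n" "(2, a) \<in> good_index q n" by (simp_all add: good_index_def n)
      then show ?thesis using z[of 1 "Suc a"] z[of 2 a] by (intro exI[of _ 0]) (simp add: quad_coeff_def)
    qed
    then show ?thesis by (simp add: nd s_def)
  qed
qed

text \<open>The multiples p found above are the components of a preimage at 1. It remains to hit
  each y x by components at x and y, one of whose scalars is nonzero whenever y x is not
  indexed.\<close>

lemma good_zero_coboundary: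
  assumes q: "q \<noteq> 0" and coc: "\<And>a. a \<le> Suc (Suc m) \<Longrightarrow> cdiff (Suc m) V a = 0"
    and z: "\<And>c a. (c, a) \<in> good_index q (Suc m) \<Longrightarrow> quad_coeff c (V a) = 0"
  shows "\<exists>W. \<forall>a\<le>Suc m. V a = cdiff m W a"
proof -
  note zero = cocycle_zero_of_good[where n = "Suc m" and V = V, OF q coc z]
  have V1: "c1 (V a) = 0" if "a \<le> Suc m" for a by (rule zero(1)) (use that in simp_all)
  have V2: "cx (V 0) = 0" by (rule zero(2))
  have V3: "cy (V (Suc m)) = 0" by (rule zero(3))
  have V4: "\<exists>p. cx (V (Suc a)) = (1 + (-1) ^ Suc m * q ^ (Suc m - Suc a)) * p \<and> cy (V a) = (q ^ a + (-1) ^ Suc m) * p"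
    if "a < Suc m" for a
    by (rule zero(4)) (use that in simp_all)
  define s :: 'k where "s = (-1) ^ Suc m"
  have ss: "s * s = 1" "\<And>t. s * (s * t) = t" by (simp_all add: s_def sign_sq)
  have "\<forall>a. \<exists>p. a < Suc m \<longrightarrow> cx (V (Suc a)) = (1 + s * q ^ (m - a)) * p \<and> cy (V a) = (q ^ a + s) * p"
    using V4 by (auto simp: s_def)
  then obtain p where p: "\<And>a. a < Suc m \<Longrightarrow> cx (V (Suc a)) = (1 + s * q ^ (m - a)) * p a \<and> cy (V a) = (q ^ a + s) * p a"
    by metis
  \<comment> \<open>\<open>\<beta> a\<close> and \<open>\<alpha> c\<close> are the scalars with
    which x at f a (m-a) and y at f c (m-c) map to y x.\<close>
  define \<beta> where "\<beta> a = q ^ a - s * q" for a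
  define \<alpha> where "\<alpha> c = s * q ^ (m - c) - q" for c
  \<comment> \<open>y x at f a (m+1-a) can be reached from x at index a and from y at index a-1. The
    second way is used only where the first is closed, so that the value is not hit twice.\<close>
  define X' where "X' a = (if a \<le> m \<and> \<beta> a \<noteq> 0 then cz (V a) / \<beta> a else 0)" for a
  define Y' where "Y' c = (if (Suc c \<le> m \<and> \<beta> (Suc c) \<noteq> 0) \<or> \<alpha> c = 0 then 0 else cz (V (Suc c)) / \<alpha> c)" for c
  define W where "W a = Quad (p a) (X' a) (Y' a) 0" for a
  have "V a = cdiff m W a" if a: "a \<le> Suc m" for a
  proof (rule quad_eqI)
    show "c1 (V a) = c1 (cdiff m W a)" using V1[OF a] by (simp add: cdiff_sel a)
    show "cx (V a) = cx (cdiff m W a)"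
      using V2 p a by (cases a) (simp_all add: cdiff_sel W_def s_def)
    show "cy (V a) = cy (cdiff m W a)"
    proof (cases "a = Suc m")
      case True
      then show ?thesis using V3 by (simp add: cdiff_sel)
    next
      case False
      then show ?thesis using p[of a] a by (simp add: cdiff_sel W_def s_def)
    qed
    have zz: "cz (V a) = 0" if "(3, a) \<in> good_index q (Suc m)" using z[OF that] by (simp add: quad_coeff_def)
    have "cz (cdiff m W a) = (case a of 0 \<Rightarrow> 0 | Suc c \<Rightarrow> \<alpha> c * Y' c) + (if a \<le> m then \<beta> a * X' a else 0)"
      unfolding cdiff_sel(4)[OF a] by (simp add: W_def \<alpha>_def \<beta>_def s_def split: nat.split)
    also have "\<dots> = cz (V a)"
    proof (cases "a \<le> m \<and> \<beta> a \<noteq> 0")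
      case True
      then show ?thesis by (cases a) (simp_all add: X'_def Y'_def)
    next
      case no_\<beta>: False
      then have X0: "(if a \<le> m then \<beta> a * X' a else 0) = 0" by (simp add: X'_def)
      show ?thesis
      proof (cases a)
        case 0
        then have "1 = s * q" using no_\<beta> by (simp add: \<beta>_def)
        then have "s * 1 = s * (s * q)" by simp
        then have "edge q m" using ss by (simp add: edge_def s_def)
        then have "(3, a) \<in> good_index q (Suc m)" by (simp add: good_index_def 0)
        then show ?thesis using zz X0 by (simp add: 0)
      next
        case (Suc c)
        show ?thesis
        proof (cases "\<alpha> c = 0")
          case False
          then show ?thesis using X0 no_\<beta> by (auto simp: Suc Y'_def)
        next
          case True
          have "(3, a) \<in> good_index q (Suc m)"
          proof (cases "a = Suc m")
            case a: True
            then have "edge q m" using True by (simp add: Suc \<alpha>_def edge_def s_def)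
            then show ?thesis by (simp add: good_index_def a)
          next
            case False
            then obtain d where m: "m = Suc (c + d)" using a Suc less_imp_Suc_add[of c m] by auto
            have b: "\<beta> (Suc c) = 0" using no_\<beta> by (simp add: Suc m)
            have "q * (q ^ c - s) = 0" using b by (simp add: \<beta>_def algebra_simps)
            then have 1: "q ^ c = s" using q by simp
            have "m - c = Suc d" by (simp add: m)
            then have "q * (s * q ^ d - 1) = 0" using True by (simp add: \<alpha>_def algebra_simps)
            then have "s * q ^ d = 1" using q by simp
            then have "s * (s * q ^ d) = s" by simp
            then have 2: "q ^ d = s" using ss by simp
            have "s = (-1) ^ (c + d)" by (simp add: s_def m)
            then have "good q c d" using 1 2 by (simp add: good_def)
            then show ?thesis by (simp add: good_index_def Suc m)
          qed
          then show ?thesis using zz X0 True by (simp add: Suc)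
        qed
      qed
    qed
    finally show "cz (V a) = cz (cdiff m W a)" by simp
  qed
  then show ?thesis by blast
qed

lemma koszul_coordinates:
  assumes q: "q \<noteq> 0"
  shows "cohomology_coordinates HC HD n (good_index q n) (\<lambda>f (c, a). quad_coeff c (val f a))"
  unfolding cohomology_coordinates_def
proof (intro conjI allI ballI)
  have le: "a \<le> n" if "(c, a) \<in> good_index q n" for c a using that by (auto simp: good_index_def)
  have cc: "f \<in> module_hom R (koszul n) (regular_bimodule A)" "f \<in> extensional (carrier (koszul n))" if "f \<in> cocycles HC HD n" for f
    using that by (auto simp: hom_complex_cocycle)
  fix i assume i: "i \<in> good_index q n"
  obtain c a where ca: "i = (c, a)" by (cases i)
  then have a: "a \<le> n" using le i by simp
  fix f assume f: "f \<in> cocycles HC HD n"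
  show "(case i of (c, a) \<Rightarrow> quad_coeff c (val (k \<odot>\<^bsub>HC n\<^esub> f) a)) = k * (case i of (c, a) \<Rightarrow> quad_coeff c (val f a))" for k
    using val_smult[OF cc(1)[OF f] a, of k] by (simp add: ca quad_coeff_def)
  fix g assume g: "g \<in> cocycles HC HD n"
  show "(case i of (c, a) \<Rightarrow> quad_coeff c (val (f \<oplus>\<^bsub>HC n\<^esub> g) a)) =
      (case i of (c, a) \<Rightarrow> quad_coeff c (val f a)) + (case i of (c, a) \<Rightarrow> quad_coeff c (val g a))"
    using val_add[OF cc(1)[OF f] cc(1)[OF g] a] by (simp add: ca quad_coeff_def)
next
  fix f assume f: "f \<in> cocycles HC HD n"
  then have fh: "f \<in> module_hom R (koszul n) (regular_bimodule A)" and fe: "f \<in> extensional (carrier (koszul n))"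
    by (auto simp: hom_complex_cocycle)
  have coc: "\<And>a. a \<le> Suc n \<Longrightarrow> cdiff n (val f) a = 0" using f cocycle_val[OF fh fe] by simp
  show "f \<in> coboundaries HC HD n \<longleftrightarrow> (\<forall>i\<in>good_index q n. (case i of (c, a) \<Rightarrow> quad_coeff c (val f a)) = 0)"
  proof (cases n)
    case 0
    have "val f 0 = 0" if z: "\<And>c a. (c, a) \<in> good_index q 0 \<Longrightarrow> quad_coeff c (val f a) = 0"
    proof (rule quad_eqI)
      note V = cocycle_zero_of_good[where n = 0 and V = "val f", OF q coc[unfolded 0] z]
      show "c1 (val f 0) = c1 0" "cx (val f 0) = cx 0" "cy (val f 0) = cy 0" using V by simp_all
      \<comment> \<open>Nothing maps into degree 0, so y x at f 0 0 always survives; it is the index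
        (3, 0) that \<open>good_index\<close> contains for n = 0.\<close>
      show "cz (val f 0) = cz 0" using z[of 3 0] by (simp add: good_index_def quad_coeff_def)
    qed
    moreover have "quad_coeff c (val f a) = 0" if "val f 0 = 0" "(c, a) \<in> good_index q 0" for c a
      using that by (auto simp: good_index_def quad_coeff_def)
    moreover have "(\<forall>i\<in>good_index q 0. (case i of (c, a) \<Rightarrow> quad_coeff c (val f a)) = 0) \<longleftrightarrow>
        (\<forall>c a. (c, a) \<in> good_index q 0 \<longrightarrow> quad_coeff c (val f a) = 0)" by auto
    ultimately show ?thesis
      using coboundary_val_0[OF fh[unfolded 0] fe[unfolded 0]] unfolding 0 by blast
  next
    case (Suc m)
    have le: "a \<le> Suc m" if "(c, a) \<in> good_index q (Suc m)" for c a using that by (auto simp: good_index_def)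
    show ?thesis
    proof
      assume "f \<in> coboundaries HC HD n"
      then obtain V where "\<forall>a\<le>Suc m. val f a = cdiff m V a"
        using coboundary_val_Suc[OF fh[unfolded Suc] fe[unfolded Suc]] unfolding Suc by blast
      then show "\<forall>i\<in>good_index q n. (case i of (c, a) \<Rightarrow> quad_coeff c (val f a)) = 0"
        unfolding Suc using le cdiff_good_zero by auto
    next
      assume "\<forall>i\<in>good_index q n. (case i of (c, a) \<Rightarrow> quad_coeff c (val f a)) = 0"
      then have "quad_coeff c (val f a) = 0" if "(c, a) \<in> good_index q (Suc m)" for c a
        using that unfolding Suc by auto
      from good_zero_coboundary[where m = m and V = "val f", OF q coc[unfolded Suc] this]
      show "f \<in> coboundaries HC HD n"
        using coboundary_val_Suc[OF fh[unfolded Suc] fe[unfolded Suc]] unfolding Suc by simp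
    qed
  qed
next
  fix t
  obtain V where V: "\<forall>a\<le>Suc n. cdiff n V a = 0" "\<forall>(c, a)\<in>good_index q n. quad_coeff c (V a) = t (c, a)"
    using good_cocycle_exists by blast
  obtain f :: "(('a, 'k) gens \<Rightarrow> _) \<Rightarrow> _" where f: "f \<in> module_hom R (koszul n) (regular_bimodule A)" "f \<in> extensional (carrier (koszul n))"
      "\<And>a. a \<le> n \<Longrightarrow> val f a = V a"
    using hom_of_val[of n V] by blast
  have "cdiff n (val f) a = cdiff n V a" if "a \<le> Suc n" for a
    using that f(3) by (cases a) (auto simp: cdiff_def)
  then have "f \<in> cocycles HC HD n" using V(1) cocycle_val[OF f(1,2)] by simp
  moreover have "\<forall>i\<in>good_index q n. (case i of (c, a) \<Rightarrow> quad_coeff c (val f a)) = t i"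
    using V(2) f(3) by (auto simp: good_index_def)
  ultimately show "\<exists>f\<in>cocycles HC HD n. \<forall>i\<in>good_index q n. (case i of (c, a) \<Rightarrow> quad_coeff c (val f a)) = t i" by blast
qed

lemma HH_dim_coordinates:
  assumes "q \<noteq> 0"
  shows "vectorspace.fin_dim class_ring (HH A n) \<and> vectorspace.dim class_ring (HH A n) = card (good_index q n)"
  unfolding HH_def
proof (rule Ext_dim[OF scalar_algebra_enveloping left_module_bimodule left_module_bimodule _ projective_resolution_koszul
      koszul_coordinates[OF assms]])
  show "finite (good_index q n)"
    by (rule finite_subset[of _ "{0, 1, 2, 3} \<times> {..n}"]) (auto simp: good_index_def)
qed

end

lemma HH_Lambda_dim:
  assumes "q \<noteq> 0"
  shows "vectorspace.fin_dim class_ring (HH (Lambda q) n)"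
    "vectorspace.dim class_ring (HH (Lambda q) n) = card (good_index q n)"
proof -
  interpret coordinate_lambda "Lambda q" q "lambda_coord q"
    by (intro coordinate_lambda.intro coordinate_Lambda)
  show "vectorspace.fin_dim class_ring (HH (Lambda q) n)"
    "vectorspace.dim class_ring (HH (Lambda q) n) = card (good_index q n)"
    using HH_dim_coordinates[OF assms, of n] by simp_all
qed

section \<open>The Hilbert series\<close>

definition good_count :: "'k::field \<Rightarrow> nat \<Rightarrow> nat" where
  "good_count q n = card {a. a \<le> n \<and> good q a (n - a)}"

definition edge_count :: "'k::field \<Rightarrow> nat \<Rightarrow> nat" where
  "edge_count q n = (if edge q n then 1 else 0)"

text \<open>A good square with 1 in degree n has x and y in degree n + 1 and y x in degree n + 2;
  two edges starting in degree n end in degree n + 1. The case distinctions keep truncated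
  subtraction from counting blocks of negative degree.\<close>

lemma card_good_index:
  "card (good_index q n) = good_count q n + 2 * (edge_count q n + (if n = 0 then 0 else good_count q (n - 1))) +
    (if n = 0 then 1 else 2 * edge_count q (n - 1) + (if n = 1 then 0 else good_count q (n - 2)))"
proof -
  define S where "S m = {a. a \<le> m \<and> good q a (m - a)}" for m
  define T where "T c = {a. (c, a) \<in> good_index q n}" for c
  have cS: "card (S m) = good_count q m" for m by (simp add: S_def good_count_def)
  have fS: "finite (S m)" for m unfolding S_def by simp
  have fT: "finite (T c)" for c
    by (rule finite_subset[of _ "{..n}"]) (auto simp: T_def good_index_def)
  have "good_index q n = Sigma {0, 1, 2, 3} T"
    unfolding T_def good_index_def by blast
  then have "card (good_index q n) = (\<Sum>c\<in>{0, 1, 2, 3}. card (T c))"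
    by (simp only: card_SigmaI finite.intros fT ball_simps simp_thms)
  also have "\<dots> = card (T 0) + (card (T 1) + (card (T 2) + card (T 3)))"
    by simp
  also have "card (T 0) = good_count q n"
    by (simp add: T_def good_index_def good_count_def)
  also have "card (T 1) = edge_count q n + (if n = 0 then 0 else good_count q (n - 1))"
  proof -
    have "a \<in> T 1 \<longleftrightarrow> a \<in> (if edge q n then {0} else {}) \<union> (if n = 0 then {} else Suc ` S (n - 1))" for a
    proof (cases a)
      case (Suc u)
      then show ?thesis by (cases n) (auto simp: T_def good_index_def S_def)
    qed (auto simp: T_def good_index_def)
    then have "T 1 = (if edge q n then {0} else {}) \<union> (if n = 0 then {} else Suc ` S (n - 1))" by blast
    then show ?thesis
      by (simp add: edge_count_def cS card_image fS)
  qed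
  also have "card (T 2) = edge_count q n + (if n = 0 then 0 else good_count q (n - 1))"
  proof -
    have "T 2 = (if edge q n then {n} else {}) \<union> (if n = 0 then {} else S (n - 1))"
      by (auto simp: T_def good_index_def S_def split: if_splits)
    moreover have "n \<noteq> 0 \<Longrightarrow> n \<notin> S (n - 1)" by (auto simp: S_def)
    ultimately show ?thesis
      by (simp add: edge_count_def cS fS)
  qed
  also have "card (T 3) = (if n = 0 then 1 else 2 * edge_count q (n - 1) + (if n = 1 then 0 else good_count q (n - 2)))"
  proof -
    consider "n = 0" | "n = 1" | m where "n = Suc (Suc m)" by (metis One_nat_def not0_implies_Suc)
    then show ?thesis
    proof cases
      case 1
      then have "T 3 = {0}" by (auto simp: T_def good_index_def)
      then show ?thesis using 1 by simp
    next
      case 2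
      then have "T 3 = (if edge q 0 then {0, 1} else {})" by (auto simp: T_def good_index_def)
      then show ?thesis using 2 by (simp add: edge_count_def)
    next
      case 3
      have "a \<in> T 3 \<longleftrightarrow> a \<in> (if edge q (Suc m) then {0, n} else {}) \<union> Suc ` S m" for a
        by (cases a) (auto simp: T_def good_index_def S_def 3 Suc_le_eq image_iff)
      then have "T 3 = (if edge q (Suc m) then {0, n} else {}) \<union> Suc ` S m" by blast
      moreover have "n \<notin> Suc ` S m" "0 \<notin> Suc ` S m" by (auto simp: 3 S_def)
      ultimately show ?thesis
        by (simp add: 3 edge_count_def cS card_image fS)
    qed
  qed
  finally show ?thesis by simp
qed

definition good_series :: "'k::field \<Rightarrow> rat fps" where "good_series q = Abs_fps (\<lambda>n. of_nat (good_count q n))"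
definition edge_series :: "'k::field \<Rightarrow> rat fps" where "edge_series q = Abs_fps (\<lambda>n. of_nat (edge_count q n))"

text \<open>The factor (1 + t)^2 lists the four corners of a square by degree, the two factors 1 + t
  the ends of the two edges, and the summand 1 is y x in degree 0.\<close>

lemma hilbert_series_HH_Lambda:
  assumes "q \<noteq> 0"
  shows "hilbert_series (HH (Lambda q)) =
    1 + (1 + fps_X) ^ 2 * good_series q + ((1 + fps_X) * edge_series q + (1 + fps_X) * edge_series q)"
proof -
  let ?G = "good_series q" and ?E = "edge_series q"
  have "hilbert_series (HH (Lambda q)) = 1 + (?G + (fps_X * ?G + fps_X * ?G) + fps_X * (fps_X * ?G)) +
      (?E + ?E + (fps_X * ?E + fps_X * ?E))"
  proof (rule fps_ext)
    fix n
    have two: "fps_nth (2 * H) n = 2 * fps_nth H n" for H :: "rat fps"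
      by (simp only: mult_2 fps_add_nth)
    have "n = 0 \<or> n = 1 \<or> (\<exists>m. n = Suc (Suc m))" by (metis One_nat_def not0_implies_Suc)
    then show "fps_nth (hilbert_series (HH (Lambda q))) n = fps_nth (1 + (?G + (fps_X * ?G + fps_X * ?G) + fps_X * (fps_X * ?G)) +
      (?E + ?E + (fps_X * ?E + fps_X * ?E))) n"
      by (auto simp: hilbert_series_def HH_Lambda_dim(2)[OF assms] card_good_index good_series_def edge_series_def two)
  qed
  also have "\<dots> = 1 + (1 + fps_X) ^ 2 * ?G + ((1 + fps_X) * ?E + (1 + fps_X) * ?E)"
    by (simp add: power2_eq_square algebra_simps)
  finally show ?thesis .
qed

section \<open>Generating functions of the counts\<close>

definition multiples :: "nat \<Rightarrow> rat fps" where "multiples d = Abs_fps (\<lambda>n. if d dvd n then 1 else 0)"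

lemma multiples_eq: "d > 0 \<Longrightarrow> (1 - fps_X ^ d) * multiples d = 1"
proof (rule fps_ext)
  fix n assume d: "d > 0"
  have "fps_nth ((1 - fps_X ^ d) * multiples d) n = (if d dvd n then 1 else 0) - (if n < d then 0 else if d dvd n - d then 1 else 0)"
    by (simp add: left_diff_distrib fps_X_power_mult_nth multiples_def)
  also have "\<dots> = fps_nth (1 :: rat fps) n"
    using d by (auto simp: dvd_minus_self nat_dvd_not_less)
  finally show "fps_nth ((1 - fps_X ^ d) * multiples d) n = fps_nth (1 :: rat fps) n" .
qed

lemma right_inverse_unique:
  fixes Q F H :: "'a::comm_monoid_mult"
  assumes "Q * F = 1" "Q * H = 1"
  shows "F = H"
proof -
  have "F = (Q * H) * F" using assms(2) by simp
  also have "\<dots> = (Q * F) * H" by (simp only: mult_ac)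
  finally show ?thesis using assms(1) by simp
qed

text \<open>Replaces the quotients of the theorem by products with an inverse series, so that the
  final computations stay in a commutative ring.\<close>

lemma fps_divide_square:
  fixes P Q F :: "rat fps"
  assumes "Q * F = 1"
  shows "P / Q ^ 2 = P * F ^ 2"
proof -
  have "Q ^ 2 * F ^ 2 = 1" using assms by (simp flip: power_mult_distrib)
  then have P: "P = P * F ^ 2 * Q ^ 2" by (simp add: mult.commute mult.left_commute)
  have "Q \<noteq> 0" using assms by auto
  then show ?thesis by (subst P) simp
qed

lemma indicator_product_nth:
  "fps_nth (Abs_fps (\<lambda>n. if P n then 1 else 0) * Abs_fps (\<lambda>n. if Q n then 1 else 0) :: rat fps) n =
    of_nat (card {a. a \<le> n \<and> P a \<and> Q (n - a)})"
proof -
  have "(\<Sum>a = 0..n. (if P a then 1 else 0) * (if Q (n - a) then 1 else 0) :: rat) =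
      (\<Sum>a\<in>{0..n}. if P a \<and> Q (n - a) then 1 else 0)"
    by (intro sum.cong) auto
  also have "\<dots> = (\<Sum>a\<in>{a \<in> {0..n}. P a \<and> Q (n - a)}. 1)"
    by (subst sum.inter_filter[symmetric]) simp_all
  also have "{a \<in> {0..n}. P a \<and> Q (n - a)} = {a. a \<le> n \<and> P a \<and> Q (n - a)}" by auto
  finally show ?thesis by (simp add: fps_mult_nth)
qed

lemma good_series_multiples:
  assumes "\<And>u v. good q u v \<longleftrightarrow> d dvd u \<and> d dvd v"
  shows "good_series q = multiples d ^ 2"
  by (rule fps_ext)
    (simp add: power2_eq_square multiples_def indicator_product_nth good_series_def good_count_def assms)

text \<open>Write u = r k and v = r l. As r is odd, u + v is even exactly if k and l have the same
  parity. Pairs of even multiples give M^2 with M = 1 / (1 - t^(2r)), pairs of odd ones (t^r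
  M)^2.\<close>

lemma good_series_odd:
  assumes good: "\<And>u v. good q u v \<longleftrightarrow> r dvd u \<and> r dvd v \<and> even (u + v)" and r: "odd r"
  shows "good_series q = multiples (2 * r) ^ 2 * (1 + fps_X ^ (2 * r))"
proof -
  \<comment> \<open>\<open>?P\<close> describes the odd multiples of r.\<close>
  let ?M = "multiples (2 * r)" and ?P = "\<lambda>n. r \<le> n \<and> 2 * r dvd n - r"
  have shift: "fps_X ^ r * ?M = Abs_fps (\<lambda>n. if ?P n then 1 else 0)"
    by (rule fps_ext) (auto simp: fps_X_power_mult_nth multiples_def)
  have r0: "r > 0" using r by (rule odd_pos)
  have P: "?P (r * k) \<longleftrightarrow> odd k" for k
  proof (cases k)
    case (Suc j)
    have "2 * r dvd r * j \<longleftrightarrow> even j" using r0 by (simp add: mult.commute[of 2])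
    then show ?thesis by (simp add: Suc)
  qed (use r0 in simp)
  have M: "2 * r dvd r * k \<longleftrightarrow> even k" for k using r0 by (simp add: mult.commute[of 2])
  have dvdP: "r dvd u" if "?P u" for u
    using that by (metis dvd_diffD1 dvd_mult_right dvd_refl le_add_diff_inverse dvd_add_right_iff)
  have iff: "good q u v \<longleftrightarrow> (2 * r dvd u \<and> 2 * r dvd v) \<or> (?P u \<and> ?P v)" for u v
  proof (cases "r dvd u \<and> r dvd v")
    case True
    then obtain k l where kl: "u = r * k" "v = r * l" by (auto simp: dvd_def)
    have "even (u + v) \<longleftrightarrow> (even k \<longleftrightarrow> even l)" using r by (simp add: kl)
    then show ?thesis using True unfolding good kl P M by auto
  next
    case False
    then show ?thesis using dvdP dvd_mult_right unfolding good by blast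
  qed
  have disj: "\<not> (2 * r dvd u \<and> ?P u)" for u
  proof
    assume u: "2 * r dvd u \<and> ?P u"
    then obtain k where "u = r * k" using dvdP by (auto simp: dvd_def)
    then show False using u P M by metis
  qed
  have "good_series q = ?M * ?M + (fps_X ^ r * ?M) * (fps_X ^ r * ?M)"
  proof (rule fps_ext)
    fix n
    let ?A = "{a. a \<le> n \<and> 2 * r dvd a \<and> 2 * r dvd (n - a)}" and ?B = "{a. a \<le> n \<and> ?P a \<and> ?P (n - a)}"
    have "{a. a \<le> n \<and> good q a (n - a)} = ?A \<union> ?B" unfolding iff by blast
    moreover have "?A \<inter> ?B = {}" using disj by blast
    moreover have "finite ?A" "finite ?B" by simp_all
    ultimately have "good_count q n = card ?A + card ?B"
      unfolding good_count_def by (simp only: card_Un_disjoint)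
    then show "fps_nth (good_series q) n = fps_nth (?M * ?M + (fps_X ^ r * ?M) * (fps_X ^ r * ?M)) n"
      unfolding shift by (simp only: good_series_def multiples_def fps_nth_Abs_fps fps_add_nth indicator_product_nth of_nat_add)
  qed
  moreover have "fps_X ^ (2 * r) = (fps_X ^ r * fps_X ^ r :: rat fps)" by (simp add: mult_2 power_add)
  ultimately show ?thesis by (simp only: power2_eq_square distrib_left mult_1_left mult_1_right mult_ac)
qed

section \<open>Powers of a root of unity and the condition \<open>good\<close>\<close>

lemma power_eq_one_iff_dvd:
  fixes q :: "'k::field"
  assumes "r \<ge> 1" "q ^ r = 1" "\<forall>m. 1 \<le> m \<and> m < r \<longrightarrow> q ^ m \<noteq> 1"
  shows "q ^ u = 1 \<longleftrightarrow> r dvd u"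
proof -
  have "q ^ u = q ^ (u mod r) * (q ^ r) ^ (u div r)"
    by (simp flip: power_mult power_add)
  then have "q ^ u = q ^ (u mod r)" using assms(2) by simp
  moreover have "u mod r < r" using assms(1) by simp
  moreover have "q ^ (u mod r) = 1 \<longleftrightarrow> u mod r = 0"
    using assms(3) \<open>u mod r < r\<close> by (cases "u mod r = 0") auto
  ultimately show ?thesis by (simp add: dvd_eq_mod_eq_0)
qed

lemma minus_one_eq_one_iff: "(- 1 :: 'k::field) = 1 \<longleftrightarrow> CHAR('k) = 2"
proof -
  have "(- 1 :: 'k) = 1 \<longleftrightarrow> of_nat 2 = (0 :: 'k)"
    by (metis add_eq_0_iff2 of_nat_numeral one_add_one)
  also have "\<dots> \<longleftrightarrow> CHAR('k) dvd 2" by (rule of_nat_eq_0_iff_char_dvd)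
  also have "\<dots> \<longleftrightarrow> CHAR('k) = 2"
    using CHAR_not_1[where 'a = 'k] by (metis One_nat_def dvd_refl prime_nat_iff two_is_prime_nat)
  finally show ?thesis .
qed

text \<open>For odd u + v the condition would require q^u = -1, and the r-th power of this equation
  reads 1 = -1.\<close>

lemma good_edge_odd_order:
  fixes q :: "'k::field"
  assumes "q ^ r = 1" and dvd: "\<And>u. q ^ u = 1 \<longleftrightarrow> r dvd u" and r: "odd r" and c: "(- 1 :: 'k) \<noteq> 1"
  shows "good q u v \<longleftrightarrow> r dvd u \<and> r dvd v \<and> even (u + v)"
proof (cases "even (u + v)")
  case True
  then show ?thesis by (simp add: good_def dvd)
next
  case False
  have "q ^ u \<noteq> - 1"
  proof
    assume "q ^ u = - 1"
    then have "(q ^ u) ^ r = - 1" using r by simp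
    moreover have "(q ^ u) ^ r = (q ^ r) ^ u" by (simp flip: power_mult add: mult.commute)
    ultimately show False using assms(1) c by simp
  qed
  then show ?thesis using False by (simp add: good_def)
qed

text \<open>For odd u + v both sides fail. If q^u = q^v = -1, then u and v are odd multiples of r/2
  and their sum is even; if r divides both, their sum is even as well.\<close>

lemma good_even_order:
  fixes q :: "'k::field"
  assumes dvd: "\<And>u. q ^ u = 1 \<longleftrightarrow> r dvd u" and r: "even r" "r > 0" and c: "(- 1 :: 'k) \<noteq> 1"
  shows "good q u v \<longleftrightarrow> r dvd u \<and> r dvd v"
proof (cases "even (u + v)")
  case True
  then show ?thesis by (simp add: good_def dvd)
next
  case False
  obtain h where h: "r = 2 * h" using r by auto
  have "even k" if k: "u = h * k" "q ^ u = 1" for u k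
  proof -
    have "2 * h dvd h * k" using that dvd by (simp add: h)
    then show ?thesis using r by (simp add: h mult.commute[of 2])
  qed
  have odd: "\<exists>k. u = h * k \<and> odd k" if u: "q ^ u = - 1" for u
  proof -
    have "q ^ (2 * u) = 1" using u by (simp add: power_mult mult.commute[of 2])
    then have "2 * h dvd 2 * u" using dvd by (simp add: h)
    then obtain k where k: "u = h * k" by (auto simp: dvd_def)
    have "odd k"
    proof
      assume "even k"
      then have "r dvd u" by (auto simp: h k)
      then have "q ^ u = 1" using dvd by simp
      then show False using u c by simp
    qed
    then show ?thesis using k by auto
  qed
  have "\<not> (q ^ u = - 1 \<and> q ^ v = - 1)"
  proof
    assume "q ^ u = - 1 \<and> q ^ v = - 1"
    then obtain k l where "u = h * k" "odd k" "v = h * l" "odd l" using odd by metis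
    then show False using False by (auto simp flip: distrib_left)
  qed
  moreover have "\<not> (r dvd u \<and> r dvd v)" using False r by (meson dvd_add dvd_trans)
  moreover have "(- 1) ^ (u + v) = (- 1 :: 'k)" using False by simp
  ultimately show ?thesis unfolding good_def by metis
qed

theorem mainTheorem2:
  fixes q :: "'k::field" and r :: nat
  assumes "r \<ge> 1" and "q ^ r = 1" and "\<forall>m. 1 \<le> m \<and> m < r \<longrightarrow> q ^ m \<noteq> 1"
  shows "(\<forall>i. vectorspace.fin_dim class_ring (HH (Lambda q) i)) \<and>
    (r > 1 \<and> odd r \<and> CHAR('k) \<noteq> 2 \<longrightarrow>
       hilbert_series (HH (Lambda q)) =
         1 + (1 + fps_X) ^ 2 * (1 + fps_X ^ (2 * r)) / (1 - fps_X ^ (2 * r)) ^ 2) \<and>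
    ((CHAR('k) = 2 \<and> q \<noteq> 1) \<or> (CHAR('k) \<noteq> 2 \<and> r > 2 \<and> even r) \<longrightarrow>
       hilbert_series (HH (Lambda q)) = 1 + (1 + fps_X) ^ 2 / (1 - fps_X ^ r) ^ 2) \<and>
    (CHAR('k) = 2 \<and> q = 1 \<longrightarrow>
       hilbert_series (HH (Lambda q)) = 4 / (1 - fps_X) ^ 2) \<and>
    (CHAR('k) \<noteq> 2 \<and> q = -1 \<longrightarrow>
       hilbert_series (HH (Lambda q)) = (4 - 4 * fps_X + fps_X ^ 2) / (1 - fps_X) ^ 2) \<and>
    (CHAR('k) \<noteq> 2 \<and> q = 1 \<longrightarrow>
       hilbert_series (HH (Lambda q)) = 2 / (1 - fps_X) ^ 2)"
proof (intro conjI impI allI)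
  have q0: "q \<noteq> 0" using assms(1,2) by (cases r) auto
  note dvd = power_eq_one_iff_dvd[OF assms]
  note hs = hilbert_series_HH_Lambda[OF q0]
  have char2: "(- 1 :: 'k) ^ n = 1" if "CHAR('k) = 2" for n
  proof -
    have "(- 1 :: 'k) = 1" using that by (simp only: minus_one_eq_one_iff)
    then show ?thesis by (simp only: power_one)
  qed
  have sign_cases: "(-1) ^ n = (1 :: 'k) \<or> (-1) ^ n = (-1 :: 'k)" for n by (cases "even n") auto
  \<comment> \<open>\<open>edge\<close> makes q a power of -1, so q^2 = 1 and the order is at most
    2; in characteristic 2 it makes q = 1.\<close>
  have no_edge: "edge_series q = 0" if "r > 2 \<or> CHAR('k) = 2 \<and> q \<noteq> 1"
  proof -
    have "\<not> edge q n" for n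
    proof
      assume e: "edge q n"
      then have "q = 1 \<or> q = - 1" using sign_cases[of "Suc n"] by (auto simp: edge_def)
      moreover from this have "q ^ 2 = 1" by auto
      then have "r \<le> 2" using dvd[of 2] by (auto dest: dvd_imp_le)
      ultimately show False using that minus_one_eq_one_iff[where 'k = 'k] by auto
    qed
    then show ?thesis by (intro fps_ext) (simp add: edge_series_def edge_count_def)
  qed
  have F1: "(1 - fps_X) * multiples 1 = 1" using multiples_eq[of 1] by simp
  show "vectorspace.fin_dim class_ring (HH (Lambda q) i)" for i by (rule HH_Lambda_dim(1)[OF q0])
  show "hilbert_series (HH (Lambda q)) = 1 + (1 + fps_X) ^ 2 * (1 + fps_X ^ (2 * r)) / (1 - fps_X ^ (2 * r)) ^ 2"
    if h: "r > 1 \<and> odd r \<and> CHAR('k) \<noteq> 2"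
  proof -
    have "r > 2" using h by (cases "r = 2") auto
    have "good_series q = multiples (2 * r) ^ 2 * (1 + fps_X ^ (2 * r))"
      by (rule good_series_odd) (use h good_edge_odd_order[OF assms(2) dvd] minus_one_eq_one_iff[where 'k = 'k] in auto)
    then show ?thesis
      using assms(1) unfolding hs no_edge[OF disjI1[OF \<open>r > 2\<close>]]
      by (simp add: fps_divide_square[OF multiples_eq] mult_ac)
  qed
  show "hilbert_series (HH (Lambda q)) = 1 + (1 + fps_X) ^ 2 / (1 - fps_X ^ r) ^ 2"
    if h: "(CHAR('k) = 2 \<and> q \<noteq> 1) \<or> (CHAR('k) \<noteq> 2 \<and> r > 2 \<and> even r)"
  proof -
    have "good q u v \<longleftrightarrow> r dvd u \<and> r dvd v" for u v
    proof (cases "CHAR('k) = 2")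
      case True
      then show ?thesis by (simp only: good_def char2 dvd)
    next
      case False
      then show ?thesis using h by (intro good_even_order[OF dvd]) (auto simp: minus_one_eq_one_iff)
    qed
    then have "good_series q = multiples r ^ 2" by (rule good_series_multiples)
    moreover have "edge_series q = 0" using h by (intro no_edge) auto
    ultimately show ?thesis
      using assms(1) unfolding hs by (simp add: fps_divide_square[OF multiples_eq])
  qed
  show "hilbert_series (HH (Lambda q)) = 4 / (1 - fps_X) ^ 2" if h: "CHAR('k) = 2 \<and> q = 1"
  proof -
    let ?F = "multiples 1"
    have G: "good_series q = ?F ^ 2"
      by (rule good_series_multiples) (use h in \<open>simp add: good_def char2 del: minus_one_power_iff\<close>)
    have "edge q n" for n using h by (simp only: edge_def char2)
    then have E: "edge_series q = ?F"
      by (intro fps_ext) (simp add: edge_series_def edge_count_def multiples_def)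
    \<comment> \<open>Since the edge series is F and the square series F^2, the total is the square
      of 1 + (1 + t) F. Writing 1 = (1 - t) F turns the base into 2 F.\<close>
    have "1 + (1 + fps_X) ^ 2 * ?F ^ 2 + ((1 + fps_X) * ?F + (1 + fps_X) * ?F) = (1 + (1 + fps_X) * ?F) ^ 2"
      by (simp add: power2_eq_square algebra_simps)
    also have "1 + (1 + fps_X) * ?F = ?F + ?F" by (subst F1[symmetric]) (simp add: algebra_simps)
    also have "(?F + ?F) ^ 2 = 4 * ?F ^ 2" by (simp add: power2_eq_square algebra_simps)
    finally show ?thesis unfolding hs G E fps_divide_square[OF F1] .
  qed
  show "hilbert_series (HH (Lambda q)) = (4 - 4 * fps_X + fps_X ^ 2) / (1 - fps_X) ^ 2" if h: "CHAR('k) \<noteq> 2 \<and> q = -1"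
  proof -
    let ?F = "multiples 1"
    have m: "(- 1 :: 'k) \<noteq> 1" using h by (simp add: minus_one_eq_one_iff)
    have r: "r = 2"
    proof -
      have "r dvd 2" using dvd[of 2] h by simp
      moreover have "r \<noteq> 1" using assms(2) h m by auto
      ultimately show ?thesis by (metis One_nat_def prime_nat_iff two_is_prime_nat)
    qed
    have G: "good_series q = multiples 2 ^ 2"
      by (rule good_series_multiples) (use good_even_order[OF dvd] r m in auto)
    \<comment> \<open>For q = -1 the edges with zero differential start in the even degrees.\<close>
    have E: "edge_series q = multiples 2"
      by (rule fps_ext) (use h m in \<open>auto simp: edge_series_def edge_count_def edge_def multiples_def minus_one_power_iff\<close>)
    have "(1 - fps_X) * ((1 + fps_X) * multiples 2) = 1"
      using multiples_eq[of 2] by (simp add: power2_eq_square algebra_simps)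
    then have F: "(1 + fps_X) * multiples 2 = ?F"
      using F1 by (rule right_inverse_unique)
    have "1 + (1 + fps_X) ^ 2 * multiples 2 ^ 2 + ((1 + fps_X) * multiples 2 + (1 + fps_X) * multiples 2) = (1 + (1 + fps_X) * multiples 2) ^ 2"
      by (simp add: power2_eq_square algebra_simps)
    \<comment> \<open>As (1 + t) / (1 - t^2) = F, the base of the square is (1 - t) F + F; its
      factor 2 - t produces the numerator 4 - 4 t + t^2.\<close>
    also have "1 + (1 + fps_X) * multiples 2 = (2 - fps_X) * ?F"
      unfolding F by (subst F1[symmetric]) (simp add: algebra_simps)
    also have "((2 - fps_X) * ?F) ^ 2 = (4 - 4 * fps_X + fps_X ^ 2) * ?F ^ 2"
      by (simp add: power2_eq_square algebra_simps)
    finally show ?thesis unfolding hs G E fps_divide_square[OF F1] .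
  qed
  show "hilbert_series (HH (Lambda q)) = 2 / (1 - fps_X) ^ 2" if h: "CHAR('k) \<noteq> 2 \<and> q = 1"
  proof -
    let ?F = "multiples 1"
    have m: "(- 1 :: 'k) \<noteq> 1" using h by (simp add: minus_one_eq_one_iff)
    have r: "r = 1" using dvd[of 1] h by simp
    have G: "good_series q = multiples (2 * r) ^ 2 * (1 + fps_X ^ (2 * r))"
      by (rule good_series_odd) (use good_edge_odd_order[OF assms(2) dvd] r m in auto)
    \<comment> \<open>For q = 1 the edges with zero differential start in the odd degrees, so the
      series is not the square root of the other one and no square can be completed.\<close>
    have E: "edge_series q = fps_X * multiples 2"
      by (rule fps_ext) (use h m in \<open>auto simp: edge_series_def edge_count_def edge_def multiples_def minus_one_power_iff\<close>)
    have "(1 - fps_X) * ((1 + fps_X) * multiples 2) = 1"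
      using multiples_eq[of 2] by (simp add: power2_eq_square algebra_simps)
    then have F: "(1 + fps_X) * multiples 2 = ?F"
      using F1 by (rule right_inverse_unique)
    have 1: "((1 - fps_X) * ?F) ^ 2 = 1" "(1 - fps_X) * ?F = 1" using F1 by simp_all
    have "1 + (1 + fps_X) ^ 2 * (multiples 2 ^ 2 * (1 + fps_X ^ 2)) +
        ((1 + fps_X) * (fps_X * multiples 2) + (1 + fps_X) * (fps_X * multiples 2)) =
      1 + ((1 + fps_X) * multiples 2) ^ 2 * (1 + fps_X ^ 2) + 2 * fps_X * ((1 + fps_X) * multiples 2) * 1"
      by (simp add: power2_eq_square algebra_simps)
    \<comment> \<open>Over the denominator (1 - t)^2 the numerator is (1 - t)^2 + (1 + t^2) + 2 t (1
      - t) = 2.\<close>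
    also have "\<dots> = ((1 - fps_X) * ?F) ^ 2 + ?F ^ 2 * (1 + fps_X ^ 2) + 2 * fps_X * ?F * ((1 - fps_X) * ?F)"
      unfolding F 1 by simp
    also have "\<dots> = 2 * ?F ^ 2" by (simp add: power2_eq_square algebra_simps)
    finally show ?thesis unfolding hs G E fps_divide_square[OF F1] r by simp
  qed
qed

end
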